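(* For $0\le t\le m$ let $\tau_t$ be the element of $G_N$ given (in blocks of sizes $m,r,m,m,r,m$) by $$\tau_t=\begin{bmatrix}1_m&0&0&0&0&0\\0&1_r&0&0&0_r&0\\0&0&1_m&0&0&0\\0&0&e_t&1_m&0&0\\0&0_r&0&0&1_r&0\\ e_t^*&0&0&0&0&1_m\end{bmatrix},\qquad e_t=\begin{bmatrix}1_t&0\\0&0\end{bmatrix}\in M_m(\mathbb B).$$ Then $\{\tau_t:0\le t\le m\}$ is a complete set of representatives of $P_N\backslash G_N/(G_n\times G_n)$.
   Context: $\mathbb B=\mathbb Q\oplus\mathbb Q\zeta\oplus\mathbb Q\xi\oplus\mathbb Q\zeta\xi$ is a definite quaternion algebra over $\mathbb Q$, $\zeta^2=\alpha$, $\xi^2=\beta$, $\zeta\xi=-\xi\zeta$ with $\alpha,\beta<0$ squarefree integers; for a matrix $X$ over $\mathbb B$, $X^*={}^t\overline X$ with the main involution. Let $n=2m+r$ with $m>1$, and $N=2n$. Groups of $\mathbb Q$-points: $$G_n=\{g\in\mathrm{GL}_n(\mathbb B):g^*\phi g=\phi\},\quad\phi=\begin{bmatrix}0&0&-1_m\\0&\zeta1_r&0\\1_m&0&0\end{bmatrix},$$ $$G_N=\{g\in\mathrm{GL}_N(\mathbb B):g^*J_ng=J_n\},\quad J_n=\begin{bmatrix}0&-1_n\\1_n&0\end{bmatrix}.$$ $P_N=\left\{\begin{bmatrix}a&b\\ c&d\end{bmatrix}\in G_N:c=0\right\}$ ($n\times n$ blocks) is the Siegel parabolic subgroup. $G_n\times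 G_n$ is regarded as a subgroup of $G_N$ through the doubling embedding $g_1\times g_2\mapsto R^{-1}\mathrm{diag}[g_1,g_2]R$, where (block sizes $m,r,m,m,r,m$) $$R=\begin{bmatrix}1_m&0&0&0&0&0\\0&\frac12&0&0&-\zeta^{-1}&0\\0&0&0&1_m&0&0\\0&0&-1_m&0&0&0\\0&-\frac12&0&0&-\zeta^{-1}&0\\0&0&0&0&0&1_m\end{bmatrix},$$ which satisfies $R^*\mathrm{diag}[\phi,-\phi]R=J_n$.
   Formalization: It is assumed in addition that the block ζ1_r of φ is anisotropic (automatic for r ≤ 1); otherwise, e.g. for α = β = −1, r = 2 with isotropic vector (1, ξ), there are more than m+1 double cosets and the τ_t with 0 ≤ t ≤ m are not complete. *)

theory Defs
  imports
    "HOL-Computational_Algebra.Squarefree"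
    "Jordan_Normal_Form.Matrix"
begin

section \<open>Definite quaternion algebras over the rationals\<close>

text \<open>The structure map of a division algebra over the rationals
  (\<^const>\<open>of_rat\<close> is only available for commutative fields).\<close>

definition rat_embed :: "rat \<Rightarrow> 'b::{division_ring,ring_char_0}" where
  "rat_embed q = (case quotient_of q of (a, b) \<Rightarrow> of_int a / of_int b)"

definition quat_comb ::
    "'b::{division_ring,ring_char_0} \<Rightarrow> 'b \<Rightarrow> rat \<times> rat \<times> rat \<times> rat \<Rightarrow> 'b" where
  "quat_comb \<zeta> \<xi> = (\<lambda>(a, b, c, d).
     rat_embed a + rat_embed b * \<zeta> + rat_embed c * \<xi> + rat_embed d * (\<zeta> * \<xi>))"

text \<open>The algebra is the whole type \<open>'b\<close>. The direct sum decomposition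
  \<open>\<rat> \<oplus> \<rat>\<zeta> \<oplus> \<rat>\<xi> \<oplus> \<rat>\<zeta>\<xi>\<close> is the bijectivity of \<^const>\<open>quat_comb\<close>. Definiteness is
  \<open>\<alpha>, \<beta> < 0\<close>; as a definite quaternion algebra is a division ring, the sort of \<open>'b\<close>
  imposes no further restriction.\<close>

definition definite_quaternion_algebra ::
    "int \<Rightarrow> int \<Rightarrow> 'b::{division_ring,ring_char_0} \<Rightarrow> 'b \<Rightarrow> bool" where
  "definite_quaternion_algebra \<alpha> \<beta> \<zeta> \<xi> \<longleftrightarrow>
     \<alpha> < 0 \<and> \<beta> < 0 \<and> squarefree \<alpha> \<and> squarefree \<beta> \<and>
     \<zeta> ^ 2 = of_int \<alpha> \<and> \<xi> ^ 2 = of_int \<beta> \<and> \<zeta> * \<xi> = - (\<xi> * \<zeta>) \<and>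
     bij (quat_comb \<zeta> \<xi>)"

text \<open>The main involution.\<close>

definition quat_conj :: "'b::{division_ring,ring_char_0} \<Rightarrow> 'b \<Rightarrow> 'b \<Rightarrow> 'b" where
  "quat_conj \<zeta> \<xi> x =
     (case inv_into UNIV (quat_comb \<zeta> \<xi>) x of (a, b, c, d) \<Rightarrow> quat_comb \<zeta> \<xi> (a, - b, - c, - d))"


section \<open>Matrices\<close>

definition quat_adjoint ::
    "'b::{division_ring,ring_char_0} \<Rightarrow> 'b \<Rightarrow> 'b mat \<Rightarrow> 'b mat" where
  "quat_adjoint \<zeta> \<xi> X = map_mat (quat_conj \<zeta> \<xi>) (transpose_mat X)"

definition append_cols :: "'b::zero mat \<Rightarrow> 'b mat \<Rightarrow> 'b mat" where
  "append_cols A B = four_block_mat A B (0\<^sub>m 0 (dim_col A)) (0\<^sub>m 0 (dim_col B))"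

fun block_row :: "'b::zero mat list \<Rightarrow> 'b mat" where
  "block_row [] = 0\<^sub>m 0 0"
| "block_row [A] = A"
| "block_row (A # As) = append_cols A (block_row As)"

fun block_mat :: "'b::zero mat list list \<Rightarrow> 'b mat" where
  "block_mat [] = 0\<^sub>m 0 0"
| "block_mat [As] = block_row As"
| "block_mat (As # Bs) = block_row As @\<^sub>r block_mat Bs"


section \<open>The groups and the doubling embedding\<close>

text \<open>The isometry group of a square matrix \<open>H\<close>.\<close>

definition isometry_group ::
    "'b::{division_ring,ring_char_0} \<Rightarrow> 'b \<Rightarrow> 'b mat \<Rightarrow> 'b mat set" where
  "isometry_group \<zeta> \<xi> H =
     {g \<in> carrier_mat (dim_row H) (dim_row H). invertible_mat g \<and> quat_adjoint \<zeta> \<xi> g * H * g = H}"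

definition phi_mat :: "'b::{division_ring,ring_char_0} \<Rightarrow> nat \<Rightarrow> nat \<Rightarrow> 'b mat" where
  "phi_mat \<zeta> m r = block_mat
    [[0\<^sub>m m m, 0\<^sub>m m r,       - 1\<^sub>m m],
     [0\<^sub>m r m, \<zeta> \<cdot>\<^sub>m 1\<^sub>m r, 0\<^sub>m r m],
     [1\<^sub>m m,   0\<^sub>m m r,       0\<^sub>m m m]]"

definition J_mat :: "nat \<Rightarrow> 'b::{division_ring,ring_char_0} mat" where
  "J_mat n = four_block_mat (0\<^sub>m n n) (- 1\<^sub>m n) (1\<^sub>m n) (0\<^sub>m n n)"

text \<open>\<open>G\<^sub>n\<close> with \<open>n = 2m + r\<close>, and \<open>G\<^sub>N\<close> with \<open>N = 2n\<close> (indexed by \<open>n\<close>).\<close>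

definition G_small :: "'b::{division_ring,ring_char_0} \<Rightarrow> 'b \<Rightarrow> nat \<Rightarrow> nat \<Rightarrow> 'b mat set" where
  "G_small \<zeta> \<xi> m r = isometry_group \<zeta> \<xi> (phi_mat \<zeta> m r)"

definition G_big :: "'b::{division_ring,ring_char_0} \<Rightarrow> 'b \<Rightarrow> nat \<Rightarrow> 'b mat set" where
  "G_big \<zeta> \<xi> n = isometry_group \<zeta> \<xi> (J_mat n)"

definition siegel_parabolic ::
    "'b::{division_ring,ring_char_0} \<Rightarrow> 'b \<Rightarrow> nat \<Rightarrow> 'b mat set" where
  "siegel_parabolic \<zeta> \<xi> n =
     {g \<in> G_big \<zeta> \<xi> n. \<exists>a b d. a \<in> carrier_mat n n \<and> b \<in> carrier_mat n n \<and> d \<in> carrier_mat n n \<and>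
        g = four_block_mat a b (0\<^sub>m n n) d}"

definition R_mat :: "'b::{division_ring,ring_char_0} \<Rightarrow> nat \<Rightarrow> nat \<Rightarrow> 'b mat" where
  "R_mat \<zeta> m r = block_mat
    [[1\<^sub>m m,   0\<^sub>m m r,              0\<^sub>m m m, 0\<^sub>m m m, 0\<^sub>m m r,                  0\<^sub>m m m],
     [0\<^sub>m r m, (1 / 2) \<cdot>\<^sub>m 1\<^sub>m r,     0\<^sub>m r m, 0\<^sub>m r m, (- inverse \<zeta>) \<cdot>\<^sub>m 1\<^sub>m r, 0\<^sub>m r m],
     [0\<^sub>m m m, 0\<^sub>m m r,              0\<^sub>m m m, 1\<^sub>m m,   0\<^sub>m m r,                  0\<^sub>m m m],
     [0\<^sub>m m m, 0\<^sub>m m r,              - 1\<^sub>m m, 0\<^sub>m m m, 0\<^sub>m m r,                  0\<^sub>m m m],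
     [0\<^sub>m r m, (- (1 / 2)) \<cdot>\<^sub>m 1\<^sub>m r, 0\<^sub>m r m, 0\<^sub>m r m, (- inverse \<zeta>) \<cdot>\<^sub>m 1\<^sub>m r, 0\<^sub>m r m],
     [0\<^sub>m m m, 0\<^sub>m m r,              0\<^sub>m m m, 0\<^sub>m m m, 0\<^sub>m m r,                  1\<^sub>m m]]"

definition doubling ::
    "'b::{division_ring,ring_char_0} \<Rightarrow> nat \<Rightarrow> nat \<Rightarrow> 'b mat \<Rightarrow> 'b mat \<Rightarrow> 'b mat" where
  "doubling \<zeta> m r g1 g2 =
     inv\<^bsub>ring_mat TYPE('b) (2 * (2 * m + r)) ()\<^esub> (R_mat \<zeta> m r) * diag_block_mat [g1, g2] * R_mat \<zeta> m r"

text \<open>\<open>G\<^sub>n \<times> G\<^sub>n\<close> as a subgroup of \<open>G\<^sub>N\<close>.\<close>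

definition doubled_subgroup ::
    "'b::{division_ring,ring_char_0} \<Rightarrow> 'b \<Rightarrow> nat \<Rightarrow> nat \<Rightarrow> 'b mat set" where
  "doubled_subgroup \<zeta> \<xi> m r =
     {doubling \<zeta> m r g1 g2 | g1 g2. g1 \<in> G_small \<zeta> \<xi> m r \<and> g2 \<in> G_small \<zeta> \<xi> m r}"

definition e_mat :: "nat \<Rightarrow> nat \<Rightarrow> 'b::{division_ring,ring_char_0} mat" where
  "e_mat m t = four_block_mat (1\<^sub>m t) (0\<^sub>m t (m - t)) (0\<^sub>m (m - t) t) (0\<^sub>m (m - t) (m - t))"

definition tau_mat ::
    "'b::{division_ring,ring_char_0} \<Rightarrow> 'b \<Rightarrow> nat \<Rightarrow> nat \<Rightarrow> nat \<Rightarrow> 'b mat" where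
  "tau_mat \<zeta> \<xi> m r t = block_mat
    [[1\<^sub>m m,                           0\<^sub>m m r, 0\<^sub>m m m,   0\<^sub>m m m, 0\<^sub>m m r, 0\<^sub>m m m],
     [0\<^sub>m r m,                         1\<^sub>m r,   0\<^sub>m r m,   0\<^sub>m r m, 0\<^sub>m r r, 0\<^sub>m r m],
     [0\<^sub>m m m,                         0\<^sub>m m r, 1\<^sub>m m,     0\<^sub>m m m, 0\<^sub>m m r, 0\<^sub>m m m],
     [0\<^sub>m m m,                         0\<^sub>m m r, e_mat m t, 1\<^sub>m m,   0\<^sub>m m r, 0\<^sub>m m m],
     [0\<^sub>m r m,                         0\<^sub>m r r, 0\<^sub>m r m,   0\<^sub>m r m, 1\<^sub>m r,   0\<^sub>m r m],
     [quat_adjoint \<zeta> \<xi> (e_mat m t), 0\<^sub>m m r, 0\<^sub>m m m,   0\<^sub>m m m, 0\<^sub>m m r, 1\<^sub>m m]]"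


section \<open>Double cosets\<close>

definition double_coset :: "'b::semiring_1 mat set \<Rightarrow> 'b mat \<Rightarrow> 'b mat set \<Rightarrow> 'b mat set" where
  "double_coset P g H = {p * g * h | p h. p \<in> P \<and> h \<in> H}"

definition complete_double_coset_reps ::
    "'b::semiring_1 mat set \<Rightarrow> 'b mat set \<Rightarrow> 'b mat set \<Rightarrow> 'b mat set \<Rightarrow> bool" where
  "complete_double_coset_reps P G H S \<longleftrightarrow>
     S \<subseteq> G \<and> bij_betw (\<lambda>s. double_coset P s H) S ((\<lambda>g. double_coset P g H) ` G)"


section \<open>Anisotropy of the middle block\<close>

text \<open>The middle block \<open>\<zeta>1\<^sub>r\<close> of \<open>\<phi>\<close> is meant to be its anisotropic kernel, so that \<open>m\<close> is the
  Witt index of \<open>\<phi>\<close>. This is automatic for \<open>r \<le> 1\<close> (shown below) but not for larger \<open>r\<close>: for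
  \<open>\<alpha> = \<beta> = -1\<close> and \<open>r = 2\<close> the vector \<open>(1, \<xi>)\<close> is isotropic, since
  \<open>\<zeta> + (-\<xi>)\<zeta>\<xi> = \<zeta> + \<beta>\<zeta> = 0\<close>. The double cosets are classified by an integer between
  \<open>0\<close> and the Witt index, so there are exactly \<open>m + 1\<close> of them if and only if
  \<open>\<zeta>1\<^sub>r\<close> is anisotropic.\<close>

definition anisotropic_block :: "'b::{division_ring,ring_char_0} \<Rightarrow> 'b \<Rightarrow> nat \<Rightarrow> bool" where
  "anisotropic_block \<zeta> \<xi> r \<longleftrightarrow>
     (\<forall>x \<in> carrier_mat r 1.
        quat_adjoint \<zeta> \<xi> x * (\<zeta> \<cdot>\<^sub>m 1\<^sub>m r) * x = 0\<^sub>m 1 1 \<longrightarrow> x = 0\<^sub>m r 1)"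

lemma rat_embed_0: "rat_embed 0 = 0"
  by (simp add: rat_embed_def)

lemma quat_conj_eq_0:
  assumes "definite_quaternion_algebra \<alpha> \<beta> \<zeta> \<xi>" and "quat_conj \<zeta> \<xi> x = 0"
  shows "x = 0"
proof -
  have b: "bij (quat_comb \<zeta> \<xi>)"
    using assms(1) by (simp add: definite_quaternion_algebra_def)
  obtain a b c d where x: "inv_into UNIV (quat_comb \<zeta> \<xi>) x = (a, b, c, d)"
    by (metis surj_pair)
  have z: "quat_comb \<zeta> \<xi> (0, 0, 0, 0) = 0"
    by (simp add: quat_comb_def rat_embed_0)
  have "quat_comb \<zeta> \<xi> (a, - b, - c, - d) = quat_comb \<zeta> \<xi> (0, 0, 0, 0)"
    using assms(2) x z by (simp add: quat_conj_def)
  then have "(a, - b, - c, - d) = (0, 0, 0, 0)"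
    using b by (meson bij_is_inj injD)
  then have "inv_into UNIV (quat_comb \<zeta> \<xi>) x = (0, 0, 0, 0)"
    using x by simp
  then show ?thesis
    using b z by (metis bij_inv_eq_iff)
qed

lemma anisotropic_block_le_1:
  assumes q: "definite_quaternion_algebra \<alpha> \<beta> \<zeta> \<xi>" and "r \<le> 1"
  shows "anisotropic_block \<zeta> \<xi> r"
proof (cases "r = 0")
  case True
  then show ?thesis by (auto simp: anisotropic_block_def)
next
  case False
  then have r: "r = 1" using assms(2) by simp
  have z: "\<zeta> \<noteq> 0"
    using q by (auto simp: definite_quaternion_algebra_def power2_eq_square)
  show ?thesis unfolding anisotropic_block_def r
  proof (intro ballI impI)
    fix x :: "'a mat"
    assume x: "x \<in> carrier_mat 1 1"
      and e: "quat_adjoint \<zeta> \<xi> x * (\<zeta> \<cdot>\<^sub>m 1\<^sub>m 1) * x = 0\<^sub>m 1 1"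
    have "(quat_adjoint \<zeta> \<xi> x * (\<zeta> \<cdot>\<^sub>m 1\<^sub>m 1) * x) $$ (0, 0)
        = quat_conj \<zeta> \<xi> (x $$ (0, 0)) * \<zeta> * x $$ (0, 0)"
      using x by (simp add: quat_adjoint_def scalar_prod_def)
    then have "quat_conj \<zeta> \<xi> (x $$ (0, 0)) = 0 \<or> x $$ (0, 0) = 0"
      using e z by simp
    then have "x $$ (0, 0) = 0"
      using quat_conj_eq_0[OF q] by blast
    then show "x = 0\<^sub>m 1 1"
      using x by (intro eq_matI) auto
  qed
qed

end

theory Submission
  imports Defs
begin

text \<open>A coset \<open>P g\<close> is the Lagrangian row space of the lower half of \<open>g\<close>. In the coordinates given by \<open>R\<close> it
  is the row space of a matrix \<open>(A | B)\<close> whose halves have the same Gram matrix with respect to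
  \<open>\<psi> = \<phi>\<^bsup>-1\<^esup>\<close>, and \<open>G\<^sub>n \<times> G\<^sub>n\<close> acts by \<open>(A | B) \<mapsto> (A g | B h)\<close>. The rank of \<open>A\<close> is an invariant. Row
  reduction brings \<open>A\<close> and \<open>B\<close> to the shapes \<open>(A\<^sub>1, A\<^sub>2, 0)\<close> and \<open>(B\<^sub>1, 0, B\<^sub>2)\<close>, where \<open>A\<^sub>2\<close> and \<open>B\<^sub>2\<close> are
  isotropic with \<open>n - rank A\<close> rows, and Witt's extension theorem first makes \<open>(A\<^sub>1, A\<^sub>2) = (B\<^sub>1, B\<^sub>2)\<close> and then
  moves \<open>A\<^sub>2\<close> to any other isotropic system of the same size, so the rank is the only invariant. As the
  Witt index of \<open>\<phi>\<close> is \<open>m\<close>, the ranks that occur are \<open>n - m, \<dots>, n\<close>, and \<open>\<tau>\<^sub>t\<close> has rank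
  \<open>n - (m - t)\<close>.\<close>

text \<open>Cosets \<open>P g\<close> carry an action from the right, so subspaces are spans of
  rows. The form on rows is \<psi> = \<phi>^-1 because \<open>adj g * \<phi> * g = \<phi>\<close>
  and \<open>g * \<psi> * adj g = \<psi>\<close> define the same group; on the doubled space J^-1 =
  -J appears for the same reason. Quaternions do not commute, so determinants are of no use:
  independence of rows is expressed by a right inverse, and every dimension count comes down to the
  single inequality \<open>mult_eq_one_mat_le\<close>. The obstacle is that a row operation acts on
  both halves of (A | B) at once, so the halves cannot be normalised separately: once A is reduced,
  B may only be changed by operations that respect the zero rows of A. The number of isotropic rows
  that result is the defect n - rank A, which the Witt index bounds; this is the place where
  anisotropy of the middle block enters. Witt's theorem has to cover degenerate subspaces, since the
  spans to be moved contain their isotropic parts.\<close>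

lemma assoc_mult_mat_dim:
  fixes A B C :: "'a::semiring_0 mat"
  assumes "dim_col A = dim_row B" "dim_col B = dim_row C"
  shows "A * B * C = A * (B * C)"
  using assms by (intro assoc_mult_mat[of _ "dim_row A" "dim_col A" _ "dim_col B" _ "dim_col C"]) auto

lemma mult_add_mat_dim:
  fixes A B C :: "'a::semiring_0 mat"
  assumes "dim_col A = dim_row C" "dim_row B = dim_row C" "dim_col B = dim_col C"
  shows "A * (B + C) = A * B + A * C"
  using assms by (intro mult_add_distrib_mat[of _ "dim_row A" "dim_col A" _ "dim_col B"]) auto

lemma add_mult_mat_dim:
  fixes A B C :: "'a::semiring_0 mat"
  assumes "dim_col B = dim_row C" "dim_row A = dim_row B" "dim_col A = dim_col B"
  shows "(A + B) * C = A * C + B * C"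
  using assms by (intro add_mult_distrib_mat[of _ "dim_row A" "dim_col A" _ _ "dim_col C"]) auto

lemma mult_minus_mat_dim:
  fixes A B C :: "'a::ring mat"
  assumes "dim_col A = dim_row C" "dim_row B = dim_row C" "dim_col B = dim_col C"
  shows "A * (B - C) = A * B - A * C"
  using assms by (intro mult_minus_distrib_mat[of _ "dim_row A" "dim_col A" _ "dim_col B"]) auto

lemma minus_mult_mat_dim:
  fixes A B C :: "'a::ring mat"
  assumes "dim_col B = dim_row C" "dim_row A = dim_row B" "dim_col A = dim_col B"
  shows "(A - B) * C = A * C - B * C"
  using assms by (intro minus_mult_distrib_mat[of _ "dim_row A" "dim_col A" _ _ "dim_col C"]) auto

lemma uminus_mult_mat_dim:
  fixes A B :: "'a::ring mat"
  assumes "dim_col A = dim_row B"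
  shows "- A * B = - (A * B)" "A * - B = - (A * B)"
  using assms by (auto intro!: eq_matI simp: scalar_prod_def sum_negf)

lemma zero_mult_mat_dim:
  fixes A :: "'a::semiring_0 mat"
  shows "l = dim_row A \<Longrightarrow> 0\<^sub>m k l * A = 0\<^sub>m k (dim_col A)"
    and "dim_col A = l \<Longrightarrow> A * 0\<^sub>m l k = 0\<^sub>m (dim_row A) k"
  by (auto intro!: eq_matI simp: scalar_prod_def)

lemma one_mult_mat_dim:
  fixes A :: "'a::semiring_1 mat"
  shows "l = dim_row A \<Longrightarrow> 1\<^sub>m l * A = A" and "dim_col A = l \<Longrightarrow> A * 1\<^sub>m l = A"
  by auto

lemma zero_add_mat_dim:
  fixes A :: "'a::group_add mat"
  shows "k = dim_row A \<Longrightarrow> l = dim_col A \<Longrightarrow> 0\<^sub>m k l + A = A"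
    and "k = dim_row A \<Longrightarrow> l = dim_col A \<Longrightarrow> A + 0\<^sub>m k l = A"
    and "k = dim_row A \<Longrightarrow> l = dim_col A \<Longrightarrow> A - 0\<^sub>m k l = A"
    and "k = dim_row A \<Longrightarrow> l = dim_col A \<Longrightarrow> 0\<^sub>m k l - A = - A"
    and "A - A = 0\<^sub>m (dim_row A) (dim_col A)"
    and "- (0\<^sub>m k l :: 'a mat) = 0\<^sub>m k l"
    and "- A + A = 0\<^sub>m (dim_row A) (dim_col A)"
    and "A + - A = 0\<^sub>m (dim_row A) (dim_col A)"
  by (auto intro!: eq_matI)

text \<open>The side conditions are equations between dimensions, with no inner dimension to be
  guessed as in \<open>carrier_mat\<close>, so that rewriting can discharge them.\<close>

lemmas mat_dim_simps = assoc_mult_mat_dim mult_add_mat_dim add_mult_mat_dim mult_minus_mat_dim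
  minus_mult_mat_dim uminus_mult_mat_dim zero_mult_mat_dim one_mult_mat_dim zero_add_mat_dim

text \<open>Products are kept nested to the right, and there a known product \<open>A * B\<close> is
  no longer a subterm.\<close>

lemma mult_mat_shift:
  fixes A B C :: "'a::semiring_0 mat"
  assumes "A * B = D" "dim_col A = dim_row B" "dim_col B = dim_row C"
  shows "A * (B * C) = D * C"
  using assms assoc_mult_mat_dim[of A B C] by simp

section \<open>Stacking matrices by rows and by columns\<close>

lemma dim_append_rows [simp]:
  "dim_row (A @\<^sub>r B) = dim_row A + dim_row B" "dim_col (A @\<^sub>r B) = dim_col A"
  by (simp_all add: append_rows_def)

lemma dim_append_cols [simp]:
  "dim_row (append_cols A B) = dim_row A" "dim_col (append_cols A B) = dim_col A + dim_col B"
  by (simp_all add: append_cols_def)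

lemma index_append_rows:
  assumes "i < dim_row A + dim_row B" "j < dim_col A"
  shows "(A @\<^sub>r B) $$ (i, j) = (if i < dim_row A then A $$ (i, j) else B $$ (i - dim_row A, j))"
  using assms by (simp add: append_rows_def)

lemma index_append_cols:
  assumes "i < dim_row A" "j < dim_col A + dim_col B"
  shows "append_cols A B $$ (i, j) = (if j < dim_col A then A $$ (i, j) else B $$ (i, j - dim_col A))"
  using assms by (simp add: append_cols_def)

lemma append_rows_assoc:
  assumes "dim_col A = dim_col B"
  shows "(A @\<^sub>r B) @\<^sub>r C = A @\<^sub>r (B @\<^sub>r C)"
  using assms by (intro eq_matI) (auto simp: index_append_rows)

lemma append_cols_assoc:
  assumes "dim_row A = dim_row B"
  shows "append_cols (append_cols A B) C = append_cols A (append_cols B C)"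
  using assms by (intro eq_matI) (auto simp: index_append_cols)

lemma four_block_mat_eq_append:
  assumes "dim_row A = dim_row B" "dim_row C = dim_row D" "dim_col A = dim_col C" "dim_col B = dim_col D"
  shows "four_block_mat A B C D = append_cols A B @\<^sub>r append_cols C D"
  using assms by (intro eq_matI) (auto simp: index_append_rows index_append_cols)

lemma append_cols_append_rows:
  assumes "dim_row A = dim_row B" "dim_row C = dim_row D" "dim_col A = dim_col C" "dim_col B = dim_col D"
  shows "append_cols (A @\<^sub>r C) (B @\<^sub>r D) = append_cols A B @\<^sub>r append_cols C D"
  using assms by (intro eq_matI) (auto simp: index_append_rows index_append_cols)

lemma append_rows_inject:
  assumes "A @\<^sub>r B = C @\<^sub>r D" "dim_row A = dim_row C" "dim_col A = dim_col B" "dim_col C = dim_col D"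
  shows "A = C" "B = D"
proof -
  have c: "dim_col A = dim_col C" and r: "dim_row B = dim_row D"
    using assms(1,2) by (metis dim_append_rows(2), metis dim_append_rows(1) add_left_cancel)
  have e: "(A @\<^sub>r B) $$ (i, j) = (C @\<^sub>r D) $$ (i, j)" for i j using assms(1) by simp
  show "A = C"
  proof (rule eq_matI)
    fix i j assume "i < dim_row C" "j < dim_col C"
    then show "A $$ (i, j) = C $$ (i, j)"
      using e[of i j] assms(2-) c by (simp add: index_append_rows)
  qed (use assms c in auto)
  show "B = D"
  proof (rule eq_matI)
    fix i j assume "i < dim_row D" "j < dim_col D"
    then show "B $$ (i, j) = D $$ (i, j)"
      using e[of "dim_row C + i" j] assms(2-) c r by (simp add: index_append_rows)
  qed (use assms c r in auto)
qed

lemma append_cols_inject: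
  assumes "append_cols A B = append_cols C D" "dim_col A = dim_col C"
    "dim_row A = dim_row B" "dim_row C = dim_row D"
  shows "A = C" "B = D"
proof -
  have c: "dim_row A = dim_row C" and r: "dim_col B = dim_col D"
    using assms(1,2) by (metis dim_append_cols(1), metis dim_append_cols(2) add_left_cancel)
  have e: "append_cols A B $$ (i, j) = append_cols C D $$ (i, j)" for i j using assms(1) by simp
  show "A = C"
  proof (rule eq_matI)
    fix i j assume "i < dim_row C" "j < dim_col C"
    then show "A $$ (i, j) = C $$ (i, j)"
      using e[of i j] assms(2-) c by (simp add: index_append_cols)
  qed (use assms c in auto)
  show "B = D"
  proof (rule eq_matI)
    fix i j assume "i < dim_row D" "j < dim_col D"
    then show "B $$ (i, j) = D $$ (i, j)"
      using e[of i "dim_col C + j"] assms(2-) c r by (simp add: index_append_cols)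
  qed (use assms c r in auto)
qed

lemma append_rows_split:
  assumes "dim_row M = a + b"
  obtains X Y where "X \<in> carrier_mat a (dim_col M)" "Y \<in> carrier_mat b (dim_col M)" "M = X @\<^sub>r Y"
proof
  let ?X = "mat a (dim_col M) (\<lambda>(i, j). M $$ (i, j))"
  let ?Y = "mat b (dim_col M) (\<lambda>(i, j). M $$ (a + i, j))"
  show "?X \<in> carrier_mat a (dim_col M)" "?Y \<in> carrier_mat b (dim_col M)" by auto
  show "M = ?X @\<^sub>r ?Y"
    using assms by (intro eq_matI) (auto simp: index_append_rows)
qed

lemma append_cols_split:
  assumes "dim_col M = a + b"
  obtains X Y where "X \<in> carrier_mat (dim_row M) a" "Y \<in> carrier_mat (dim_row M) b" "M = append_cols X Y"
proof
  let ?X = "mat (dim_row M) a (\<lambda>(i, j). M $$ (i, j))"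
  let ?Y = "mat (dim_row M) b (\<lambda>(i, j). M $$ (i, a + j))"
  show "?X \<in> carrier_mat (dim_row M) a" "?Y \<in> carrier_mat (dim_row M) b" by auto
  show "M = append_cols ?X ?Y"
    using assms by (intro eq_matI) (auto simp: index_append_cols)
qed

lemma append_rows_mult:
  fixes A B C :: "'a::semiring_0 mat"
  assumes "dim_col A = dim_row C" "dim_col B = dim_row C"
  shows "(A @\<^sub>r B) * C = A * C @\<^sub>r B * C"
  using assms by (intro eq_matI) (auto simp: index_append_rows scalar_prod_def intro!: sum.cong)

lemma mult_append_cols:
  fixes A B C :: "'a::semiring_0 mat"
  assumes "dim_col A = dim_row B" "dim_row C = dim_row B"
  shows "A * append_cols B C = append_cols (A * B) (A * C)"
  using assms by (intro eq_matI) (auto simp: index_append_cols scalar_prod_def intro!: sum.cong)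

lemma sum_lessThan_add:
  fixes f :: "nat \<Rightarrow> 'a::comm_monoid_add"
  shows "(\<Sum>i = 0..<a + b. f i) = (\<Sum>i = 0..<a. f i) + (\<Sum>i = 0..<b. f (a + i))"
  by (induction b) (simp_all add: add.assoc)

lemma append_cols_mult_append_rows:
  fixes A B C D :: "'a::semiring_0 mat"
  assumes "dim_col A = dim_row C" "dim_col B = dim_row D" "dim_row A = dim_row B" "dim_col C = dim_col D"
  shows "append_cols A B * (C @\<^sub>r D) = A * C + B * D"
  using assms
  by (intro eq_matI) (auto simp: index_append_cols index_append_rows scalar_prod_def sum_lessThan_add)

lemma append_rows_add:
  assumes "dim_row A = dim_row C" "dim_row B = dim_row D" "dim_col A = dim_col C" "dim_col B = dim_col D"
    "dim_col A = dim_col B"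
  shows "(A @\<^sub>r B) + (C @\<^sub>r D) = (A + C) @\<^sub>r (B + D)"
  using assms by (intro eq_matI) (auto simp: index_append_rows)

lemma append_cols_add:
  assumes "dim_row A = dim_row C" "dim_row B = dim_row D" "dim_col A = dim_col C" "dim_col B = dim_col D"
    "dim_row A = dim_row B"
  shows "append_cols A B + append_cols C D = append_cols (A + C) (B + D)"
  using assms by (intro eq_matI) (auto simp: index_append_cols)

lemma append_rows_minus:
  fixes A B C D :: "'a::group_add mat"
  assumes "dim_row A = dim_row C" "dim_row B = dim_row D" "dim_col A = dim_col C" "dim_col B = dim_col D"
    "dim_col A = dim_col B"
  shows "(A @\<^sub>r B) - (C @\<^sub>r D) = (A - C) @\<^sub>r (B - D)"
  using assms by (intro eq_matI) (auto simp: index_append_rows)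

lemma uminus_append_rows:
  assumes "dim_col A = dim_col B"
  shows "- (A @\<^sub>r B) = - A @\<^sub>r - B"
  using assms by (intro eq_matI) (auto simp: index_append_rows)

lemma uminus_append_cols:
  assumes "dim_row A = dim_row B"
  shows "- append_cols A B = append_cols (- A) (- B)"
  using assms by (intro eq_matI) (auto simp: index_append_cols)

lemma four_block_mult_append_rows:
  fixes A B C D X Y :: "'a::semiring_0 mat"
  assumes "A \<in> carrier_mat a c" "B \<in> carrier_mat a d" "C \<in> carrier_mat b c" "D \<in> carrier_mat b d"
    "X \<in> carrier_mat c n" "Y \<in> carrier_mat d n"
  shows "four_block_mat A B C D * (X @\<^sub>r Y) = (A * X + B * Y) @\<^sub>r (C * X + D * Y)"
  using assms
  by (simp add: four_block_mat_eq_append append_rows_mult append_cols_mult_append_rows carrier_matD)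

lemma zero_append:
  "0\<^sub>m a n @\<^sub>r 0\<^sub>m b n = 0\<^sub>m (a + b) n" "append_cols (0\<^sub>m n a) (0\<^sub>m n b) = 0\<^sub>m n (a + b)"
  by (intro eq_matI; auto simp: index_append_rows index_append_cols)+

section \<open>Rank of matrices over a division ring\<close>

text \<open>Induction on the inner dimension: the matrix \<open>C\<close> spans the kernel of the last row \<open>y\<close> of \<open>Y\<close>,
  and \<open>C'\<close> forgets a coordinate in which \<open>y\<close> does not vanish.\<close>

lemma mult_eq_one_mat_le:
  fixes X Y :: "'a::division_ring mat"
  assumes "X \<in> carrier_mat k l" "Y \<in> carrier_mat l k" "X * Y = 1\<^sub>m k"
  shows "k \<le> l"
  using assms
proof (induction l arbitrary: k X Y)
  case 0
  show ?case
  proof (rule ccontr)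
    assume "\<not> k \<le> 0"
    then have "(X * Y) $$ (0, 0) = 1" using 0(3) by simp
    moreover have "(X * Y) $$ (0, 0) = 0" using 0(1,2) \<open>\<not> k \<le> 0\<close> by (simp add: scalar_prod_def)
    ultimately show False by simp
  qed
next
  case (Suc l)
  obtain X1 x where X: "X1 \<in> carrier_mat k l" "x \<in> carrier_mat k 1" "X = append_cols X1 x"
    using append_cols_split[of X l 1] Suc.prems by (metis Suc_eq_plus1 carrier_matD)
  obtain Y1 y where Y: "Y1 \<in> carrier_mat l k" "y \<in> carrier_mat 1 k" "Y = Y1 @\<^sub>r y"
    using append_rows_split[of Y l 1] Suc.prems by (metis Suc_eq_plus1 carrier_matD)
  have XY: "X1 * Y1 + x * y = 1\<^sub>m k"
    using Suc.prems(3) X Y by (simp add: append_cols_mult_append_rows)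
  show ?case
  proof (cases "\<forall>j<k. y $$ (0, j) = 0")
    case True
    then have "y = 0\<^sub>m 1 k" using Y by (intro eq_matI) auto
    then have "X1 * Y1 = 1\<^sub>m k" using XY X Y by (simp add: mat_dim_simps)
    then have "k \<le> l" by (rule Suc.IH[OF X(1) Y(1)])
    then show ?thesis by simp
  next
    case False
    then obtain j where j: "j < k" "y $$ (0, j) \<noteq> 0" by blast
    then obtain k' where k: "k = Suc k'" by (cases k) auto
    \<comment> \<open>\<open>f\<close> lists the indices other than j in increasing order.\<close>
    define f where "f i = (if i < j then i else Suc i)" for i
    have f: "f a \<noteq> j" "a < k' \<Longrightarrow> f a < k" "f a = f b \<longleftrightarrow> a = b" for a b
      using k by (auto simp: f_def)
    define C' where "C' = mat k' k (\<lambda>(a, b). if b = f a then 1 else (0::'a))"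
    define C where "C = mat k k' (\<lambda>(b, a). if b = f a then 1
      else if b = j then - (inverse (y $$ (0, j)) * y $$ (0, f a)) else (0::'a))"
    have c: "C' \<in> carrier_mat k' k" "C \<in> carrier_mat k k'" by (auto simp: C'_def C_def)
    have 1: "C' * C = 1\<^sub>m k'"
    proof (rule eq_matI)
      fix a b assume "a < dim_row (1\<^sub>m k' :: 'a mat)" "b < dim_col (1\<^sub>m k' :: 'a mat)"
      then have ab: "a < k'" "b < k'" by auto
      have "(C' * C) $$ (a, b) = (\<Sum>i = 0..<k. (if i = f a then 1 else 0) * C $$ (i, b))"
        using ab c by (auto simp: scalar_prod_def C'_def intro!: sum.cong)
      also have "\<dots> = (\<Sum>i = 0..<k. if i = f a then C $$ (i, b) else 0)"
        by (rule sum.cong) auto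
      also have "\<dots> = C $$ (f a, b)" using f(2)[OF ab(1)] by simp
      also have "\<dots> = 1\<^sub>m k' $$ (a, b)" using ab f by (simp add: C_def)
      finally show "(C' * C) $$ (a, b) = 1\<^sub>m k' $$ (a, b)" .
    qed (use c in auto)
    have 2: "y * C = 0\<^sub>m 1 k'"
    proof (rule eq_matI)
      fix a b assume "a < dim_row (0\<^sub>m 1 k' :: 'a mat)" "b < dim_col (0\<^sub>m 1 k' :: 'a mat)"
      then have ab: "a = 0" "b < k'" by auto
      have "(y * C) $$ (a, b) = (\<Sum>i = 0..<k. y $$ (0, i) * C $$ (i, b))"
        using ab c Y by (auto simp: scalar_prod_def intro!: sum.cong)
      also have "\<dots> = (\<Sum>i = 0..<k. (if i = f b then y $$ (0, i) else 0) +
          (if i = j then - (y $$ (0, i) * (inverse (y $$ (0, j)) * y $$ (0, f b))) else 0))"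
        using ab f(1)[of b] by (intro sum.cong) (auto simp: C_def)
      also have "\<dots> = 0"
        using f(2)[OF ab(2)] j by (simp add: sum.distrib mult.assoc[symmetric])
      finally show "(y * C) $$ (a, b) = 0\<^sub>m 1 k' $$ (a, b)" using ab by simp
    qed (use c Y in auto)
    \<comment> \<open>Multiplication by \<open>C\<close> kills the rank-one term
      \<open>x * y\<close>, so the identity of size k - 1 factors through l.\<close>
    have "1\<^sub>m k' = C' * (X1 * Y1 + x * y) * C" using XY 1 c by (simp add: mat_dim_simps)
    also have "\<dots> = (C' * X1) * (Y1 * C)" using c X Y 2 by (simp add: mat_dim_simps)
    finally have "k' \<le> l" using Suc.IH[of "C' * X1" k' "Y1 * C"] c X Y by auto
    then show ?thesis using k by simp
  qed
qed

text \<open>Over a division ring a right inverse exists exactly when the rows are left independent.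
  In this form the notion passes directly to products and block matrices.\<close>

definition full_row_rank :: "'a::semiring_1 mat \<Rightarrow> bool" where
  "full_row_rank X \<longleftrightarrow> (\<exists>Q \<in> carrier_mat (dim_col X) (dim_row X). X * Q = 1\<^sub>m (dim_row X))"

lemma full_row_rankI:
  fixes X :: "'a::semiring_1 mat"
  assumes "X * Q = 1\<^sub>m k" "dim_row X = k" "dim_row Q = dim_col X"
  shows "full_row_rank X"
  unfolding full_row_rank_def
proof
  show "X * Q = 1\<^sub>m (dim_row X)" using assms by simp
  have "dim_col Q = k" using arg_cong[OF assms(1), of dim_col] by simp
  then show "Q \<in> carrier_mat (dim_col X) (dim_row X)" using assms by auto
qed

lemma full_row_rankE:
  assumes "full_row_rank X" "X \<in> carrier_mat k n"
  obtains Q where "Q \<in> carrier_mat n k" "X * Q = 1\<^sub>m k"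
  using assms by (auto simp: full_row_rank_def)

lemma full_row_rank_mult_right_factor:
  fixes X g h :: "'a::semiring_1 mat"
  assumes "full_row_rank X" "X \<in> carrier_mat k n" "g \<in> carrier_mat n n" "h \<in> carrier_mat n n" "g * h = 1\<^sub>m n"
  shows "full_row_rank (X * g)"
proof -
  obtain Q where Q: "Q \<in> carrier_mat n k" "X * Q = 1\<^sub>m k" using assms full_row_rankE by blast
  have "(X * g) * (h * Q) = X * ((g * h) * Q)" using assms(2-4) Q(1) by (simp add: mat_dim_simps)
  then have "(X * g) * (h * Q) = 1\<^sub>m k" using assms Q by simp
  then show ?thesis using assms Q by (intro full_row_rankI[of _ "h * Q"]) auto
qed

text \<open>If \<open>T\<close> is a right inverse of Y, then \<open>T - Q * (X * T)\<close> still
  is one, because Y kills Q, and it is killed by X. Next to \<open>Q\<close> it completes a right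
  inverse of the stack.\<close>

lemma full_row_rank_append:
  fixes X Y :: "'a::ring_1 mat"
  assumes X: "X \<in> carrier_mat k n" and Y: "Y \<in> carrier_mat l n"
    and Q: "Q \<in> carrier_mat n k" "X * Q = 1\<^sub>m k" "Y * Q = 0\<^sub>m l k" and "full_row_rank Y"
  shows "full_row_rank (X @\<^sub>r Y)"
proof -
  obtain T where T: "T \<in> carrier_mat n l" "Y * T = 1\<^sub>m l" using assms full_row_rankE by blast
  have "X * (Q * (X * T)) = (X * Q) * (X * T)" "Y * (Q * (X * T)) = (Y * Q) * (X * T)"
    using X Y Q(1) T(1) by (simp_all add: mat_dim_simps)
  then have *: "X * (Q * (X * T)) = X * T" "Y * (Q * (X * T)) = 0\<^sub>m l l"
    using X Y Q T by (simp_all add: mat_dim_simps)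
  have "(X @\<^sub>r Y) * append_cols Q (T - Q * (X * T)) = four_block_mat (1\<^sub>m k) (0\<^sub>m k l) (0\<^sub>m l k) (1\<^sub>m l)"
    using X Y Q T by (simp add: mat_dim_simps append_rows_mult mult_append_cols four_block_mat_eq_append *
        append_cols_append_rows append_rows_minus del: four_block_one_mat)
  then show ?thesis
    using X Y Q T by (intro full_row_rankI[of _ "append_cols Q (T - Q * (X * T))" "k + l"]) auto
qed

text \<open>A dimension count: X consists of independent rows in the left kernel of P, and P has
  column rank b. Replacing T by \<open>T - T * Q * X\<close> kills Q and keeps the product with P,
  so X stacked on it has the right inverse (Q | P).\<close>

lemma full_row_rank_mult_zero_le:
  fixes X P T :: "'a::division_ring mat"
  assumes X: "X \<in> carrier_mat a n" and P: "P \<in> carrier_mat n b" and T: "T \<in> carrier_mat b n"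
    and "full_row_rank X" "T * P = 1\<^sub>m b" "X * P = 0\<^sub>m a b"
  shows "a + b \<le> n"
proof -
  obtain Q where Q: "Q \<in> carrier_mat n a" "X * Q = 1\<^sub>m a" using assms full_row_rankE by blast
  define T' where "T' = T - T * Q * X"
  have T': "T' \<in> carrier_mat b n" using T X by (auto simp: T'_def)
  have TP: "T' * P = 1\<^sub>m b" and TQ: "T' * Q = 0\<^sub>m b a"
    using X P T Q assms(5,6) by (simp_all add: T'_def mat_dim_simps)
  have "(X @\<^sub>r T') * append_cols Q P = append_cols (X * Q) (X * P) @\<^sub>r append_cols (T' * Q) (T' * P)"
    using X P T' Q by (simp add: append_rows_mult mult_append_cols append_cols_append_rows)
  also have "\<dots> = four_block_mat (1\<^sub>m a) (0\<^sub>m a b) (0\<^sub>m b a) (1\<^sub>m b)"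
    unfolding Q(2) assms(6) TP TQ by (rule four_block_mat_eq_append[symmetric]) simp_all
  finally have "(X @\<^sub>r T') * append_cols Q P = 1\<^sub>m (a + b)" by simp
  moreover have "X @\<^sub>r T' \<in> carrier_mat (a + b) n" using X T' by (rule carrier_append_rows)
  moreover have "append_cols Q P \<in> carrier_mat n (a + b)"
    using Q(1) P by (intro carrier_matI) simp_all
  ultimately show ?thesis using mult_eq_one_mat_le by blast
qed

lemma full_row_rank_single:
  fixes v :: "'a::division_ring mat"
  assumes "v \<in> carrier_mat 1 n" "v \<noteq> 0\<^sub>m 1 n"
  shows "full_row_rank v"
proof -
  obtain j where j: "j < n" "v $$ (0, j) \<noteq> 0" using assms by (auto simp: mat_eq_iff)
  define q where "q = mat n 1 (\<lambda>(i, k). if i = j then inverse (v $$ (0, j)) else 0)"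
  have "v * q = 1\<^sub>m 1"
  proof (rule eq_matI)
    fix a b assume "a < dim_row (1\<^sub>m 1 :: 'a mat)" "b < dim_col (1\<^sub>m 1 :: 'a mat)"
    then have ab: "a = 0" "b = 0" by auto
    have "(v * q) $$ (0, 0) = (\<Sum>i = 0..<n. if i = j then v $$ (0, i) * inverse (v $$ (0, j)) else 0)"
    proof -
      have "(v * q) $$ (0, 0) = (\<Sum>i = 0..<n. v $$ (0, i) * q $$ (i, 0))"
        using assms(1) by (simp add: scalar_prod_def q_def)
      also have "\<dots> = (\<Sum>i = 0..<n. if i = j then v $$ (0, i) * inverse (v $$ (0, j)) else 0)"
        by (rule sum.cong) (simp_all add: q_def)
      finally show ?thesis .
    qed
    then show "(v * q) $$ (a, b) = 1\<^sub>m 1 $$ (a, b)" using j ab by simp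
  qed (use assms in \<open>auto simp: q_def\<close>)
  then show ?thesis using assms by (intro full_row_rankI[of _ q 1]) (auto simp: q_def)
qed

lemma nonzero_mat_row:
  fixes X :: "'a::semiring_1 mat"
  assumes X: "X \<in> carrier_mat k n" and "X \<noteq> 0\<^sub>m k n"
  obtains d where "d \<in> carrier_mat 1 k" "d * X \<noteq> 0\<^sub>m 1 n"
proof -
  obtain i j where ij: "i < k" "j < n" "X $$ (i, j) \<noteq> 0" using assms by (auto simp: mat_eq_iff)
  define d where "d = mat 1 k (\<lambda>(a, b). if b = i then 1 else (0::'a))"
  have "(d * X) $$ (0, j) = (\<Sum>b = 0..<k. d $$ (0, b) * X $$ (b, j))"
    using X ij by (simp add: scalar_prod_def d_def)
  also have "\<dots> = (\<Sum>b = 0..<k. if b = i then X $$ (b, j) else 0)"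
    by (rule sum.cong) (auto simp: d_def)
  finally have "(d * X) $$ (0, j) \<noteq> 0" using ij by simp
  then have "d * X \<noteq> 0\<^sub>m 1 n" using ij by auto
  then show thesis using that[of d] by (simp add: d_def)
qed

lemma minus_mat_eq_0_iff:
  fixes A B :: "'a::group_add mat"
  assumes "A \<in> carrier_mat k n" "B \<in> carrier_mat k n"
  shows "A - B = 0\<^sub>m k n \<longleftrightarrow> A = B"
  using assms by (auto simp: mat_eq_iff)

text \<open>If \<open>B * A - 1\<close> were nonzero, some combination of its rows would be a
  nonzero vector killed by B. As B has the left inverse A, hence rank n, the count gives 1 + n \<le>
  n.\<close>

lemma mult_one_mat_commute:
  fixes A B :: "'a::division_ring mat"
  assumes A: "A \<in> carrier_mat n n" and B: "B \<in> carrier_mat n n" and AB: "A * B = 1\<^sub>m n"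
  shows "B * A = 1\<^sub>m n"
proof (rule ccontr)
  assume ne: "B * A \<noteq> 1\<^sub>m n"
  have BA: "B * A \<in> carrier_mat n n" using A B by simp
  define D where "D = B * A - 1\<^sub>m n"
  have D: "D \<in> carrier_mat n n" "D \<noteq> 0\<^sub>m n n"
    using ne minus_mat_eq_0_iff[OF BA one_carrier_mat] by (auto simp: D_def)
  have DB: "D * B = 0\<^sub>m n n" using A B AB by (simp add: D_def mat_dim_simps)
  obtain d where d: "d \<in> carrier_mat 1 n" "d * D \<noteq> 0\<^sub>m 1 n" using nonzero_mat_row[OF D] .
  have dD: "d * D \<in> carrier_mat 1 n" using d D by simp
  have "d * D * B = 0\<^sub>m 1 n" using d D(1) B DB by (simp add: mat_dim_simps)
  then have "1 + n \<le> n"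
    using full_row_rank_mult_zero_le[OF dD B A full_row_rank_single[OF dD d(2)] AB] by simp
  then show False by simp
qed

text \<open>The two column blocks of a right inverse of the stack are right inverses of the two
  parts.\<close>

lemma full_row_rank_appendD:
  fixes X Y :: "'a::semiring_1 mat"
  assumes "full_row_rank (X @\<^sub>r Y)" and X: "X \<in> carrier_mat k n" and Y: "Y \<in> carrier_mat l n"
  shows "full_row_rank X" "full_row_rank Y"
proof -
  obtain Q where Q: "Q \<in> carrier_mat n (k + l)" "(X @\<^sub>r Y) * Q = 1\<^sub>m (k + l)"
    using assms full_row_rankE[of "X @\<^sub>r Y" "k + l" n] carrier_append_rows by blast
  obtain Q1 Q2 where Q12: "Q1 \<in> carrier_mat n k" "Q2 \<in> carrier_mat n l" "Q = append_cols Q1 Q2"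
    using append_cols_split[of Q k l] Q(1) by (metis carrier_matD)
  have "four_block_mat (X * Q1) (X * Q2) (Y * Q1) (Y * Q2) =
      four_block_mat (1\<^sub>m k) (0\<^sub>m k l) (0\<^sub>m l k) (1\<^sub>m l)"
    using Q(2) Q12 X Y by (simp add: four_block_mat_eq_append[of "X * Q1"] append_rows_mult mult_append_cols
        append_cols_append_rows)
  then have "append_cols (X * Q1) (X * Q2) @\<^sub>r append_cols (Y * Q1) (Y * Q2) =
      append_cols (1\<^sub>m k) (0\<^sub>m k l) @\<^sub>r append_cols (0\<^sub>m l k) (1\<^sub>m l)"
    using Q12 X Y by (simp add: four_block_mat_eq_append del: four_block_one_mat)
  note * = append_rows_inject[OF this]
  have "append_cols (X * Q1) (X * Q2) = append_cols (1\<^sub>m k) (0\<^sub>m k l)"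
    using Q12 X Y by (intro *(1)) auto
  then have "X * Q1 = 1\<^sub>m k" by (rule append_cols_inject) (use Q12 X Y in auto)
  then show "full_row_rank X" using Q12 X Y by (intro full_row_rankI) auto
  have "append_cols (Y * Q1) (Y * Q2) = append_cols (0\<^sub>m l k) (1\<^sub>m l)"
    using Q12 X Y by (intro *(2)) auto
  then have "Y * Q2 = 1\<^sub>m l" by (rule append_cols_inject) (use Q12 X Y in auto)
  then show "full_row_rank Y" using Q12 X Y by (intro full_row_rankI) auto
qed

section \<open>Row equivalence and row reduction\<close>

definition row_equiv :: "'a::semiring_1 mat \<Rightarrow> 'a mat \<Rightarrow> bool" where
  "row_equiv A B \<longleftrightarrow> (\<exists>U V. U \<in> carrier_mat (dim_row A) (dim_row A) \<and> V \<in> carrier_mat (dim_row A) (dim_row A) \<and>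
     U * V = 1\<^sub>m (dim_row A) \<and> V * U = 1\<^sub>m (dim_row A) \<and> B = U * A)"

lemma row_equivI:
  assumes "U \<in> carrier_mat p p" "V \<in> carrier_mat p p" "U * V = 1\<^sub>m p" "V * U = 1\<^sub>m p" "dim_row A = p" "B = U * A"
  shows "row_equiv A B"
  using assms by (auto simp: row_equiv_def)

lemma row_equivE:
  assumes "row_equiv A B" "dim_row A = p"
  obtains U V where "U \<in> carrier_mat p p" "V \<in> carrier_mat p p" "U * V = 1\<^sub>m p" "V * U = 1\<^sub>m p" "B = U * A"
  using assms by (auto simp: row_equiv_def)

lemma row_equiv_dim: "row_equiv A B \<Longrightarrow> dim_row B = dim_row A" "row_equiv A B \<Longrightarrow> dim_col B = dim_col A"
  by (auto simp: row_equiv_def)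

lemma row_equiv_refl: "row_equiv A A"
  by (rule row_equivI[of "1\<^sub>m (dim_row A)" _ "1\<^sub>m (dim_row A)"]) auto

lemma row_equiv_trans [trans]:
  assumes "row_equiv A B" "row_equiv B C"
  shows "row_equiv A C"
proof -
  obtain U V where U: "U \<in> carrier_mat (dim_row A) (dim_row A)" "V \<in> carrier_mat (dim_row A) (dim_row A)"
    "U * V = 1\<^sub>m (dim_row A)" "V * U = 1\<^sub>m (dim_row A)" "B = U * A"
    using row_equivE[OF assms(1) refl] by metis
  obtain U' V' where U': "U' \<in> carrier_mat (dim_row A) (dim_row A)" "V' \<in> carrier_mat (dim_row A) (dim_row A)"
    "U' * V' = 1\<^sub>m (dim_row A)" "V' * U' = 1\<^sub>m (dim_row A)" "C = U' * B"
    using row_equivE[OF assms(2) row_equiv_dim(1)[OF assms(1)]] by metis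
  have "(U' * U) * (V * V') = U' * ((U * V) * V')" "(V * V') * (U' * U) = V * ((V' * U') * U)"
    using U(1,2) U'(1,2) by (simp_all add: assoc_mult_mat_dim)
  then have "(U' * U) * (V * V') = 1\<^sub>m (dim_row A)" "(V * V') * (U' * U) = 1\<^sub>m (dim_row A)"
    using U U' by simp_all
  moreover have "C = (U' * U) * A" using U U' by (simp add: assoc_mult_mat_dim)
  ultimately show ?thesis using U(1,2) U'(1,2) by (intro row_equivI[of "U' * U" _ "V * V'"]) auto
qed

lemma row_equiv_full_row_rank:
  fixes X Y :: "'a::semiring_1 mat"
  assumes "row_equiv X Y" "full_row_rank X"
  shows "full_row_rank Y"
proof -
  let ?p = "dim_row X"
  obtain U V where U: "U \<in> carrier_mat ?p ?p" "V \<in> carrier_mat ?p ?p" "U * V = 1\<^sub>m ?p" "Y = U * X"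
    using row_equivE[OF assms(1) refl] by metis
  obtain Q where Q: "Q \<in> carrier_mat (dim_col X) ?p" "X * Q = 1\<^sub>m ?p"
    using assms(2) by (auto simp: full_row_rank_def)
  have "Y * (Q * V) = U * ((X * Q) * V)" using U(1,2,4) Q(1) by (simp add: assoc_mult_mat_dim)
  then have "Y * (Q * V) = 1\<^sub>m ?p" using U Q by simp
  then show ?thesis using U Q by (intro full_row_rankI) auto
qed

lemma row_equiv_append_rows:
  fixes X Y :: "'a::ring_1 mat"
  assumes "row_equiv X X'" "row_equiv Y Y'" "dim_col X = dim_col Y"
  shows "row_equiv (X @\<^sub>r Y) (X' @\<^sub>r Y')"
proof -
  let ?p = "dim_row X" and ?q = "dim_row Y"
  obtain U V where U: "U \<in> carrier_mat ?p ?p" "V \<in> carrier_mat ?p ?p"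
    "U * V = 1\<^sub>m ?p" "V * U = 1\<^sub>m ?p" "X' = U * X" using row_equivE[OF assms(1) refl] by metis
  obtain U' V' where U': "U' \<in> carrier_mat ?q ?q" "V' \<in> carrier_mat ?q ?q"
    "U' * V' = 1\<^sub>m ?q" "V' * U' = 1\<^sub>m ?q" "Y' = U' * Y" using row_equivE[OF assms(2) refl] by metis
  let ?U = "four_block_mat U (0\<^sub>m ?p ?q) (0\<^sub>m ?q ?p) U'"
  let ?V = "four_block_mat V (0\<^sub>m ?p ?q) (0\<^sub>m ?q ?p) V'"
  have "?U * ?V = 1\<^sub>m (?p + ?q)" "?V * ?U = 1\<^sub>m (?p + ?q)"
    using U U' by (simp_all add: mult_four_block_mat[of _ ?p ?p _ ?q _ ?q _ _ ?p _ ?q] mat_dim_simps)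
  moreover have "?U * (X @\<^sub>r Y) = X' @\<^sub>r Y'"
    using U U' assms(3) by (subst four_block_mult_append_rows[where n = "dim_col X"])
      (auto simp: mat_dim_simps)
  ultimately show ?thesis using U(1,2) U'(1,2) by (intro row_equivI[of ?U "?p + ?q" ?V]) auto
qed

lemma row_equiv_swap:
  fixes X Y :: "'a::ring_1 mat"
  assumes "dim_col X = dim_col Y"
  shows "row_equiv (X @\<^sub>r Y) (Y @\<^sub>r X)"
proof -
  let ?p = "dim_row X" and ?q = "dim_row Y"
  let ?U = "four_block_mat (0\<^sub>m ?q ?p) (1\<^sub>m ?q) (1\<^sub>m ?p) (0\<^sub>m ?p ?q) :: 'a mat"
  let ?V = "four_block_mat (0\<^sub>m ?p ?q) (1\<^sub>m ?p) (1\<^sub>m ?q) (0\<^sub>m ?q ?p) :: 'a mat"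
  have U: "?U \<in> carrier_mat (?p + ?q) (?p + ?q)" "?V \<in> carrier_mat (?p + ?q) (?p + ?q)"
    by (auto intro!: carrier_matI)
  have "?U * ?V = 1\<^sub>m (?q + ?p)" "?V * ?U = 1\<^sub>m (?p + ?q)"
    by (simp_all add: mult_four_block_mat[of _ ?q ?p _ ?q _ ?p _ _ ?q _ ?p]
        mult_four_block_mat[of _ ?p ?q _ ?p _ ?q _ _ ?p _ ?q] mat_dim_simps)
  moreover have "?U * (X @\<^sub>r Y) = Y @\<^sub>r X"
    using assms by (subst four_block_mult_append_rows[where n = "dim_col X"]) (auto simp: mat_dim_simps)
  ultimately show ?thesis
    using U by (intro row_equivI[of ?U "?p + ?q" ?V]) (auto simp: add.commute)
qed

lemma row_equiv_add:
  fixes X Y :: "'a::ring_1 mat"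
  assumes X: "X \<in> carrier_mat k n" and Y: "Y \<in> carrier_mat l n" and C: "C \<in> carrier_mat k l"
  shows "row_equiv (X @\<^sub>r Y) ((X + C * Y) @\<^sub>r Y)"
proof -
  let ?U = "\<lambda>C. four_block_mat (1\<^sub>m k) C (0\<^sub>m l k) (1\<^sub>m l)"
  have *: "?U C * ?U (- C) = 1\<^sub>m (k + l)" "?U (- C) * ?U C = 1\<^sub>m (k + l)"
    using C by (simp_all add: mult_four_block_mat[of _ k k _ l _ l _ _ k _ l] mat_dim_simps)
  have "?U C * (X @\<^sub>r Y) = (X + C * Y) @\<^sub>r Y"
    using X Y C by (subst four_block_mult_append_rows[where n = n]) (auto simp: mat_dim_simps)
  then show ?thesis using X Y C * by (intro row_equivI[of "?U C" "k + l" "?U (- C)"]) auto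
qed

text \<open>A reduction of one half of a pair is carried out on the whole pair: the matrix
  \<open>U\<close> that reduces A also acts on B, on whichever side B stands.\<close>

lemma row_equiv_join:
  fixes A :: "'a::semiring_1 mat"
  assumes "row_equiv A A'" "dim_row B = dim_row A"
  obtains B' where "dim_row B' = dim_row A" "dim_col B' = dim_col B"
    "row_equiv (append_cols A B) (append_cols A' B')" "row_equiv (append_cols B A) (append_cols B' A')"
proof -
  let ?p = "dim_row A"
  obtain U V where U: "U \<in> carrier_mat ?p ?p" "V \<in> carrier_mat ?p ?p"
    "U * V = 1\<^sub>m ?p" "V * U = 1\<^sub>m ?p" "A' = U * A" using row_equivE[OF assms(1) refl] by metis
  show thesis
  proof (rule that[of "U * B"])
    show "row_equiv (append_cols A B) (append_cols A' (U * B))"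
      "row_equiv (append_cols B A) (append_cols (U * B) A')"
      using U assms(2) by (auto intro!: row_equivI[of U ?p V] simp: mult_append_cols)
  qed (use U assms(2) in auto)
qed

text \<open>Conversely, an operation on a pair acts on both halves by one and the same
  \<open>U\<close>.\<close>

lemma row_equiv_append_cols:
  fixes A :: "'a::semiring_1 mat"
  assumes "row_equiv (append_cols A B) (append_cols A' B')" "dim_row A = p" "dim_row B = p" "dim_row A' = dim_row B'"
    "dim_col A = dim_col A'"
  obtains U V where "U \<in> carrier_mat p p" "V \<in> carrier_mat p p" "U * V = 1\<^sub>m p" "V * U = 1\<^sub>m p"
    "A' = U * A" "B' = U * B"
proof -
  obtain U V where U: "U \<in> carrier_mat p p" "V \<in> carrier_mat p p"
    "U * V = 1\<^sub>m p" "V * U = 1\<^sub>m p" "append_cols A' B' = U * append_cols A B"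
    using row_equivE[OF assms(1), of p] assms(2) by auto
  have e: "append_cols A' B' = append_cols (U * A) (U * B)" using U assms(2,3) by (simp add: mult_append_cols)
  have "A' = U * A" using append_cols_inject(1)[OF e] assms by simp
  moreover have "B' = U * B" using append_cols_inject(2)[OF e] assms by simp
  ultimately show thesis using that U by metis
qed

text \<open>Induction on the number of rows. With the lower rows reduced to \<open>A0\<close>, the
  new row is replaced by \<open>a' = a - a * Q * A0\<close> for a right inverse \<open>Q\<close> of
  \<open>A0\<close>. Then \<open>a' * Q = 0\<close>, so \<open>a'\<close> is either zero and joins
  the zero rows or is independent of \<open>A0\<close>.\<close>

lemma row_equiv_normal_form:
  fixes A :: "'a::division_ring mat"
  assumes "A \<in> carrier_mat p n"
  obtains k A0 where "k \<le> p" "A0 \<in> carrier_mat k n" "full_row_rank A0" "row_equiv A (A0 @\<^sub>r 0\<^sub>m (p - k) n)"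
proof -
  have "\<exists>k A0. k \<le> p \<and> A0 \<in> carrier_mat k n \<and> full_row_rank A0 \<and> row_equiv A (A0 @\<^sub>r 0\<^sub>m (p - k) n)"
    using assms
  proof (induction p arbitrary: A)
    case 0
    have "full_row_rank A" using 0 by (intro full_row_rankI[of _ "0\<^sub>m n 0"]) (auto intro!: eq_matI)
    moreover have "A @\<^sub>r 0\<^sub>m 0 n = A" by (rule eq_matI) (use 0 in \<open>auto simp: index_append_rows\<close>)
    ultimately show ?case using 0 row_equiv_refl[of A] by force
  next
    case (Suc p)
    obtain a A1 where A: "a \<in> carrier_mat 1 n" "A1 \<in> carrier_mat p n" "A = a @\<^sub>r A1"
      using append_rows_split[of A 1 p] Suc.prems by (metis carrier_matD plus_1_eq_Suc)
    obtain k A0 where k: "k \<le> p" "A0 \<in> carrier_mat k n" "full_row_rank A0"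
      "row_equiv A1 (A0 @\<^sub>r 0\<^sub>m (p - k) n)" using Suc.IH[OF A(2)] by blast
    obtain Q where Q: "Q \<in> carrier_mat n k" "A0 * Q = 1\<^sub>m k" using full_row_rankE[OF k(3,2)] .
    define a' where "a' = a + - (a * Q) * A0"
    have a': "a' \<in> carrier_mat 1 n" using A(1) Q(1) k(2) by (simp add: a'_def)
    have "row_equiv A (a @\<^sub>r (A0 @\<^sub>r 0\<^sub>m (p - k) n))"
      unfolding A(3) using A k by (intro row_equiv_append_rows row_equiv_refl) auto
    also have "a @\<^sub>r (A0 @\<^sub>r 0\<^sub>m (p - k) n) = (a @\<^sub>r A0) @\<^sub>r 0\<^sub>m (p - k) n"
      using A k by (intro append_rows_assoc[symmetric]) auto
    also have "row_equiv \<dots> ((a' @\<^sub>r A0) @\<^sub>r 0\<^sub>m (p - k) n)"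
      unfolding a'_def using A(1) k(2) Q(1)
      by (intro row_equiv_append_rows row_equiv_refl row_equiv_add[of _ 1 n _ k]) auto
    finally have eqv: "row_equiv A ((a' @\<^sub>r A0) @\<^sub>r 0\<^sub>m (p - k) n)" .
    show ?case
    proof (cases "a' = 0\<^sub>m 1 n")
      case True
      have "row_equiv ((a' @\<^sub>r A0) @\<^sub>r 0\<^sub>m (p - k) n) ((A0 @\<^sub>r a') @\<^sub>r 0\<^sub>m (p - k) n)"
        using a' k(2) by (intro row_equiv_append_rows row_equiv_refl row_equiv_swap) auto
      also have "(A0 @\<^sub>r a') @\<^sub>r 0\<^sub>m (p - k) n = A0 @\<^sub>r 0\<^sub>m (Suc p - k) n"
        using k True by (simp add: append_rows_assoc zero_append Suc_diff_le)
      finally have "row_equiv A (A0 @\<^sub>r 0\<^sub>m (Suc p - k) n)" using eqv row_equiv_trans by blast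
      then show ?thesis using k by (intro exI[of _ k] exI[of _ A0]) auto
    next
      case False
      have "a' * Q = 0\<^sub>m 1 k" using A(1) k(2) Q by (simp add: a'_def mat_dim_simps)
      then have "full_row_rank (A0 @\<^sub>r a')"
        by (intro full_row_rank_append[OF k(2) a' Q] full_row_rank_single[OF a' False]) auto
      then have "full_row_rank (a' @\<^sub>r A0)"
        by (rule row_equiv_full_row_rank[rotated]) (use a' k(2) in \<open>auto intro: row_equiv_swap\<close>)
      then show ?thesis
        using eqv k a' by (intro exI[of _ "Suc k"] exI[of _ "a' @\<^sub>r A0"]) (auto intro!: carrier_matI)
    qed
  qed
  then show thesis using that by blast
qed

text \<open>The first clause bounds the rank by k from above, since A factors through k. The second
  bounds it from below, since the identity of size k factors through A.\<close>

definition has_rank :: "'a::semiring_1 mat \<Rightarrow> nat \<Rightarrow> bool" where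
  "has_rank A k \<longleftrightarrow>
     (\<exists>P Q. P \<in> carrier_mat (dim_row A) k \<and> Q \<in> carrier_mat k (dim_col A) \<and> A = P * Q) \<and>
     (\<exists>T S. T \<in> carrier_mat k (dim_row A) \<and> S \<in> carrier_mat (dim_col A) k \<and> T * A * S = 1\<^sub>m k)"

text \<open>The identity of size k factors through A, hence through A', hence through k'.\<close>

lemma has_rank_le:
  fixes A A' :: "'a::division_ring mat"
  assumes "has_rank A k" "has_rank A' k'" "A = W * A' * G" "dim_col W = dim_row A'" "dim_row G = dim_col A'"
  shows "k \<le> k'"
proof -
  obtain T S where T: "T \<in> carrier_mat k (dim_row A)" "S \<in> carrier_mat (dim_col A) k" "T * A * S = 1\<^sub>m k"
    using assms(1) by (auto simp: has_rank_def)
  obtain P Q where P: "P \<in> carrier_mat (dim_row A') k'" "Q \<in> carrier_mat k' (dim_col A')" "A' = P * Q"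
    using assms(2) by (auto simp: has_rank_def)
  have d: "dim_row A = dim_row W" "dim_col A = dim_col G" using assms(3) by auto
  have "T * W * P \<in> carrier_mat k k'" "Q * G * S \<in> carrier_mat k' k"
    by (rule carrier_matI; use T(1,2) P(1,2) in simp)+
  moreover have "T * W * P * (Q * G * S) = T * (W * (P * Q) * G) * S"
    using T(1,2) P(1,2) assms(4,5) d by (simp add: assoc_mult_mat_dim)
  then have "T * W * P * (Q * G * S) = 1\<^sub>m k"
    using T(3)[unfolded assms(3) P(3)] by metis
  ultimately show ?thesis using mult_eq_one_mat_le by blast
qed

lemma row_equiv_has_rank:
  fixes A :: "'a::ring_1 mat"
  assumes "row_equiv A (X @\<^sub>r 0\<^sub>m l n)" "X \<in> carrier_mat k n" "full_row_rank X"
  shows "has_rank A k"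
proof -
  have d: "dim_row A = k + l" "dim_col A = n" using row_equiv_dim[OF assms(1)] assms(2) by auto
  obtain U V where U: "U \<in> carrier_mat (k + l) (k + l)" "V \<in> carrier_mat (k + l) (k + l)" "U * V = 1\<^sub>m (k + l)"
    "V * U = 1\<^sub>m (k + l)" "X @\<^sub>r 0\<^sub>m l n = U * A"
    using row_equivE[OF assms(1) d(1)] by metis
  obtain Q where Q: "Q \<in> carrier_mat n k" "X * Q = 1\<^sub>m k" using full_row_rankE[OF assms(3,2)] .
  \<comment> \<open>\<open>?i\<close> embeds the first k coordinates and \<open>?j\<close> projects
    onto them. They turn the row reduction into the two factorisations that \<open>has_rank\<close>
    demands.\<close>
  let ?i = "1\<^sub>m k @\<^sub>r 0\<^sub>m l k :: 'a mat" and ?j = "append_cols (1\<^sub>m k) (0\<^sub>m k l) :: 'a mat"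
  have iX: "?i * X = X @\<^sub>r 0\<^sub>m l n" using assms(2) by (simp add: append_rows_mult mat_dim_simps)
  have "A = V * U * A" using U d by simp
  also have "\<dots> = V * ?i * X" using U(1,2) d assms(2) by (simp add: assoc_mult_mat_dim iX U(5))
  finally have "A = V * ?i * X" .
  have "?j * U * A * Q = ?j * (X @\<^sub>r 0\<^sub>m l n) * Q"
    using U(1) d assms(2) by (simp add: assoc_mult_mat_dim U(5))
  also have "?j * (X @\<^sub>r 0\<^sub>m l n) = X"
    using assms(2) by (simp add: append_cols_mult_append_rows mat_dim_simps)
  finally have TS: "?j * U * A * Q = 1\<^sub>m k" using Q(2) by simp
  have "?i \<in> carrier_mat (k + l) k" "?j \<in> carrier_mat k (k + l)"
    by (rule carrier_matI; simp)+
  then have "V * ?i \<in> carrier_mat (k + l) k" "?j * U \<in> carrier_mat k (k + l)"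
    using U(1,2) mult_carrier_mat by blast+
  then show ?thesis unfolding has_rank_def d
    using assms(2) Q(1) TS \<open>A = V * ?i * X\<close> by metis
qed

section \<open>Hermitian geometry over a division ring with involution\<close>

text \<open>Of the main involution the geometry uses only that it is an additive anti-automorphism
  of order dividing two.\<close>

locale star_division_ring =
  fixes star :: "'b::division_ring \<Rightarrow> 'b"
  assumes star_add: "star (x + y) = star x + star y"
    and star_mult: "star (x * y) = star y * star x"
    and star_star [simp]: "star (star x) = x"
begin

lemma star_0 [simp]: "star 0 = 0"
  using star_add[of 0 0] by simp

lemma star_1 [simp]: "star 1 = 1"
  by (metis mult_1 mult_1_right star_mult star_star)

lemma star_minus: "star (- x) = - star x"
  using star_add[of x "- x"] by (simp add: eq_neg_iff_add_eq_0 add.commute)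

lemma star_sum: "star (sum f A) = (\<Sum>i\<in>A. star (f i))"
  by (induction A rule: infinite_finite_induct) (auto simp: star_add)

definition adj :: "'b mat \<Rightarrow> 'b mat" where
  "adj X = map_mat star (transpose_mat X)"

lemma dim_adj [simp]: "dim_row (adj X) = dim_col X" "dim_col (adj X) = dim_row X"
  by (simp_all add: adj_def)

lemma index_adj [simp]: "i < dim_col X \<Longrightarrow> j < dim_row X \<Longrightarrow> adj X $$ (i, j) = star (X $$ (j, i))"
  by (simp add: adj_def)

lemma adj_adj [simp]: "adj (adj X) = X"
  by (intro eq_matI) auto

lemma adj_mult: "dim_col X = dim_row Y \<Longrightarrow> adj (X * Y) = adj Y * adj X"
  by (intro eq_matI) (auto simp: scalar_prod_def star_sum star_mult)

lemma adj_add: "dim_row X = dim_row Y \<Longrightarrow> dim_col X = dim_col Y \<Longrightarrow> adj (X + Y) = adj X + adj Y"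
  by (intro eq_matI) (auto simp: star_add)

lemma adj_uminus: "adj (- X) = - adj X"
  by (intro eq_matI) (auto simp: star_minus)

lemma adj_minus: "dim_row X = dim_row Y \<Longrightarrow> dim_col X = dim_col Y \<Longrightarrow> adj (X - Y) = adj X - adj Y"
  by (intro eq_matI) (auto simp: star_add star_minus diff_conv_add_uminus simp del: add_uminus_conv_diff)

lemma adj_one [simp]: "adj (1\<^sub>m k) = 1\<^sub>m k"
  by (intro eq_matI) auto

lemma adj_zero [simp]: "adj (0\<^sub>m k l) = 0\<^sub>m l k"
  by (intro eq_matI) auto

lemma adj_append_rows: "dim_col X = dim_col Y \<Longrightarrow> adj (X @\<^sub>r Y) = append_cols (adj X) (adj Y)"
  by (intro eq_matI) (auto simp: index_append_rows index_append_cols)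

lemma adj_append_cols: "dim_row X = dim_row Y \<Longrightarrow> adj (append_cols X Y) = adj X @\<^sub>r adj Y"
  by (intro eq_matI) (auto simp: index_append_rows index_append_cols)

lemmas adj_simps = adj_mult adj_add adj_uminus adj_minus adj_append_rows adj_append_cols

lemma adj_eq_iff: "adj X = adj Y \<longleftrightarrow> X = Y"
  by (metis adj_adj)

end

text \<open>Scalars are handled as matrices of size 1, so that values of the form and coefficients
  of vectors multiply like all other matrices.\<close>

lemma one_by_one_mat_inverse:
  fixes c :: "'a::division_ring mat"
  assumes "c \<in> carrier_mat 1 1" "c \<noteq> 0\<^sub>m 1 1"
  obtains a where "a \<in> carrier_mat 1 1" "c * a = 1\<^sub>m 1" "a * c = 1\<^sub>m 1"
proof -
  obtain a where a: "a \<in> carrier_mat 1 1" "c * a = 1\<^sub>m 1"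
    using full_row_rank_single[OF assms] assms(1) full_row_rankE by blast
  then show thesis using that mult_one_mat_commute[OF assms(1)] by blast
qed

text \<open>Rows of a \<open>k \<times> n\<close> matrix span a subspace of the left vector space \<open>'b ^ n\<close>, whose
  skew-hermitian form has Gram matrix \<open>\<psi>\<close>; isometries act from the right.\<close>

locale skew_hermitian_space = star_division_ring star
  for star :: "'b::{division_ring,ring_char_0} \<Rightarrow> 'b" +
  fixes n :: nat and \<psi> \<phi> :: "'b mat"
  assumes psi_carrier: "\<psi> \<in> carrier_mat n n" and phi_carrier: "\<phi> \<in> carrier_mat n n"
    and adj_psi: "adj \<psi> = - \<psi>"
    and psi_phi: "\<psi> * \<phi> = 1\<^sub>m n" and phi_psi: "\<phi> * \<psi> = 1\<^sub>m n"
begin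

lemma dim_psi [simp]: "dim_row \<psi> = n" "dim_col \<psi> = n" "dim_row \<phi> = n" "dim_col \<phi> = n"
  using psi_carrier phi_carrier by auto

definition gram :: "'b mat \<Rightarrow> 'b mat \<Rightarrow> 'b mat" where
  "gram X Y = X * \<psi> * adj Y"

lemma dim_gram [simp]: "dim_row (gram X Y) = dim_row X" "dim_col (gram X Y) = dim_row Y"
  by (simp_all add: gram_def)

lemma adj_gram: "dim_col X = n \<Longrightarrow> dim_col Y = n \<Longrightarrow> adj (gram X Y) = - gram Y X"
  by (simp add: gram_def adj_mult adj_psi mat_dim_simps)

lemma gram_add:
  "dim_col X = n \<Longrightarrow> dim_col Y = n \<Longrightarrow> dim_col Z = n \<Longrightarrow> dim_row X = dim_row Y \<Longrightarrow>
    gram (X + Y) Z = gram X Z + gram Y Z"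
  "dim_col X = n \<Longrightarrow> dim_col Y = n \<Longrightarrow> dim_col Z = n \<Longrightarrow> dim_row X = dim_row Y \<Longrightarrow>
    gram Z (X + Y) = gram Z X + gram Z Y"
  by (simp_all add: gram_def adj_add mat_dim_simps)

lemma gram_minus:
  "dim_col X = n \<Longrightarrow> dim_col Y = n \<Longrightarrow> dim_col Z = n \<Longrightarrow> dim_row X = dim_row Y \<Longrightarrow>
    gram (X - Y) Z = gram X Z - gram Y Z"
  "dim_col X = n \<Longrightarrow> dim_col Y = n \<Longrightarrow> dim_col Z = n \<Longrightarrow> dim_row X = dim_row Y \<Longrightarrow>
    gram Z (X - Y) = gram Z X - gram Z Y"
  by (simp_all add: gram_def adj_minus mat_dim_simps)

lemma gram_mult:
  "dim_col X = n \<Longrightarrow> dim_col Y = n \<Longrightarrow> dim_col a = dim_row X \<Longrightarrow> gram (a * X) Y = a * gram X Y"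
  "dim_col X = n \<Longrightarrow> dim_col Y = n \<Longrightarrow> dim_col a = dim_row Y \<Longrightarrow> gram X (a * Y) = gram X Y * adj a"
  by (simp_all add: gram_def adj_mult mat_dim_simps)

lemma gram_append_rows:
  "dim_col X = n \<Longrightarrow> dim_col Y = n \<Longrightarrow> dim_col Z = n \<Longrightarrow> gram (X @\<^sub>r Y) Z = gram X Z @\<^sub>r gram Y Z"
  "dim_col X = n \<Longrightarrow> dim_col Y = n \<Longrightarrow> dim_col Z = n \<Longrightarrow> gram Z (X @\<^sub>r Y) = append_cols (gram Z X) (gram Z Y)"
  by (simp_all add: gram_def adj_simps append_rows_mult mult_append_cols)

definition isometries :: "'b mat set" where
  "isometries = {g \<in> carrier_mat n n. g * \<psi> * adj g = \<psi>}"

lemma isometriesD: "g \<in> isometries \<Longrightarrow> g \<in> carrier_mat n n" "g \<in> isometries \<Longrightarrow> g * (\<psi> * adj g) = \<psi>"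
  by (auto simp: isometries_def assoc_mult_mat_dim)

lemma gram_isometry:
  assumes "g \<in> isometries" "dim_col X = n" "dim_col Y = n"
  shows "gram (X * g) (Y * g) = gram X Y"
proof -
  have "gram (X * g) (Y * g) = X * (g * (\<psi> * adj g)) * adj Y"
    using isometriesD(1)[OF assms(1)] assms(2-) by (simp add: gram_def adj_mult mat_dim_simps)
  then show ?thesis using isometriesD(2)[OF assms(1)] by (simp add: gram_def)
qed

text \<open>Multiplying \<open>g * \<psi> * adj g = \<psi>\<close> by \<phi> on the right exhibits a
  right inverse of g, which for square matrices is two-sided.\<close>

lemma isometry_inverse:
  assumes g: "g \<in> isometries"
  shows "\<psi> * adj g * \<phi> \<in> isometries" "g * (\<psi> * adj g * \<phi>) = 1\<^sub>m n" "(\<psi> * adj g * \<phi>) * g = 1\<^sub>m n"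
proof -
  note c [simp] = isometriesD(1)[OF g] carrier_matD[OF isometriesD(1)[OF g]]
  define h where "h = \<psi> * adj g * \<phi>"
  have h [simp]: "h \<in> carrier_mat n n" "dim_row h = n" "dim_col h = n" by (auto simp: h_def)
  have "g * h = (g * (\<psi> * adj g)) * \<phi>" by (simp add: h_def mat_dim_simps)
  then have gh: "g * h = 1\<^sub>m n" using isometriesD(2)[OF g] psi_phi by simp
  then have hg: "h * g = 1\<^sub>m n" using mult_one_mat_commute[of g n h] by simp
  then have hg': "adj g * adj h = 1\<^sub>m n" by (metis adj_mult adj_one c(2) h(3))
  have "h * \<psi> * adj h = h * (g * (\<psi> * adj g)) * adj h" using isometriesD(2)[OF g] by simp
  also have "\<dots> = (h * g) * \<psi> * (adj g * adj h)" by (simp add: mat_dim_simps)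
  also have "\<dots> = \<psi>" using hg hg' by simp
  finally have "h \<in> isometries" by (simp add: isometries_def)
  with gh hg show "\<psi> * adj g * \<phi> \<in> isometries" "g * (\<psi> * adj g * \<phi>) = 1\<^sub>m n"
    "(\<psi> * adj g * \<phi>) * g = 1\<^sub>m n" by (simp_all add: h_def)
qed

lemma isometries_one: "1\<^sub>m n \<in> isometries"
  by (simp add: isometries_def)

lemma isometries_mult:
  assumes "g \<in> isometries" "h \<in> isometries"
  shows "g * h \<in> isometries"
proof -
  note [simp] = carrier_matD[OF isometriesD(1)[OF assms(1)]] carrier_matD[OF isometriesD(1)[OF assms(2)]]
  have "g * h * \<psi> * adj (g * h) = g * (h * (\<psi> * adj h)) * adj g"
    by (simp add: adj_mult mat_dim_simps)
  also have "\<dots> = \<psi>" using isometriesD(2)[OF assms(1)] isometriesD(2)[OF assms(2)] by (simp add: mat_dim_simps)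
  finally show ?thesis
    using mult_carrier_mat[OF isometriesD(1)[OF assms(1)] isometriesD(1)[OF assms(2)]]
    by (simp add: isometries_def)
qed

lemma full_row_rank_isometry:
  assumes "full_row_rank X" "dim_col X = n" "g \<in> isometries"
  shows "full_row_rank (X * g)"
  by (rule full_row_rank_mult_right_factor[OF assms(1) carrier_matI[OF refl assms(2)]
        isometriesD(1)[OF assms(3)] isometriesD(1)[OF isometry_inverse(1)[OF assms(3)]]
        isometry_inverse(2)[OF assms(3)]])

text \<open>The quasi-reflection \<open>v \<mapsto> v - \<langle>v, w\<rangle> \<langle>x, w\<rangle>\<^bsup>-1\<^esup> w\<close> along \<open>w = x - y\<close>.\<close>

lemma quasi_reflection:
  assumes x: "x \<in> carrier_mat 1 n" and y: "y \<in> carrier_mat 1 n" and eq: "gram x x = gram y y"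
    and ne: "gram x (x - y) \<noteq> 0\<^sub>m 1 1"
  obtains g where "g \<in> isometries" "x * g = y"
    "\<And>v k. v \<in> carrier_mat k n \<Longrightarrow> gram v (x - y) = 0\<^sub>m k 1 \<Longrightarrow> v * g = v"
proof -
  define w where "w = x - y"
  define b where "b = gram x w"
  note [simp] = carrier_matD[OF x] carrier_matD[OF y]
  have w [simp]: "dim_row w = 1" "dim_col w = n" by (simp_all add: w_def)
  have b: "b \<in> carrier_mat 1 1" by (auto simp: b_def)
  have "b \<noteq> 0\<^sub>m 1 1" using ne by (simp add: b_def w_def)
  then obtain a where a: "a \<in> carrier_mat 1 1" "b * a = 1\<^sub>m 1" "a * b = 1\<^sub>m 1"
    using one_by_one_mat_inverse[OF b] by blast
  note [simp] = carrier_matD[OF a(1)] carrier_matD[OF b]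
  define S where "S = \<psi> * adj w * a * w"
  have S [simp]: "dim_row S = n" "dim_col S = n" by (simp_all add: S_def)
  define g where "g = 1\<^sub>m n - S"
  have g [simp]: "dim_row g = n" "dim_col g = n" by (simp_all add: g_def)
  have vS: "v * S = gram v w * a * w" if "v \<in> carrier_mat k n" for v k
    using that by (simp add: S_def gram_def mat_dim_simps)
  have vg: "v * g = v - gram v w * a * w" if "v \<in> carrier_mat k n" for v k
    using that vS[OF that] by (simp add: g_def mat_dim_simps)
  have "x * g = x - w"
    using vg[OF x] by (simp add: b_def[symmetric] a(2) mat_dim_simps)
  also have "\<dots> = y" by (auto simp: w_def intro!: eq_matI)
  finally have 1: "x * g = y" .
  have 2: "v * g = v" if "v \<in> carrier_mat k n" "gram v (x - y) = 0\<^sub>m k 1" for v k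
    using vg[OF that(1)] that by (simp add: w_def[symmetric] mat_dim_simps)
  \<comment> \<open>Equality of the lengths of x and y enters here. It yields
    \<open>a * gram w w * adj a = adj a - a\<close>, which is exactly what makes the quadratic term
    of \<open>(1 - S) * \<psi> * adj (1 - S)\<close> cancel the linear ones.\<close>
  have ww: "gram w w = b - adj b"
  proof -
    have 1: "gram w w = gram x x - gram x y - (gram y x - gram x x)"
      unfolding w_def by (simp add: gram_minus eq) (auto intro!: eq_matI)
    have 2: "b - adj b = (gram x x - gram x y) - (- gram x x - - gram y x)"
      unfolding b_def w_def by (simp add: gram_minus adj_minus adj_gram)
    show ?thesis unfolding 1 2 by (intro eq_matI) auto
  qed
  have ab: "adj b * adj a = 1\<^sub>m 1" using a(3) by (metis adj_mult adj_one carrier_matD b a(1))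
  have "a * gram w w * adj a = a * b * adj a - a * (adj b * adj a)"
    unfolding ww by (simp add: mat_dim_simps)
  then have aw: "a * gram w w * adj a = adj a - a"
    using a ab by (simp add: mat_dim_simps)
  have aS: "adj S = - (adj w * adj a * w * \<psi>)"
    by (simp add: S_def adj_mult adj_psi mat_dim_simps)
  have "S * \<psi> * adj S = - (\<psi> * adj w * (a * gram w w * adj a) * w * \<psi>)"
    unfolding aS by (simp add: S_def gram_def mat_dim_simps)
  also have "\<dots> = - (\<psi> * (adj w * (adj a * (w * \<psi>))) - \<psi> * (adj w * (a * (w * \<psi>))))"
    unfolding aw by (simp add: mat_dim_simps)
  also have "\<dots> = \<psi> * (adj w * (a * (w * \<psi>))) + - (\<psi> * (adj w * (adj a * (w * \<psi>))))"
    by (intro eq_matI) auto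
  also have "\<dots> = S * \<psi> + \<psi> * adj S"
    unfolding aS by (simp add: S_def mat_dim_simps)
  finally have SS: "S * \<psi> * adj S = S * \<psi> + \<psi> * adj S" .
  have "g * \<psi> * adj g = \<psi> - S * \<psi> - (\<psi> * adj S - S * \<psi> * adj S)"
    unfolding g_def by (simp add: adj_minus mat_dim_simps)
  also have "\<dots> = \<psi>" unfolding SS by (intro eq_matI) auto
  finally have "g \<in> isometries" by (auto simp: isometries_def)
  with 1 2 that show thesis by blast
qed

end

section \<open>Witt's extension theorem\<close>

lemma one_by_one_mat_mult_nonzero:
  fixes a b :: "'a::division_ring mat"
  assumes a: "a \<in> carrier_mat 1 1" "a \<noteq> 0\<^sub>m 1 1" and b: "b \<in> carrier_mat 1 1" "b \<noteq> 0\<^sub>m 1 1"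
  shows "a * b \<noteq> 0\<^sub>m 1 1"
proof
  assume ab: "a * b = 0\<^sub>m 1 1"
  obtain a' where a': "a' \<in> carrier_mat 1 1" "a' * a = 1\<^sub>m 1" using one_by_one_mat_inverse[OF a] by blast
  have "b = (a' * a) * b" using a' b by simp
  also have "\<dots> = a' * (a * b)" using a(1) a'(1) b(1) by (simp add: mat_dim_simps)
  also have "\<dots> = 0\<^sub>m 1 1" using ab a' by simp
  finally show False using b by simp
qed

lemma one_mat_neq_zero: "1\<^sub>m 1 \<noteq> (0\<^sub>m 1 1 :: 'a::zero_neq_one mat)"
  by (auto simp: mat_eq_iff)

context skew_hermitian_space
begin

lemma adj_eq_zero_iff: "adj X = 0\<^sub>m l k \<longleftrightarrow> X = 0\<^sub>m k l"
  using adj_eq_iff[of X "0\<^sub>m k l"] by simp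

lemma gram_zero_swap:
  assumes "dim_col X = n" "dim_col Y = n" "gram X Y = 0\<^sub>m k l"
  shows "gram Y X = 0\<^sub>m l k"
proof -
  have "gram Y X = - adj (gram X Y)" using assms(1,2) by (simp add: adj_gram)
  then show ?thesis using assms(3) by (simp add: mat_dim_simps)
qed

text \<open>The last column \<open>q\<close> of a right inverse of the stack is killed by X and sent
  to 1 by x. Nondegeneracy turns this functional into a vector: \<open>gram v u = v * q\<close> for
  \<open>u = adj (\<phi> * q)\<close>.\<close>

lemma gram_dual_vector:
  assumes X: "X \<in> carrier_mat k n" and x: "x \<in> carrier_mat 1 n" and "full_row_rank (X @\<^sub>r x)"
  obtains u where "u \<in> carrier_mat 1 n" "gram X u = 0\<^sub>m k 1" "gram x u = 1\<^sub>m 1"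
proof -
  obtain Q where Q: "Q \<in> carrier_mat n (k + 1)" "(X @\<^sub>r x) * Q = 1\<^sub>m (k + 1)"
    using assms full_row_rankE carrier_append_rows by metis
  define q where "q = Q * (0\<^sub>m k 1 @\<^sub>r 1\<^sub>m 1)"
  have q: "q \<in> carrier_mat n 1" using Q(1) by (auto simp: q_def)
  have "(X @\<^sub>r x) * q = 0\<^sub>m k 1 @\<^sub>r 1\<^sub>m 1"
    unfolding q_def using Q X x by (subst mult_mat_shift[OF Q(2)]) (auto simp: mat_dim_simps)
  then have Xx: "X * q @\<^sub>r x * q = 0\<^sub>m k 1 @\<^sub>r 1\<^sub>m 1"
    using X x q by (simp add: append_rows_mult)
  have 1: "X * q = 0\<^sub>m k 1" "x * q = 1\<^sub>m 1"
    using append_rows_inject[OF Xx] X x q by auto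
  define u where "u = adj (\<phi> * q)"
  have u: "u \<in> carrier_mat 1 n" using q by (auto simp: u_def)
  have "gram v u = v * q" if "v \<in> carrier_mat l n" for v l
  proof -
    have "gram v u = v * ((\<psi> * \<phi>) * q)" using that q by (simp add: gram_def u_def mat_dim_simps)
    then show ?thesis using psi_phi q by simp
  qed
  then show thesis using that[OF u] 1 X x by simp
qed

text \<open>For \<open>p = \<langle>u, u\<rangle>\<close> and \<open>c = \<langle>x, u\<rangle>\<close> the equation says that \<open>x + a u\<close> has the same length as \<open>x\<close>.\<close>

lemma isometry_scalar_exists:
  assumes p: "p \<in> carrier_mat 1 1" "adj p = - p" and c: "c \<in> carrier_mat 1 1" "c \<noteq> 0\<^sub>m 1 1"
  obtains a where "a \<in> carrier_mat 1 1" "a \<noteq> 0\<^sub>m 1 1" "a * p * adj a + (c * adj a - a * adj c) = 0\<^sub>m 1 1"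
proof (cases "p = 0\<^sub>m 1 1")
  case True
  have "c * p * adj c + (c * adj c - c * adj c) = 0\<^sub>m 1 1" using c True by (simp add: mat_dim_simps)
  then show thesis using that c by blast
next
  case False
  obtain p' where p': "p' \<in> carrier_mat 1 1" "p * p' = 1\<^sub>m 1" "p' * p = 1\<^sub>m 1"
    using one_by_one_mat_inverse[OF p(1) False] by blast
  \<comment> \<open>The solution will be a = -2 c p^-1, for which x + a u is the image of x under
    the reflection that negates u. The factor 2 is nonzero in characteristic 0, so a is
    nonzero.\<close>
  define P where "P = p' + p'"
  have P: "P \<in> carrier_mat 1 1" using p' by (simp add: P_def)
  have pP: "p * P = 1\<^sub>m 1 + 1\<^sub>m 1" using p p' by (simp add: P_def mat_dim_simps)
  have "P \<noteq> 0\<^sub>m 1 1"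
  proof
    assume "P = 0\<^sub>m 1 1"
    then have "1\<^sub>m 1 + 1\<^sub>m 1 = (0\<^sub>m 1 1 :: 'b mat)" using pP p by simp
    then have "(1\<^sub>m 1 + 1\<^sub>m 1 :: 'b mat) $$ (0, 0) = 0\<^sub>m 1 1 $$ (0, 0)" by simp
    then show False by simp
  qed
  have "adj p' * adj p = 1\<^sub>m 1" using adj_mult[of p p'] p(1) p'(1,2) by simp
  then have "- (adj p' * p) = 1\<^sub>m 1" unfolding p(2) using p(1) p'(1) by (simp add: mat_dim_simps)
  then have "adj p' * p = - 1\<^sub>m 1" by (metis uminus_uminus_mat)
  then have "adj p' * p * p' = - p'" using p' by (simp add: mat_dim_simps)
  then have "adj p' = - p'" using p p' by (simp add: assoc_mult_mat_dim)
  then have aP: "adj P = - P" using p' by (simp add: P_def adj_add) (auto intro!: eq_matI)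
  define a where "a = c * P"
  have a: "a \<in> carrier_mat 1 1" using c P by (simp add: a_def)
  have "a * p * adj a = - (c * P * (p * P) * adj c)" using c P p aP
    by (simp add: a_def adj_mult mat_dim_simps)
  also have "\<dots> = - (a * adj c + a * adj c)" unfolding pP using c P
    by (simp add: a_def mat_dim_simps)
  finally have 1: "a * p * adj a = - (a * adj c + a * adj c)" .
  have 2: "c * adj a = - (a * adj c)" using c P aP by (simp add: a_def adj_mult mat_dim_simps)
  have "(- a) * p * adj (- a) + (c * adj (- a) - (- a) * adj c) =
      a * p * adj a + (- (c * adj a) - - (a * adj c))"
    using a p c by (simp add: adj_uminus mat_dim_simps)
  also have "\<dots> = 0\<^sub>m 1 1" unfolding 1 2 using a c by (intro eq_matI) auto
  finally have "(- a) * p * adj (- a) + (c * adj (- a) - (- a) * adj c) = 0\<^sub>m 1 1" .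
  moreover have "a \<noteq> 0\<^sub>m 1 1" unfolding a_def
    using one_by_one_mat_mult_nonzero[OF c P \<open>P \<noteq> 0\<^sub>m 1 1\<close>] .
  then have "- a \<noteq> 0\<^sub>m 1 1" using a by (auto simp: mat_eq_iff)
  ultimately show thesis using that[of "- a"] a by simp
qed

text \<open>If \<open>x - y\<close> is orthogonal to \<open>x\<close>, two quasi-reflections through a vector \<open>z = x + u\<close> of the same length
  are used, where \<open>u\<close> is orthogonal to \<open>X\<close> but neither to \<open>x\<close> nor to \<open>y\<close>.\<close>

lemma one_step_isometry_extension:
  assumes X: "X \<in> carrier_mat k n" and x: "x \<in> carrier_mat 1 n" and y: "y \<in> carrier_mat 1 n"
    and eq: "gram x x = gram y y" and Xeq: "gram X x = gram X y"
    and full: "full_row_rank (X @\<^sub>r x)" "full_row_rank (X @\<^sub>r y)"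
  obtains g where "g \<in> isometries" "X * g = X" "x * g = y"
proof (cases "gram x (x - y) = 0\<^sub>m 1 1")
  case False
  have "gram X (x - y) = 0\<^sub>m k 1" using X x y Xeq by (simp add: gram_minus mat_dim_simps)
  then show thesis using quasi_reflection[OF x y eq False] X that by metis
next
  case True
  note [simp] = carrier_matD[OF X] carrier_matD[OF x] carrier_matD[OF y]
  have gc: "gram v w \<in> carrier_mat 1 1" if "v \<in> carrier_mat 1 n" "w \<in> carrier_mat 1 n" for v w
    using that by (intro carrier_matI) auto
  have xy: "gram x y = gram x x"
    using True minus_mat_eq_0_iff[OF gc[OF x x] gc[OF x y]] by (simp add: gram_minus)
  obtain u1 where u1: "u1 \<in> carrier_mat 1 n" "gram X u1 = 0\<^sub>m k 1" "gram x u1 = 1\<^sub>m 1"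
    using gram_dual_vector[OF X x full(1)] .
  obtain u2 where u2: "u2 \<in> carrier_mat 1 n" "gram X u2 = 0\<^sub>m k 1" "gram y u2 = 1\<^sub>m 1"
    using gram_dual_vector[OF X y full(2)] .
  note [simp] = carrier_matD[OF u1(1)] carrier_matD[OF u2(1)]
  \<comment> \<open>\<open>u1\<close> pairs to 1 with x and \<open>u2\<close> with y. If neither of
    them serves for both vectors, their sum does.\<close>
  have "\<exists>u \<in> carrier_mat 1 n. gram X u = 0\<^sub>m k 1 \<and> gram x u \<noteq> 0\<^sub>m 1 1 \<and> gram y u \<noteq> 0\<^sub>m 1 1"
  proof -
    consider "gram y u1 \<noteq> 0\<^sub>m 1 1" | "gram x u2 \<noteq> 0\<^sub>m 1 1" | "gram y u1 = 0\<^sub>m 1 1" "gram x u2 = 0\<^sub>m 1 1" by blast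
    then show ?thesis
    proof cases
      case 1
      then show ?thesis using u1 one_mat_neq_zero by (metis (no_types))
    next
      case 2
      then show ?thesis using u2 one_mat_neq_zero by (metis (no_types))
    next
      case 3
      have "gram x (u1 + u2) = 1\<^sub>m 1" "gram y (u1 + u2) = 1\<^sub>m 1" "gram X (u1 + u2) = 0\<^sub>m k 1"
        using 3 u1 u2 by (simp_all add: gram_add mat_dim_simps)
      then show ?thesis using one_mat_neq_zero add_carrier_mat[OF u2(1), of u1] by (metis (no_types))
    qed
  qed
  then obtain u0 where u0: "u0 \<in> carrier_mat 1 n" "gram X u0 = 0\<^sub>m k 1" "gram x u0 \<noteq> 0\<^sub>m 1 1"
    "gram y u0 \<noteq> 0\<^sub>m 1 1" by blast
  note [simp] = carrier_matD[OF u0(1)]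
  obtain a where a: "a \<in> carrier_mat 1 1" "a \<noteq> 0\<^sub>m 1 1"
    "a * gram u0 u0 * adj a + (gram x u0 * adj a - a * adj (gram x u0)) = 0\<^sub>m 1 1"
    using isometry_scalar_exists[OF gc[OF u0(1) u0(1)] _ gc[OF x u0(1)] u0(3)] adj_gram[of u0 u0] by auto
  note [simp] = carrier_matD[OF a(1)]
  have a': "adj a \<in> carrier_mat 1 1" "adj a \<noteq> 0\<^sub>m 1 1" using a by (auto simp: adj_eq_zero_iff)
  define u where "u = a * u0"
  have u: "u \<in> carrier_mat 1 n" using a u0 by (simp add: u_def)
  note [simp] = carrier_matD[OF u]
  have Xu: "gram X u = 0\<^sub>m k 1" using u0 by (simp add: u_def gram_mult mat_dim_simps)
  have xu: "gram x u \<noteq> 0\<^sub>m 1 1" "gram y u \<noteq> 0\<^sub>m 1 1"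
    using one_by_one_mat_mult_nonzero[OF gc[OF x u0(1)] u0(3) a'] one_by_one_mat_mult_nonzero[OF gc[OF y u0(1)] u0(4) a']
    by (simp_all add: u_def gram_mult)
  have "gram u u + (gram x u + gram u x) = a * gram u0 u0 * adj a + (gram x u0 * adj a + a * gram u0 x)"
    by (simp add: u_def gram_mult mat_dim_simps)
  also have "gram u0 x = - adj (gram x u0)" by (simp add: adj_gram)
  also have "a * gram u0 u0 * adj a + (gram x u0 * adj a + a * - adj (gram x u0)) = 0\<^sub>m 1 1"
    using a(3) by (simp add: mat_dim_simps) (simp add: mat_eq_iff)
  finally have uu: "gram u u + (gram x u + gram u x) = 0\<^sub>m 1 1" .
  define z where "z = x + u"
  have z: "z \<in> carrier_mat 1 n" using x u by (simp add: z_def)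
  note [simp] = carrier_matD[OF z]
  have "gram z z = gram x x + (gram u u + (gram x u + gram u x))"
    by (simp add: z_def gram_add) (auto intro!: eq_matI simp: ac_simps)
  then have zz: "gram x x = gram z z" using uu by (simp add: mat_dim_simps)
  have xz: "x - z = - u" by (auto simp: z_def intro!: eq_matI)
  have gu: "gram v (- u) = - gram v u" if "dim_col v = n" for v
    using that by (simp add: gram_def adj_uminus mat_dim_simps)
  have neg: "- M \<noteq> 0\<^sub>m 1 1" if "M \<noteq> 0\<^sub>m 1 1" for M :: "'b mat"
    using that by (metis uminus_uminus_mat zero_add_mat_dim(6))
  have 1: "gram x (x - z) \<noteq> 0\<^sub>m 1 1" unfolding xz using neg[OF xu(1)] by (simp add: gu)
  obtain g1 where g1: "g1 \<in> isometries" "x * g1 = z" "X * g1 = X"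
    using quasi_reflection[OF x z zz 1] X Xu unfolding xz by (metis (no_types, lifting) gu[OF carrier_matD(2)[OF X]] zero_add_mat_dim(6))
  \<comment> \<open>The step from z to y is again a quasi-reflection: since
    \<open>gram x y = gram x x = gram z z\<close>, the denominator is \<open>- gram u y\<close>,
    which is nonzero by the choice of u.\<close>
  have "gram z (z - y) = gram z z - gram z y" by (simp add: gram_minus)
  also have "gram z y = gram x x + gram u y" by (simp add: z_def gram_add xy)
  also have "gram z z - (gram x x + gram u y) = - gram u y" unfolding zz by (intro eq_matI) auto
  finally have 2: "gram z (z - y) = - gram u y" .
  have "gram u y \<noteq> 0\<^sub>m 1 1" using xu(2) gram_zero_swap[of u y 1 1] by auto
  then have 3: "gram z (z - y) \<noteq> 0\<^sub>m 1 1" unfolding 2 by (rule neg)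
  have zy: "gram z z = gram y y" using zz eq by simp
  have "gram X (z - y) = 0\<^sub>m k 1"
    by (simp add: z_def gram_minus gram_add Xu Xeq) (auto intro!: eq_matI)
  then obtain g2 where g2: "g2 \<in> isometries" "z * g2 = y" "X * g2 = X"
    using quasi_reflection[OF z y zy 3] X by metis
  note [simp] = carrier_matD[OF isometriesD(1)[OF g1(1)]] carrier_matD[OF isometriesD(1)[OF g2(1)]]
  have "X * (g1 * g2) = X" "x * (g1 * g2) = y"
    using g1(2,3) g2(2,3) assoc_mult_mat_dim[of X g1 g2] assoc_mult_mat_dim[of x g1 g2] by simp_all
  then show thesis using that isometries_mult[OF g1(1) g2(1)] by blast
qed

lemma gram_append_rows_eqD:
  assumes "gram (X @\<^sub>r x) (X @\<^sub>r x) = gram (Y @\<^sub>r y) (Y @\<^sub>r y)"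
    and "X \<in> carrier_mat k n" "Y \<in> carrier_mat k n" "x \<in> carrier_mat l n" "y \<in> carrier_mat l n"
  shows "gram X X = gram Y Y" "gram X x = gram Y y" "gram x X = gram y Y" "gram x x = gram y y"
proof -
  have e: "append_cols (gram X X) (gram X x) @\<^sub>r append_cols (gram x X) (gram x x) =
      append_cols (gram Y Y) (gram Y y) @\<^sub>r append_cols (gram y Y) (gram y y)"
    using assms by (simp add: gram_append_rows append_cols_append_rows)
  have 1: "append_cols (gram X X) (gram X x) = append_cols (gram Y Y) (gram Y y)"
    by (rule append_rows_inject(1)[OF e]) (use assms(2-) in auto)
  have 2: "append_cols (gram x X) (gram x x) = append_cols (gram y Y) (gram y y)"
    by (rule append_rows_inject(2)[OF e]) (use assms(2-) in auto)
  show "gram X X = gram Y Y" "gram X x = gram Y y"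
    using append_cols_inject[OF 1] assms(2-) by auto
  show "gram x X = gram y Y" "gram x x = gram y y"
    using append_cols_inject[OF 2] assms(2-) by auto
qed

text \<open>The span of X may be degenerate, so it cannot be split off as an orthogonal summand. The
  rows are matched one at a time instead, each new one by an isometry that fixes the rows already
  matched.\<close>

theorem witt_extension:
  assumes "X \<in> carrier_mat k n" "Y \<in> carrier_mat k n" "full_row_rank X" "full_row_rank Y"
    and "gram X X = gram Y Y"
  obtains g where "g \<in> isometries" "X * g = Y"
proof -
  have "\<exists>g \<in> isometries. X * g = Y"
    using assms
  proof (induction k arbitrary: X Y)
    case 0
    then have "X * 1\<^sub>m n = Y" by (intro eq_matI) auto
    then show ?case using isometries_one by blast
  next
    case (Suc k)
    obtain X0 x where X: "X0 \<in> carrier_mat k n" "x \<in> carrier_mat 1 n" "X = X0 @\<^sub>r x"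
      using append_rows_split[of X k 1] Suc.prems(1) by (metis carrier_matD Suc_eq_plus1)
    obtain Y0 y where Y: "Y0 \<in> carrier_mat k n" "y \<in> carrier_mat 1 n" "Y = Y0 @\<^sub>r y"
      using append_rows_split[of Y k 1] Suc.prems(2) by (metis carrier_matD Suc_eq_plus1)
    have fX: "full_row_rank X0" using full_row_rank_appendD(1)[of X0 x] X Suc.prems(3) by blast
    have fY: "full_row_rank Y0" using full_row_rank_appendD(1)[of Y0 y] Y Suc.prems(4) by blast
    have G: "gram X0 X0 = gram Y0 Y0"
      using gram_append_rows_eqD(1)[of X0 x Y0 y k 1] X Y Suc.prems(5) by simp
    obtain g where g: "g \<in> isometries" "X0 * g = Y0" using Suc.IH[OF X(1) Y(1) fX fY G] by blast
    note [simp] = carrier_matD[OF isometriesD(1)[OF g(1)]]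
    have xg: "x * g \<in> carrier_mat 1 n" using X(2) isometriesD(1)[OF g(1)] by simp
    have Xg: "X * g = Y0 @\<^sub>r x * g" using X g by (simp add: append_rows_mult)
    have full: "full_row_rank (Y0 @\<^sub>r x * g)"
      using full_row_rank_isometry[OF Suc.prems(3) _ g(1)] Suc.prems(1) Xg by simp
    have "gram (Y0 @\<^sub>r x * g) (Y0 @\<^sub>r x * g) = gram (Y0 @\<^sub>r y) (Y0 @\<^sub>r y)"
      unfolding Xg[symmetric] Y(3)[symmetric] using gram_isometry[OF g(1), of X X] Suc.prems by simp
    note * = gram_append_rows_eqD[OF this Y(1) Y(1) xg Y(2)]
    obtain h where h: "h \<in> isometries" "Y0 * h = Y0" "x * g * h = y"
      using one_step_isometry_extension[OF Y(1) xg Y(2) *(4) *(2) full] Suc.prems(4) Y(3) by blast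
    note [simp] = carrier_matD[OF isometriesD(1)[OF h(1)]]
    have "X * (g * h) = X * g * h" using Suc.prems(1) by (simp add: assoc_mult_mat_dim)
    also have "\<dots> = Y0 * h @\<^sub>r x * g * h" unfolding Xg using X Y by (simp add: append_rows_mult)
    also have "\<dots> = Y" using h Y(3) by simp
    finally show ?case using isometries_mult[OF g(1) h(1)] by blast
  qed
  then show thesis using that by blast
qed

end

section \<open>Normal form and equivalence of Lagrangians\<close>

context skew_hermitian_space
begin

text \<open>Nondegeneracy gives \<open>\<psi> * adj K\<close> the left inverse
  \<open>adj T * \<phi>\<close>, hence column rank l, and the rows of X lie in its left
  kernel.\<close>

lemma gram_orthogonal_le:
  assumes X: "X \<in> carrier_mat a n" "full_row_rank X" and K: "K \<in> carrier_mat l n" "full_row_rank K"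
    and XK: "gram X K = 0\<^sub>m a l"
  shows "a + l \<le> n"
proof -
  obtain T where T: "T \<in> carrier_mat n l" "K * T = 1\<^sub>m l" using full_row_rankE[OF K(2,1)] .
  have "adj T * adj K = 1\<^sub>m l" using adj_mult[of K T] T K(1) by simp
  have "adj T * \<phi> * (\<psi> * adj K) = adj T * ((\<phi> * \<psi>) * adj K)"
    using T(1) K(1) by (simp add: assoc_mult_mat_dim)
  then have 1: "adj T * \<phi> * (\<psi> * adj K) = 1\<^sub>m l"
    using phi_psi K(1) \<open>adj T * adj K = 1\<^sub>m l\<close> by simp
  have 2: "X * (\<psi> * adj K) = 0\<^sub>m a l" using XK X(1) K(1) by (simp add: gram_def assoc_mult_mat_dim)
  have c: "\<psi> * adj K \<in> carrier_mat n l" "adj T * \<phi> \<in> carrier_mat l n"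
    using K(1) T(1) by (auto intro!: carrier_matI)
  show ?thesis by (rule full_row_rank_mult_zero_le[OF X(1) c X(2) 1 2])
qed

text \<open>E already exhausts the orthogonal complement of K: the part of v outside its span would
  supply e + 1 independent rows orthogonal to K, against \<open>gram_orthogonal_le\<close>.\<close>

lemma orthogonal_complement_span:
  assumes E: "E \<in> carrier_mat e n" "full_row_rank E" and K: "K \<in> carrier_mat l n" "full_row_rank K"
    and EK: "gram E K = 0\<^sub>m e l" and dims: "e + l = n"
    and v: "v \<in> carrier_mat j n" "gram v K = 0\<^sub>m j l"
  obtains c where "c \<in> carrier_mat j e" "v = c * E"
proof -
  obtain Q where Q: "Q \<in> carrier_mat n e" "E * Q = 1\<^sub>m e" using full_row_rankE[OF E(2,1)] .
  have vQ: "v * Q \<in> carrier_mat j e" "v * Q * E \<in> carrier_mat j n" using v Q E by auto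
  define v' where "v' = v - v * Q * E"
  have v': "v' \<in> carrier_mat j n" unfolding v'_def by (rule minus_carrier_mat[OF vQ(2)])
  have "v' = 0\<^sub>m j n"
  proof (rule ccontr)
    assume "v' \<noteq> 0\<^sub>m j n"
    then obtain d where d: "d \<in> carrier_mat 1 j" "d * v' \<noteq> 0\<^sub>m 1 n" using nonzero_mat_row[OF v'] by blast
    have dv: "d * v' \<in> carrier_mat 1 n" using d v' by simp
    have "v' * Q = 0\<^sub>m j e" using v Q E(1) by (simp add: v'_def mat_dim_simps)
    then have 1: "d * v' * Q = 0\<^sub>m 1 e" using d v' Q by (simp add: mat_dim_simps)
    have "gram v' K = gram v K - v * Q * gram E K"
      unfolding v'_def using v(1) Q(1) E(1) K(1) by (simp add: gram_minus gram_mult assoc_mult_mat_dim)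
    then have "gram v' K = 0\<^sub>m j l" using v EK Q(1) by (simp add: mat_dim_simps)
    then have 2: "gram (d * v') K = 0\<^sub>m 1 l" using d v' K by (simp add: gram_mult mat_dim_simps)
    have full: "full_row_rank (E @\<^sub>r d * v')"
      by (rule full_row_rank_append[OF E(1) dv Q 1 full_row_rank_single[OF dv d(2)]])
    have "gram (E @\<^sub>r d * v') K = 0\<^sub>m e l @\<^sub>r 0\<^sub>m 1 l"
      using E(1) v' K(1) EK 2 by (simp add: gram_append_rows)
    then have "gram (E @\<^sub>r d * v') K = 0\<^sub>m (e + 1) l" by (simp only: zero_append)
    then have "(e + 1) + l \<le> n"
      using gram_orthogonal_le[OF carrier_append_rows[OF E(1) dv] full K] by blast
    then show False using dims by simp
  qed
  then have "v = v * Q * E" using minus_mat_eq_0_iff[OF v(1) vQ(2)] by (simp add: v'_def)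
  then show thesis using that[OF vQ(1)] by blast
qed

text \<open>\<open>A2\<close> and \<open>B2\<close> have the same number of rows because \<open>A2\<close> is orthogonal to \<open>(A1, A2)\<close> and \<open>B2\<close> to
  \<open>(B1, B2)\<close>, which bounds either number by the other.\<close>

lemma lagrangian_decomposition:
  assumes A: "A \<in> carrier_mat n n" and B: "B \<in> carrier_mat n n"
    and full: "full_row_rank (append_cols A B)" and iso: "gram A A = gram B B"
  obtains s l A1 A2 B1 B2 where "s + 2 * l = n"
    "A1 \<in> carrier_mat s n" "A2 \<in> carrier_mat l n" "B1 \<in> carrier_mat s n" "B2 \<in> carrier_mat l n"
    "full_row_rank (A1 @\<^sub>r A2)" "full_row_rank (B1 @\<^sub>r B2)" "gram A1 A1 = gram B1 B1"
    "gram A1 A2 = 0\<^sub>m s l" "gram A2 A2 = 0\<^sub>m l l" "gram B1 B2 = 0\<^sub>m s l" "gram B2 B2 = 0\<^sub>m l l"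
    "row_equiv (append_cols A B) (append_cols ((A1 @\<^sub>r A2) @\<^sub>r 0\<^sub>m l n) ((B1 @\<^sub>r 0\<^sub>m l n) @\<^sub>r B2))"
proof -
  obtain k A0 where k: "k \<le> n" "A0 \<in> carrier_mat k n" "full_row_rank A0"
    "row_equiv A (A0 @\<^sub>r 0\<^sub>m (n - k) n)" using row_equiv_normal_form[OF A] .
  define l where "l = n - k"
  have kl: "k + l = n" using k(1) by (simp add: l_def)
  obtain M where M: "dim_row M = n" "dim_col M = n"
    "row_equiv (append_cols A B) (append_cols (A0 @\<^sub>r 0\<^sub>m l n) M)"
    using row_equiv_join[OF k(4), of B] A B unfolding l_def by (metis carrier_matD)
  obtain B0 B2 where B02: "B0 \<in> carrier_mat k n" "B2 \<in> carrier_mat l n" "M = B0 @\<^sub>r B2"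
    using append_rows_split[of M k l] M kl by metis
  have M2: "append_cols (A0 @\<^sub>r 0\<^sub>m l n) M = append_cols A0 B0 @\<^sub>r append_cols (0\<^sub>m l n) B2"
    using B02 k(2) by (simp add: append_cols_append_rows)
  have "full_row_rank (append_cols A0 B0 @\<^sub>r append_cols (0\<^sub>m l n) B2)"
    using row_equiv_full_row_rank[OF M(3) full] unfolding M2 .
  \<comment> \<open>Where the left half vanishes, independence of the rows of the pair must come
    from the right half, so \<open>B2\<close> has independent rows.\<close>
  then have "full_row_rank (append_cols (0\<^sub>m l n) B2)"
    by (rule full_row_rank_appendD(2)[of _ _ k "n + n" l]) (use B02 k(2) in \<open>auto intro!: carrier_matI\<close>)
  then obtain T where T: "T \<in> carrier_mat (n + n) l" "append_cols (0\<^sub>m l n) B2 * T = 1\<^sub>m l"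
    by (rule full_row_rankE) (use B02 in \<open>auto intro!: carrier_matI\<close>)
  obtain T1 Q where T12: "T1 \<in> carrier_mat n l" "Q \<in> carrier_mat n l" "T = T1 @\<^sub>r Q"
    using append_rows_split[of T n n] T(1) by (metis carrier_matD)
  have Q: "Q \<in> carrier_mat n l" "B2 * Q = 1\<^sub>m l"
    using T(2) T12 B02 by (simp_all add: append_cols_mult_append_rows mat_dim_simps)
  \<comment> \<open>Adding multiples of (0 | B2) to the upper rows leaves \<open>A0\<close> alone.
    This choice of C gives \<open>B0' * Q = 0\<close>, so what remains of \<open>B0\<close> is
    independent of \<open>B2\<close>.\<close>
  define C where "C = - (B0 * Q)"
  have C: "C \<in> carrier_mat k l" using B02 Q by (simp add: C_def)
  define B0' where "B0' = B0 + C * B2"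
  have B0': "B0' \<in> carrier_mat k n" using B02 C by (simp add: B0'_def)
  have B0Q: "B0' * Q = 0\<^sub>m k l" using B02 Q by (simp add: B0'_def C_def mat_dim_simps)
  have "row_equiv (append_cols A0 B0 @\<^sub>r append_cols (0\<^sub>m l n) B2)
     ((append_cols A0 B0 + C * append_cols (0\<^sub>m l n) B2) @\<^sub>r append_cols (0\<^sub>m l n) B2)"
    by (rule row_equiv_add[OF _ _ C, of _ "n + n"]) (use B02 k(2) in \<open>auto intro!: carrier_matI\<close>)
  also have "append_cols A0 B0 + C * append_cols (0\<^sub>m l n) B2 = append_cols A0 B0'"
    using B02 k(2) C by (simp add: mult_append_cols append_cols_add B0'_def mat_dim_simps)
  finally have step2: "row_equiv (append_cols A B) (append_cols A0 B0' @\<^sub>r append_cols (0\<^sub>m l n) B2)"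
    using M(3) unfolding M2 by (rule row_equiv_trans[rotated])
  \<comment> \<open>A second reduction, now of the right half and only among the upper k rows. It
    replaces \<open>A0\<close> by \<open>U * A0\<close>, whose rows are still independent.\<close>
  obtain s B1 where s: "s \<le> k" "B1 \<in> carrier_mat s n" "full_row_rank B1"
    "row_equiv B0' (B1 @\<^sub>r 0\<^sub>m (k - s) n)" using row_equiv_normal_form[OF B0'] .
  define l' where "l' = k - s"
  have sl: "s + l' = k" using s(1) by (simp add: l'_def)
  obtain A' where A': "dim_row A' = k" "dim_col A' = n"
    "row_equiv (append_cols A0 B0') (append_cols A' (B1 @\<^sub>r 0\<^sub>m l' n))"
    using row_equiv_join[OF s(4), of A0] B0' k(2) unfolding l'_def by (metis carrier_matD)
  obtain U V where U: "U \<in> carrier_mat k k" "V \<in> carrier_mat k k" "U * V = 1\<^sub>m k" "V * U = 1\<^sub>m k"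
    "A' = U * A0" "B1 @\<^sub>r 0\<^sub>m l' n = U * B0'"
    by (rule row_equiv_append_cols[OF A'(3), of k]) (use A' B0' k(2) s(2) sl in auto)
  have fA': "full_row_rank A'"
    using row_equiv_full_row_rank[OF row_equivI[OF U(1-4) _ U(5)] k(3)] k(2) by simp
  obtain A1 A2 where A12: "A1 \<in> carrier_mat s n" "A2 \<in> carrier_mat l' n" "A' = A1 @\<^sub>r A2"
    using append_rows_split[of A' s l'] A' sl by metis
  have "B1 * Q @\<^sub>r 0\<^sub>m l' n * Q = U * (B0' * Q)"
    using U(1,6) B0' Q(1) s(2) by (metis append_rows_mult assoc_mult_mat_dim carrier_matD index_zero_mat(3))
  also have "\<dots> = 0\<^sub>m s l @\<^sub>r 0\<^sub>m l' l" unfolding B0Q zero_append sl using U(1) by (simp add: mat_dim_simps)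
  finally have "B1 * Q = 0\<^sub>m s l"
    by (rule append_rows_inject(1)) (use s(2) Q(1) in auto)
  obtain Q' where Q': "Q' \<in> carrier_mat n s" "B1 * Q' = 1\<^sub>m s" using full_row_rankE[OF s(3,2)] .
  have "full_row_rank (B2 @\<^sub>r B1)"
    by (rule full_row_rank_append[OF B02(2) s(2) Q \<open>B1 * Q = 0\<^sub>m s l\<close> s(3)])
  then have fB: "full_row_rank (B1 @\<^sub>r B2)"
    by (rule row_equiv_full_row_rank[rotated]) (use B02 s(2) in \<open>auto intro: row_equiv_swap\<close>)
  have "row_equiv (append_cols A0 B0' @\<^sub>r append_cols (0\<^sub>m l n) B2)
      (append_cols A' (B1 @\<^sub>r 0\<^sub>m l' n) @\<^sub>r append_cols (0\<^sub>m l n) B2)"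
    by (rule row_equiv_append_rows[OF A'(3) row_equiv_refl]) (use B02 B0' k(2) in auto)
  then have "row_equiv (append_cols A B) (append_cols A' (B1 @\<^sub>r 0\<^sub>m l' n) @\<^sub>r append_cols (0\<^sub>m l n) B2)"
    by (rule row_equiv_trans[OF step2])
  also have "append_cols A' (B1 @\<^sub>r 0\<^sub>m l' n) @\<^sub>r append_cols (0\<^sub>m l n) B2 =
      append_cols (A' @\<^sub>r 0\<^sub>m l n) ((B1 @\<^sub>r 0\<^sub>m l' n) @\<^sub>r B2)"
    using A' B02 s(2) sl by (subst append_cols_append_rows) auto
  finally have eqv: "row_equiv (append_cols A B) (append_cols (A' @\<^sub>r 0\<^sub>m l n) ((B1 @\<^sub>r 0\<^sub>m l' n) @\<^sub>r B2))" .
  obtain U' where U': "U' \<in> carrier_mat n n" "A' @\<^sub>r 0\<^sub>m l n = U' * A" "(B1 @\<^sub>r 0\<^sub>m l' n) @\<^sub>r B2 = U' * B"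
    by (rule row_equiv_append_cols[OF eqv, of n]) (use A B A' B02 s(2) sl kl in auto)
  \<comment> \<open>The equality of Gram matrices survives the row operations. Read block by block,
    each zero block in one half forces the rows opposite to it to be isotropic and orthogonal to the
    other rows of their half.\<close>
  have "gram (A' @\<^sub>r 0\<^sub>m l n) (A' @\<^sub>r 0\<^sub>m l n) = gram ((B1 @\<^sub>r 0\<^sub>m l' n) @\<^sub>r B2) ((B1 @\<^sub>r 0\<^sub>m l' n) @\<^sub>r B2)"
    unfolding U' using U'(1) A B iso by (simp add: gram_mult)
  note g1 = gram_append_rows_eqD[OF this, of k l]
  have zg: "gram (0\<^sub>m a n) Z = 0\<^sub>m a (dim_row Z)" "gram Z (0\<^sub>m a n) = 0\<^sub>m (dim_row Z) a" if "dim_col Z = n" for a Z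
    using that by (simp_all add: gram_def mat_dim_simps)
  have B10: "B1 @\<^sub>r 0\<^sub>m l' n \<in> carrier_mat k n"
    using carrier_append_rows[OF s(2) zero_carrier_mat[of l' n]] sl by simp
  have A'c: "A' \<in> carrier_mat k n" using A' by auto
  have g: "gram (A1 @\<^sub>r A2) (A1 @\<^sub>r A2) = gram (B1 @\<^sub>r 0\<^sub>m l' n) (B1 @\<^sub>r 0\<^sub>m l' n)"
    "0\<^sub>m k l = gram (B1 @\<^sub>r 0\<^sub>m l' n) B2" "0\<^sub>m l l = gram B2 B2"
    using g1[OF A'c B10 zero_carrier_mat B02(2)] A12 sl by (simp_all add: zg)
  note gA = gram_append_rows_eqD[OF g(1) A12(1) s(2) A12(2) zero_carrier_mat]
  have "0\<^sub>m s l @\<^sub>r 0\<^sub>m l' l = gram B1 B2 @\<^sub>r 0\<^sub>m l' l"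
    using g(2) s(2) B02 by (simp add: gram_append_rows zg zero_append sl)
  then have gB12: "0\<^sub>m s l = gram B1 B2" by (rule append_rows_inject(1)) (use s(2) B02 in auto)
  have gA2: "gram A1 A2 = 0\<^sub>m s l'" "gram A2 A2 = 0\<^sub>m l' l'" using gA(2,4) s(2) by (simp_all add: zg)
  have fA2: "full_row_rank A2" using full_row_rank_appendD(2)[OF fA'[unfolded A12(3)] A12(1,2)] .
  have fB2: "full_row_rank B2" using full_row_rank_appendD(2)[OF fB s(2) B02(2)] .
  have "gram (A1 @\<^sub>r A2) A2 = 0\<^sub>m (s + l') l'"
    using A12 gA2 by (simp add: gram_append_rows zero_append)
  then have "(s + l') + l' \<le> n"
    using gram_orthogonal_le[OF _ fA'[unfolded A12(3)] A12(2) fA2] A12 carrier_append_rows by blast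
  moreover have "gram (B1 @\<^sub>r B2) B2 = 0\<^sub>m (s + l) l"
    using B02 s(2) gB12[symmetric] g(3)[symmetric] by (simp add: gram_append_rows zero_append)
  then have "(s + l) + l \<le> n"
    using gram_orthogonal_le[OF _ fB B02(2) fB2] B02 s(2) carrier_append_rows by blast
  ultimately have "l' = l" using kl sl by simp
  show thesis
  proof (rule that[of s l A1 A2 B1 B2])
    show "s + 2 * l = n" using kl sl \<open>l' = l\<close> by simp
    show "gram A1 A1 = gram B1 B1" using gA(1) .
  qed (use A12 B02 s(2) \<open>l' = l\<close> fA' fB gA2 gB12 g(3) eqv in simp_all)
qed

lemma aligned_lagrangian:
  assumes A: "A \<in> carrier_mat n n" and B: "B \<in> carrier_mat n n"
    and full: "full_row_rank (append_cols A B)" and iso: "gram A A = gram B B"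
  obtains s l A1 A2 g U V where "s + 2 * l = n" "has_rank A (s + l)" "g \<in> isometries"
    "A1 \<in> carrier_mat s n" "A2 \<in> carrier_mat l n" "full_row_rank (A1 @\<^sub>r A2)"
    "gram A1 A2 = 0\<^sub>m s l" "gram A2 A2 = 0\<^sub>m l l"
    "U \<in> carrier_mat n n" "V \<in> carrier_mat n n" "V * U = 1\<^sub>m n"
    "U * A = (A1 @\<^sub>r A2) @\<^sub>r 0\<^sub>m l n" "U * (B * g) = (A1 @\<^sub>r 0\<^sub>m l n) @\<^sub>r A2"
proof -
  obtain s l A1 A2 B1 B2 where *: "s + 2 * l = n"
    "A1 \<in> carrier_mat s n" "A2 \<in> carrier_mat l n" "B1 \<in> carrier_mat s n" "B2 \<in> carrier_mat l n"
    "full_row_rank (A1 @\<^sub>r A2)" "full_row_rank (B1 @\<^sub>r B2)" "gram A1 A1 = gram B1 B1"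
    "gram A1 A2 = 0\<^sub>m s l" "gram A2 A2 = 0\<^sub>m l l" "gram B1 B2 = 0\<^sub>m s l" "gram B2 B2 = 0\<^sub>m l l"
    "row_equiv (append_cols A B) (append_cols ((A1 @\<^sub>r A2) @\<^sub>r 0\<^sub>m l n) ((B1 @\<^sub>r 0\<^sub>m l n) @\<^sub>r B2))"
    using lagrangian_decomposition[OF assms] .
  obtain U V where U: "U \<in> carrier_mat n n" "V \<in> carrier_mat n n" "U * V = 1\<^sub>m n" "V * U = 1\<^sub>m n"
    "(A1 @\<^sub>r A2) @\<^sub>r 0\<^sub>m l n = U * A" "(B1 @\<^sub>r 0\<^sub>m l n) @\<^sub>r B2 = U * B"
    by (rule row_equiv_append_cols[OF *(13), of n]) (use A B *(1-5) in auto)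
  have "row_equiv A ((A1 @\<^sub>r A2) @\<^sub>r 0\<^sub>m l n)" using U A by (intro row_equivI[OF U(1-4)]) auto
  then have rank: "has_rank A (s + l)"
    by (rule row_equiv_has_rank[OF _ carrier_append_rows[OF *(2,3)] *(6)])
  have z: "gram A2 A1 = 0\<^sub>m l s" "gram B2 B1 = 0\<^sub>m l s"
    by (rule gram_zero_swap; use * in simp)+
  \<comment> \<open>Both Gram matrices consist of \<open>gram A1 A1\<close> bordered by
    zeros.\<close>
  have "gram (B1 @\<^sub>r B2) (B1 @\<^sub>r B2) = gram (A1 @\<^sub>r A2) (A1 @\<^sub>r A2)"
    using * z by (simp add: gram_append_rows)
  then obtain g where g: "g \<in> isometries" "(B1 @\<^sub>r B2) * g = A1 @\<^sub>r A2"
    by (rule witt_extension[OF carrier_append_rows[OF *(4,5)] carrier_append_rows[OF *(2,3)] *(7,6)])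
  note [simp] = carrier_matD[OF isometriesD(1)[OF g(1)]]
  have e: "B1 * g @\<^sub>r B2 * g = A1 @\<^sub>r A2" using g(2) *(2-5) by (simp add: append_rows_mult)
  have Bg: "B1 * g = A1" "B2 * g = A2" using append_rows_inject[OF e] *(2-5) by simp_all
  have "U * (B * g) = ((B1 @\<^sub>r 0\<^sub>m l n) @\<^sub>r B2) * g" using U B by (simp add: assoc_mult_mat_dim)
  also have "\<dots> = (A1 @\<^sub>r 0\<^sub>m l n) @\<^sub>r A2" using *(2-5) Bg by (simp add: append_rows_mult zero_mult_mat_dim)
  finally show thesis using that[OF *(1) rank g(1) *(2,3,6,9,10) U(1,2,4) U(5)[symmetric]] by blast
qed

text \<open>After alignment, a single isometry that takes \<open>A2\<close> to \<open>C2\<close> is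
  applied to both halves. What then separates the two Lagrangians is one row operation, collected in
  \<open>W\<close> together with the two reductions.\<close>

theorem lagrangian_equivalence:
  assumes A: "A \<in> carrier_mat n n" and B: "B \<in> carrier_mat n n"
    and L: "full_row_rank (append_cols A B)" "gram A A = gram B B"
    and A': "A' \<in> carrier_mat n n" and B': "B' \<in> carrier_mat n n"
    and L': "full_row_rank (append_cols A' B')" "gram A' A' = gram B' B'"
    and rank: "has_rank A k" "has_rank A' k"
  obtains W g h where "W \<in> carrier_mat n n" "g \<in> isometries" "h \<in> isometries"
    "A = W * A' * g" "B = W * B' * h"
proof -
  have rank_unique: "i = j" if "has_rank M i" "has_rank M j" for M :: "'b mat" and i j
    using has_rank_le[OF that, of "1\<^sub>m (dim_row M)" "1\<^sub>m (dim_col M)"]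
      has_rank_le[OF that(2,1), of "1\<^sub>m (dim_row M)" "1\<^sub>m (dim_col M)"] by simp
  obtain s l A1 A2 g U V where a: "s + 2 * l = n" "has_rank A (s + l)" "g \<in> isometries"
    "A1 \<in> carrier_mat s n" "A2 \<in> carrier_mat l n" "full_row_rank (A1 @\<^sub>r A2)"
    "gram A1 A2 = 0\<^sub>m s l" "gram A2 A2 = 0\<^sub>m l l"
    "U \<in> carrier_mat n n" "V \<in> carrier_mat n n" "V * U = 1\<^sub>m n"
    "U * A = (A1 @\<^sub>r A2) @\<^sub>r 0\<^sub>m l n" "U * (B * g) = (A1 @\<^sub>r 0\<^sub>m l n) @\<^sub>r A2"
    using aligned_lagrangian[OF A B L] .
  obtain s' l' C1 C2 g' U' V' where c0: "s' + 2 * l' = n" "has_rank A' (s' + l')" "g' \<in> isometries"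
    "C1 \<in> carrier_mat s' n" "C2 \<in> carrier_mat l' n" "full_row_rank (C1 @\<^sub>r C2)"
    "gram C1 C2 = 0\<^sub>m s' l'" "gram C2 C2 = 0\<^sub>m l' l'"
    "U' \<in> carrier_mat n n" "V' \<in> carrier_mat n n" "V' * U' = 1\<^sub>m n"
    "U' * A' = (C1 @\<^sub>r C2) @\<^sub>r 0\<^sub>m l' n" "U' * (B' * g') = (C1 @\<^sub>r 0\<^sub>m l' n) @\<^sub>r C2"
    using aligned_lagrangian[OF A' B' L'] .
  \<comment> \<open>The rank fixes s + l and the dimension fixes s + 2 l, so s and l are
    determined.\<close>
  have "s + l = s' + l'" using rank_unique[OF a(2) rank(1)] rank_unique[OF c0(2) rank(2)] by simp
  then have sl: "s' = s" "l' = l" using a(1) c0(1) by simp_all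
  note c = c0[unfolded sl]
  have fA2: "full_row_rank A2" using full_row_rank_appendD(2)[OF a(6,4,5)] .
  have fC2: "full_row_rank C2" using full_row_rank_appendD(2)[OF c(6,4,5)] .
  obtain h where h: "h \<in> isometries" "A2 * h = C2"
    using witt_extension[OF a(5) c(5) fA2 fC2] a(8) c(8) by auto
  have hc: "h \<in> carrier_mat n n" "g \<in> carrier_mat n n" "g' \<in> carrier_mat n n"
    using isometriesD(1) h a c by blast+
  note [simp] = hc[THEN carrier_matD(1)] hc[THEN carrier_matD(2)]
  \<comment> \<open>\<open>C1\<close> and \<open>C2\<close> together span the orthogonal complement
    of \<open>C2\<close>, because s + l + l = n. The image of \<open>A1\<close> lies in it and is
    thus a combination of their rows.\<close>
  have "gram (A1 * h) C2 = 0\<^sub>m s l"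
    using gram_isometry[OF h(1), of A1 A2] a h(2) by simp
  moreover have "A1 * h \<in> carrier_mat s n" using a hc by simp
  moreover have "gram (C1 @\<^sub>r C2) C2 = 0\<^sub>m (s + l) l"
    using c by (simp add: gram_append_rows zero_append)
  moreover have "s + l + l = n" using a(1) by simp
  ultimately obtain D where D: "D \<in> carrier_mat s (s + l)" "A1 * h = D * (C1 @\<^sub>r C2)"
    using orthogonal_complement_span[OF carrier_append_rows[OF c(4,5)] c(6,5) fC2] by metis
  obtain M N where MN: "M \<in> carrier_mat s s" "N \<in> carrier_mat s l" "D = append_cols M N"
    using append_cols_split[of D s l] D(1) by (metis carrier_matD)
  have A1h: "A1 * h = M * C1 + N * C2" using D(2) MN c by (simp add: append_cols_mult_append_rows)
  define F where "F = four_block_mat M N (0\<^sub>m l s) (1\<^sub>m l)"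
  have F: "F \<in> carrier_mat (s + l) (s + l)" using MN by (simp add: F_def)
  \<comment> \<open>\<open>N\<close> occurs twice since \<open>C2\<close> is the second block of
    rows in the left half and the third one in the right half. With both copies the same
    \<open>T\<close> produces \<open>M * C1 + N * C2\<close> in either half.\<close>
  define T where "T = four_block_mat F (N @\<^sub>r 0\<^sub>m l l) (0\<^sub>m l (s + l)) (1\<^sub>m l)"
  have N0: "N @\<^sub>r 0\<^sub>m l l \<in> carrier_mat (s + l) l" using MN by (intro carrier_append_rows) auto
  have "T \<in> carrier_mat (s + l + l) (s + l + l)" using F by (simp add: T_def)
  moreover have "s + l + l = n" using a(1) by simp
  ultimately have T: "T \<in> carrier_mat n n" by simp
  have FC: "F * (C1 @\<^sub>r C2) = A1 * h @\<^sub>r C2" "F * (C1 @\<^sub>r 0\<^sub>m l n) = M * C1 @\<^sub>r 0\<^sub>m l n"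
    unfolding F_def A1h using MN c
    by (subst four_block_mult_append_rows[of _ s s _ l _ l _ _ n]; simp add: mat_dim_simps)+
  have 1: "T * ((C1 @\<^sub>r C2) @\<^sub>r 0\<^sub>m l n) = (A1 * h @\<^sub>r C2) @\<^sub>r 0\<^sub>m l n"
    unfolding T_def using F N0 c(4,5) MN(1,2) a(4)
    by (subst four_block_mult_append_rows[OF F N0 _ _ carrier_append_rows[OF c(4,5)]])
      (auto simp: FC mat_dim_simps)
  have 2: "T * ((C1 @\<^sub>r 0\<^sub>m l n) @\<^sub>r C2) = (A1 * h @\<^sub>r 0\<^sub>m l n) @\<^sub>r C2"
    unfolding T_def using F N0 c(4,5) MN
    by (subst four_block_mult_append_rows[OF F N0 _ _ carrier_append_rows[OF c(4) zero_carrier_mat] c(5)])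
      (auto simp: FC mat_dim_simps append_rows_mult append_rows_add A1h)
  define W where "W = V * T * U'"
  have W: "W \<in> carrier_mat n n" using a(10) T c(9) by (simp add: W_def)
  \<comment> \<open>Solves the equation for X with \<open>k\<close> as the inverse of
    \<open>h\<close>. It is applied to the left halves and to the right halves after
    alignment.\<close>
  have cancel: "X = W * X' * k" if X: "X \<in> carrier_mat n n" "X' \<in> carrier_mat n n" "k \<in> carrier_mat n n"
    "U * X * h = T * (U' * X')" "h * k = 1\<^sub>m n" for X X' k
  proof -
    have "V * (U * X * h) * k = (V * U) * X * (h * k)"
      using X(1,3) a(9,10) by (simp add: assoc_mult_mat_dim)
    then have "X = V * (U * X * h) * k" using X(1,5) a(11) by simp
    also have "\<dots> = W * X' * k" unfolding X(4) W_def using X a(10) T c(9) by (simp add: assoc_mult_mat_dim)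
    finally show ?thesis .
  qed
  obtain h' where h': "h' \<in> isometries" "h * h' = 1\<^sub>m n" using isometry_inverse[OF h(1)] by blast
  obtain gi where gi: "gi \<in> isometries" "g * gi = 1\<^sub>m n" using isometry_inverse[OF a(3)] by blast
  have ic: "h' \<in> carrier_mat n n" "gi \<in> carrier_mat n n" using isometriesD(1) h' gi by blast+
  have "U * A * h = T * (U' * A')"
    unfolding a(12) c(12) 1 using a(4,5) h(2) by (simp add: append_rows_mult zero_mult_mat_dim)
  then have Aeq: "A = W * A' * h'" by (rule cancel[OF A A' ic(1) _ h'(2)])
  have Bg: "B * g = W * (B' * g') * h'"
  proof (rule cancel[OF _ _ ic(1) _ h'(2)])
    show "U * (B * g) * h = T * (U' * (B' * g'))"
      unfolding a(13) c(13) 2 using a(4,5) h(2) by (simp add: append_rows_mult zero_mult_mat_dim)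
  qed (use B B' hc in auto)
  have "B = B * (g * gi)" using B gi by simp
  also have "\<dots> = (B * g) * gi" using B ic by (simp add: assoc_mult_mat_dim)
  also have "\<dots> = W * B' * (g' * h' * gi)" unfolding Bg using W B' ic by (simp add: assoc_mult_mat_dim)
  finally have "B = W * B' * (g' * h' * gi)" .
  with Aeq show thesis
    using that[OF W h'(1) isometries_mult[OF isometries_mult[OF c(3) h'(1)] gi(1)]] by blast
qed

end

section \<open>The main involution\<close>

text \<open>Cross-multiplication remains valid in a division ring because the integers are
  central.\<close>

lemma of_int_divide_eq_iff:
  fixes a b c d :: int
  assumes "b \<noteq> 0" "d \<noteq> 0"
  shows "of_int a / of_int b = (of_int c / of_int d :: 'b::{division_ring,ring_char_0}) \<longleftrightarrow> a * d = c * b"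
proof -
  have comm: "of_int x * of_int y = (of_int y * of_int x :: 'b)" for x y
    by (metis of_int_mult mult.commute)
  have "of_int a / of_int b = (of_int c / of_int d :: 'b) \<longleftrightarrow>
      of_int a / of_int b * (of_int b * of_int d) = (of_int c / of_int d * (of_int b * of_int d) :: 'b)"
    using assms by simp
  also have "of_int a / of_int b * (of_int b * of_int d) = (of_int (a * d) :: 'b)"
    using assms by (simp add: divide_inverse mult.assoc[symmetric]) (simp add: mult.assoc)
  also have "of_int c / of_int d * (of_int b * of_int d) = (of_int (c * b) :: 'b)"
    unfolding comm[of b d] using assms
    by (simp add: divide_inverse mult.assoc[symmetric]) (simp add: mult.assoc)
  finally show ?thesis by (simp only: of_int_eq_iff)
qed

lemma rat_embed_Fract:
  assumes "b \<noteq> 0"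
  shows "rat_embed (Fract a b) = (of_int a / of_int b :: 'b::{division_ring,ring_char_0})"
proof -
  obtain c d where cd: "quotient_of (Fract a b) = (c, d)" by fastforce
  then have d: "d > 0" by (rule quotient_of_denom_pos)
  have "Fract a b = Fract c d" using cd quotient_of_div[OF cd] by (simp add: Fract_of_int_quotient)
  then have "c * b = a * d" using assms d by (simp add: eq_rat)
  then have "of_int c / of_int d = (of_int a / of_int b :: 'b)"
    using assms d by (subst of_int_divide_eq_iff) auto
  then show ?thesis by (simp add: rat_embed_def cd)
qed

lemma rat_embed_of_int: "rat_embed (of_int a) = of_int a"
  using rat_embed_Fract[of 1 a] by (simp add: Fract_of_int_eq)

lemma rat_embed_1: "rat_embed 1 = 1"
  using rat_embed_of_int[of 1] by simp

lemma mult_eq_commute_inverse: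
  fixes x y :: "'a::division_ring"
  assumes "x * y = y * x"
  shows "inverse x * y = y * inverse x"
proof (cases "x = 0")
  case False
  have "inverse x * y = inverse x * (y * x) * inverse x" using False by (simp add: mult.assoc)
  also have "\<dots> = inverse x * (x * y) * inverse x" using assms by simp
  also have "\<dots> = y * inverse x" using False by (simp add: mult.assoc[symmetric])
  finally show ?thesis .
qed simp

lemma rat_embed_commute: "rat_embed q * x = x * rat_embed q"
proof (cases q)
  case (Fract a b)
  have "inverse (of_int b) * x = x * inverse (of_int b)"
    by (rule mult_eq_commute_inverse) (rule mult_of_int_commute)
  then have "of_int a * inverse (of_int b) * x = x * (of_int a * inverse (of_int b))"
    by (metis mult.assoc mult_of_int_commute)
  then show ?thesis using Fract by (simp add: rat_embed_Fract divide_inverse)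
qed

lemma rat_embed_Fract_mult_denom:
  "b \<noteq> 0 \<Longrightarrow> rat_embed (Fract a b) * of_int b = (of_int a :: 'b::{division_ring,ring_char_0})"
  by (simp add: rat_embed_Fract divide_inverse mult.assoc)

text \<open>Both sides agree after multiplication by the product of the denominators, which may be
  rearranged because rationals are central.\<close>

lemma rat_embed_mult: "rat_embed (p * q) = (rat_embed p * rat_embed q :: 'b::{division_ring,ring_char_0})"
proof (cases p; cases q)
  fix a b c d assume p: "p = Fract a b" "b > 0" and q: "q = Fract c d" "d > 0"
  have "rat_embed p * rat_embed q * (of_int b * of_int d :: 'b) =
      (rat_embed p * of_int b) * (rat_embed q * of_int d)"
    by (metis mult.assoc rat_embed_commute)
  also have "\<dots> = of_int a * of_int c"
    using p q by (simp add: rat_embed_Fract_mult_denom)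
  also have "\<dots> = rat_embed (p * q) * (of_int b * of_int d)"
    using p q rat_embed_Fract_mult_denom[of "b * d" "a * c", where ?'b = 'b] by simp
  finally show ?thesis using p q by simp
qed

lemma rat_embed_add: "rat_embed (p + q) = (rat_embed p + rat_embed q :: 'b::{division_ring,ring_char_0})"
proof (cases p; cases q)
  fix a b c d assume p: "p = Fract a b" "b > 0" and q: "q = Fract c d" "d > 0"
  have "(rat_embed p + rat_embed q) * (of_int b * of_int d :: 'b) =
      (rat_embed p * of_int b) * of_int d + (rat_embed q * of_int d) * of_int b"
    by (simp add: distrib_right mult.assoc) (metis mult_of_int_commute)
  also have "\<dots> = of_int (a * d + c * b)"
    using p q by (simp add: rat_embed_Fract_mult_denom)
  also have "\<dots> = rat_embed (p + q) * (of_int b * of_int d)"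
    using p q rat_embed_Fract_mult_denom[of "b * d" "a * d + c * b", where ?'b = 'b] by simp
  finally show ?thesis using p q by simp
qed

lemma rat_embed_minus: "rat_embed (- p) = - rat_embed p"
  using rat_embed_add[of p "- p"] by (simp add: rat_embed_0 eq_neg_iff_add_eq_0 add.commute)

locale definite_quaternion =
  fixes \<alpha> \<beta> :: int and \<zeta> \<xi> :: "'b::{division_ring,ring_char_0}"
  assumes quat: "definite_quaternion_algebra \<alpha> \<beta> \<zeta> \<xi>"
begin

lemma quat_comb_inverse: "inv_into UNIV (quat_comb \<zeta> \<xi>) (quat_comb \<zeta> \<xi> t) = t"
  using quat bij_is_inj inv_f_f unfolding definite_quaternion_algebra_def by metis

lemma quat_comb_cases:
  obtains a b c d where "x = quat_comb \<zeta> \<xi> (a, b, c, d)"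
  using quat bij_is_surj unfolding definite_quaternion_algebra_def by (metis surjD surj_pair)

lemma quat_conj_comb: "quat_conj \<zeta> \<xi> (quat_comb \<zeta> \<xi> (a, b, c, d)) = quat_comb \<zeta> \<xi> (a, - b, - c, - d)"
  by (simp add: quat_conj_def quat_comb_inverse)

lemma quat_comb_mult:
  "quat_comb \<zeta> \<xi> (a, b, c, d) * quat_comb \<zeta> \<xi> (a', b', c', d') = quat_comb \<zeta> \<xi>
     (a * a' + of_int \<alpha> * (b * b') + of_int \<beta> * (c * c') - of_int \<alpha> * of_int \<beta> * (d * d'),
      a * b' + b * a' - of_int \<beta> * (c * d') + of_int \<beta> * (d * c'),
      a * c' + c * a' + of_int \<alpha> * (b * d') - of_int \<alpha> * (d * b'),
      a * d' + d * a' + b * c' - c * b')"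
proof -
  let ?r = "rat_embed :: rat \<Rightarrow> 'b"
  have z: "\<zeta> * \<zeta> = ?r (of_int \<alpha>)" and x: "\<xi> * \<xi> = ?r (of_int \<beta>)" and zx: "\<xi> * \<zeta> = - (\<zeta> * \<xi>)"
    using quat by (simp_all add: definite_quaternion_algebra_def power2_eq_square rat_embed_of_int)
  \<comment> \<open>Rewriting rules that bring every word to the form rational times \<zeta> times
    \<xi>, with each generator at most once. The versions with \<open>w\<close> act inside products
    nested to the right.\<close>
  have za: "\<zeta> * (\<zeta> * w) = ?r (of_int \<alpha>) * w" and xa: "\<xi> * (\<xi> * w) = ?r (of_int \<beta>) * w"
    and zxa: "\<xi> * (\<zeta> * w) = - (\<zeta> * (\<xi> * w))" for w
    using z x zx by (metis mult.assoc, metis mult.assoc, metis mult.assoc mult_minus_left)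
  have c: "\<zeta> * ?r p = ?r p * \<zeta>" "\<xi> * ?r p = ?r p * \<xi>" "\<zeta> * (?r p * w) = ?r p * (\<zeta> * w)"
    "\<xi> * (?r p * w) = ?r p * (\<xi> * w)" for p w
    using rat_embed_commute by (metis, metis, metis mult.assoc, metis mult.assoc)
  have r: "?r p * ?r q = ?r (p * q)" "?r p * (?r q * w) = ?r (p * q) * w" for p q w
    by (simp_all add: rat_embed_mult mult.assoc)
  show ?thesis
    unfolding quat_comb_def prod.case
    by (simp add: distrib_left distrib_right mult.assoc z x zx za xa zxa c r)
      (simp add: diff_conv_add_uminus rat_embed_add rat_embed_minus distrib_left distrib_right
        del: add_uminus_conv_diff, simp add: algebra_simps)
qed

lemma quat_comb_add:
  "quat_comb \<zeta> \<xi> (a, b, c, d) + quat_comb \<zeta> \<xi> (a', b', c', d') = quat_comb \<zeta> \<xi> (a + a', b + b', c + c', d + d')"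
  by (simp add: quat_comb_def rat_embed_add distrib_right add_ac)

sublocale star_division_ring "quat_conj \<zeta> \<xi>"
proof
  fix x y :: 'b
  obtain a b c d where x: "x = quat_comb \<zeta> \<xi> (a, b, c, d)" by (rule quat_comb_cases)
  obtain a' b' c' d' where y: "y = quat_comb \<zeta> \<xi> (a', b', c', d')" by (rule quat_comb_cases)
  show "quat_conj \<zeta> \<xi> (x + y) = quat_conj \<zeta> \<xi> x + quat_conj \<zeta> \<xi> y"
    unfolding x y by (simp add: quat_conj_comb quat_comb_add)
  show "quat_conj \<zeta> \<xi> (x * y) = quat_conj \<zeta> \<xi> y * quat_conj \<zeta> \<xi> x"
    unfolding x y by (simp add: quat_conj_comb quat_comb_mult) (simp add: algebra_simps)
  show "quat_conj \<zeta> \<xi> (quat_conj \<zeta> \<xi> x) = x"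
    unfolding x by (simp add: quat_conj_comb)
qed

lemma zeta_ne_0: "\<zeta> \<noteq> 0"
  using quat by (auto simp: definite_quaternion_algebra_def power2_eq_square)

lemma quat_conj_zeta: "quat_conj \<zeta> \<xi> \<zeta> = - \<zeta>"
proof -
  have "\<zeta> = quat_comb \<zeta> \<xi> (0, 1, 0, 0)" by (simp add: quat_comb_def rat_embed_0 rat_embed_1)
  then have "quat_conj \<zeta> \<xi> \<zeta> = quat_comb \<zeta> \<xi> (0, - 1, 0, 0)" using quat_conj_comb by (metis add.inverse_neutral)
  then show ?thesis by (simp add: quat_comb_def rat_embed_0 rat_embed_minus rat_embed_1)
qed

end

section \<open>The doubled space\<close>

text \<open>Left multiplication by this matrix extracts the lower n rows, the part of g that
  determines its coset modulo the Siegel parabolic.\<close>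

definition lower_half :: "nat \<Rightarrow> 'b::{zero,one} mat" where
  "lower_half n = append_cols (0\<^sub>m n n) (1\<^sub>m n)"

lemma lower_half_carrier: "lower_half n \<in> carrier_mat n (n + n)"
  by (rule carrier_matI) (simp_all add: lower_half_def)

lemma dim_lower_half [simp]: "dim_row (lower_half n) = n" "dim_col (lower_half n) = n + n"
  by (simp_all add: lower_half_def)

lemma dim_J_mat [simp]: "dim_row (J_mat n) = n + n" "dim_col (J_mat n) = n + n"
  by (simp_all add: J_mat_def)

lemma J_mat_carrier: "J_mat n \<in> carrier_mat (n + n) (n + n)"
  by (rule carrier_matI) simp_all

lemma J_mat_square: "J_mat n * J_mat n = - 1\<^sub>m (n + n)"
proof -
  have "J_mat n * J_mat n = four_block_mat (- 1\<^sub>m n) (0\<^sub>m n n) (0\<^sub>m n n) (- 1\<^sub>m n)"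
    unfolding J_mat_def by (subst mult_four_block_mat[of _ n n _ n _ n _ _ n _ n]) (auto simp: mat_dim_simps)
  also have "\<dots> = - 1\<^sub>m (n + n)" by (rule eq_matI) auto
  finally show ?thesis .
qed

context star_division_ring
begin

lemma adj_four_block_mat:
  assumes "A \<in> carrier_mat a c" "B \<in> carrier_mat a d" "C \<in> carrier_mat b c" "D \<in> carrier_mat b d"
  shows "adj (four_block_mat A B C D) = four_block_mat (adj A) (adj C) (adj B) (adj D)"
  using assms by (simp add: four_block_mat_eq_append adj_append_rows adj_append_cols append_cols_append_rows)

end

context skew_hermitian_space
begin

text \<open>Both conditions say that \<open>\<psi> * adj g * \<phi>\<close> is inverse to g, one of
  them from the left and the other from the right.\<close>

lemma isometries_eq: "isometries = {g \<in> carrier_mat n n. adj g * \<phi> * g = \<phi>}"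
proof (intro equalityI subsetI)
  fix g assume g: "g \<in> isometries"
  note [simp] = carrier_matD[OF isometriesD(1)[OF g]]
  have "adj g * \<phi> * g = (\<phi> * \<psi>) * (adj g * \<phi> * g)" by (simp add: phi_psi)
  also have "\<dots> = \<phi> * (\<psi> * adj g * \<phi> * g)" by (simp add: assoc_mult_mat_dim)
  also have "\<dots> = \<phi>" using isometry_inverse(3)[OF g] by simp
  finally show "g \<in> {g \<in> carrier_mat n n. adj g * \<phi> * g = \<phi>}" using isometriesD(1)[OF g] by simp
next
  fix g assume "g \<in> {g \<in> carrier_mat n n. adj g * \<phi> * g = \<phi>}"
  then have g: "g \<in> carrier_mat n n" "adj g * \<phi> * g = \<phi>" by auto
  note [simp] = carrier_matD[OF g(1)]
  define h where "h = \<psi> * adj g * \<phi>"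
  have h: "h \<in> carrier_mat n n" by (rule carrier_matI) (simp_all add: h_def)
  have "h * g = \<psi> * (adj g * \<phi> * g)" by (simp add: h_def assoc_mult_mat_dim)
  then have "h * g = 1\<^sub>m n" using g(2) psi_phi by simp
  then have "g * h = 1\<^sub>m n" using mult_one_mat_commute[OF h g(1)] by simp
  have "g * \<psi> * adj g = g * \<psi> * adj g * (\<phi> * \<psi>)" by (simp add: phi_psi)
  also have "\<dots> = (g * h) * \<psi>" by (simp add: h_def assoc_mult_mat_dim)
  finally show "g \<in> isometries" using g(1) \<open>g * h = 1\<^sub>m n\<close> by (simp add: isometries_def)
qed

lemma isometry_invertible: "g \<in> isometries \<Longrightarrow> invertible_mat g"
  using isometry_inverse[of g] isometriesD(1)[of g] isometriesD(1)[OF isometry_inverse(1), of g]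
  unfolding invertible_mat_def inverts_mat_def by (metis carrier_matD square_mat.simps)

end

text \<open>\<open>R_isometry\<close> is the inverse of the relation
  \<open>adj R * diag[\<phi>, -\<phi>] * R = J\<close>, as befits forms on rows; \<open>Q\<close> is
  the inverse of R.\<close>

locale doubled_space = skew_hermitian_space +
  fixes R Q :: "'a mat"
  assumes R_carrier: "R \<in> carrier_mat (n + n) (n + n)" and Q_carrier: "Q \<in> carrier_mat (n + n) (n + n)"
    and RQ: "R * Q = 1\<^sub>m (n + n)" and QR: "Q * R = 1\<^sub>m (n + n)"
    and R_isometry: "R * - J_mat n * adj R = four_block_mat \<psi> (0\<^sub>m n n) (0\<^sub>m n n) (- \<psi>)"
begin

lemma dim_RQ [simp]: "dim_row R = n + n" "dim_col R = n + n" "dim_row Q = n + n" "dim_col Q = n + n"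
  using R_carrier Q_carrier by auto

sublocale big: skew_hermitian_space star "n + n" "- J_mat n" "J_mat n"
proof
  show "adj (- J_mat n) = - (- J_mat n)"
    unfolding J_mat_def adj_uminus by (subst adj_four_block_mat[of _ n n _ n _ n])
      (auto simp: adj_uminus intro!: eq_matI)
qed (use J_mat_carrier in \<open>auto simp: mat_dim_simps J_mat_square\<close>)

definition pair :: "'a mat \<Rightarrow> 'a mat \<Rightarrow> 'a mat" where
  "pair g h = four_block_mat g (0\<^sub>m n n) (0\<^sub>m n n) h"

definition dbl :: "'a mat \<Rightarrow> 'a mat \<Rightarrow> 'a mat" where
  "dbl g h = Q * pair g h * R"

lemma dim_pair [simp]:
  "dim_row g = n \<Longrightarrow> dim_row h = n \<Longrightarrow> dim_row (pair g h) = n + n"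
  "dim_col g = n \<Longrightarrow> dim_col h = n \<Longrightarrow> dim_col (pair g h) = n + n"
  by (simp_all add: pair_def)

lemma pair_mult:
  assumes "g \<in> carrier_mat n n" "h \<in> carrier_mat n n" "g' \<in> carrier_mat n n" "h' \<in> carrier_mat n n"
  shows "pair g h * pair g' h' = pair (g * g') (h * h')"
  using assms unfolding pair_def
  by (subst mult_four_block_mat[of _ n n _ n _ n _ _ n _ n]) (auto simp: mat_dim_simps)

lemma append_cols_mult_pair:
  assumes "A \<in> carrier_mat k n" "B \<in> carrier_mat k n" "g \<in> carrier_mat n n" "h \<in> carrier_mat n n"
  shows "append_cols A B * pair g h = append_cols (A * g) (B * h)"
  using assms unfolding pair_def
  by (simp add: four_block_mat_eq_append append_cols_mult_append_rows mult_append_cols append_cols_add mat_dim_simps)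

lemma dbl_carrier: "g \<in> carrier_mat n n \<Longrightarrow> h \<in> carrier_mat n n \<Longrightarrow> dbl g h \<in> carrier_mat (n + n) (n + n)"
  by (rule carrier_matI) (simp_all add: dbl_def)

lemma dbl_mult:
  assumes "g \<in> carrier_mat n n" "h \<in> carrier_mat n n" "g' \<in> carrier_mat n n" "h' \<in> carrier_mat n n"
  shows "dbl g h * dbl g' h' = dbl (g * g') (h * h')"
proof -
  have "dbl g h * dbl g' h' = Q * pair g h * (R * Q) * pair g' h' * R"
    using assms by (simp add: dbl_def assoc_mult_mat_dim)
  also have "\<dots> = Q * (pair g h * pair g' h') * R" using assms by (simp add: RQ assoc_mult_mat_dim)
  finally show ?thesis using assms by (simp add: pair_mult dbl_def)
qed

lemma dbl_Q:
  assumes "g \<in> carrier_mat n n" "h \<in> carrier_mat n n"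
  shows "dbl g h * Q = Q * pair g h"
  using assms by (simp add: dbl_def assoc_mult_mat_dim RQ)

lemma dbl_isometry:
  assumes "g \<in> isometries" "h \<in> isometries"
  shows "dbl g h \<in> big.isometries"
proof -
  note c = isometriesD(1)[OF assms(1)] isometriesD(1)[OF assms(2)]
  note [simp] = carrier_matD[OF c(1)] carrier_matD[OF c(2)]
  have QJ: "Q * (R * - J_mat n * adj R) * adj Q = - J_mat n"
  proof -
    have "adj R * adj Q = 1\<^sub>m (n + n)" using adj_mult[of Q R] QR by simp
    moreover have "Q * (R * - J_mat n * adj R) * adj Q = (Q * R) * - J_mat n * (adj R * adj Q)"
      by (simp add: assoc_mult_mat_dim)
    ultimately show ?thesis by (simp add: QR)
  qed
  have "pair g h * four_block_mat \<psi> (0\<^sub>m n n) (0\<^sub>m n n) (- \<psi>) = pair (g * \<psi>) (h * - \<psi>)"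
    using pair_mult[OF c psi_carrier uminus_carrier_mat[OF psi_carrier]] by (simp add: pair_def)
  moreover have "adj (pair g h) = pair (adj g) (adj h)"
    unfolding pair_def using c by (subst adj_four_block_mat[of _ n n _ n _ n]) auto
  moreover have "pair (g * \<psi>) (h * - \<psi>) * pair (adj g) (adj h) = pair (g * \<psi> * adj g) (h * - \<psi> * adj h)"
    by (rule pair_mult) (auto intro!: carrier_matI)
  moreover have "g * \<psi> * adj g = \<psi>" "h * - \<psi> * adj h = - \<psi>"
    using isometriesD(2)[OF assms(1)] isometriesD(2)[OF assms(2)] by (simp_all add: mat_dim_simps)
  ultimately have pair: "pair g h * (R * - J_mat n * adj R) * adj (pair g h) = R * - J_mat n * adj R"
    unfolding R_isometry by (simp add: pair_def)
  have "dbl g h * - J_mat n * adj (dbl g h) = Q * (pair g h * (R * - J_mat n * adj R) * adj (pair g h)) * adj Q"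
    by (simp add: dbl_def adj_mult assoc_mult_mat_dim)
  also have "\<dots> = - J_mat n" unfolding pair QJ ..
  finally show ?thesis using dbl_carrier[OF c] by (simp add: big.isometries_def)
qed

text \<open>The condition c = 0 in the form that suits cosets: p maps the row space of (0 | 1) into
  itself.\<close>

definition parabolic :: "'a mat set" where
  "parabolic = {p \<in> big.isometries. \<exists>d \<in> carrier_mat n n. lower_half n * p = d * lower_half n}"

lemma parabolic_mult:
  assumes "p \<in> parabolic" "q \<in> parabolic"
  shows "p * q \<in> parabolic"
proof -
  obtain d where d: "d \<in> carrier_mat n n" "lower_half n * p = d * lower_half n" and p: "p \<in> big.isometries"
    using assms(1) by (auto simp: parabolic_def)
  obtain e where e: "e \<in> carrier_mat n n" "lower_half n * q = e * lower_half n" and q: "q \<in> big.isometries"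
    using assms(2) by (auto simp: parabolic_def)
  note [simp] = carrier_matD[OF big.isometriesD(1)[OF p]] carrier_matD[OF big.isometriesD(1)[OF q]]
    carrier_matD[OF d(1)] carrier_matD[OF e(1)]
  have "lower_half n * (p * q) = (lower_half n * p) * q" by (simp add: assoc_mult_mat_dim)
  also have "\<dots> = d * (lower_half n * q)" unfolding d(2) by (simp add: assoc_mult_mat_dim)
  also have "\<dots> = (d * e) * lower_half n" unfolding e(2) by (simp add: assoc_mult_mat_dim)
  finally show ?thesis using big.isometries_mult[OF p q] mult_carrier_mat[OF d(1) e(1)]
    by (auto simp: parabolic_def)
qed

lemma parabolic_one: "1\<^sub>m (n + n) \<in> parabolic"
  unfolding parabolic_def using big.isometries_one one_carrier_mat[of n]
  by (auto intro!: bexI[of _ "1\<^sub>m n"] simp: lower_half_carrier)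

text \<open>The Lagrangian subspace of the doubled space that corresponds to the coset \<open>P g\<close>, as the row
  space of \<open>(A | B)\<close>.\<close>

definition lagr :: "'a mat \<Rightarrow> 'a mat \<Rightarrow> 'a mat \<Rightarrow> bool" where
  "lagr g A B \<longleftrightarrow> A \<in> carrier_mat n n \<and> B \<in> carrier_mat n n \<and> lower_half n * g * Q = append_cols A B"

lemma lagr_exists:
  assumes "g \<in> carrier_mat (n + n) (n + n)"
  obtains A B where "lagr g A B"
proof -
  have "dim_col (lower_half n * g * Q) = n + n" "dim_row (lower_half n * g * Q) = n" by simp_all
  then show thesis using append_cols_split[of "lower_half n * g * Q" n n] that unfolding lagr_def by metis
qed

lemma lagr_full_row_rank:
  assumes "g \<in> big.isometries" "lagr g A B"
  shows "full_row_rank (append_cols A B)"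
proof -
  have "full_row_rank (lower_half n)"
    by (rule full_row_rankI[of _ "0\<^sub>m n n @\<^sub>r 1\<^sub>m n" n])
      (simp_all add: lower_half_def append_cols_mult_append_rows mat_dim_simps)
  then have "full_row_rank (lower_half n * g)" using assms(1) by (intro big.full_row_rank_isometry) auto
  then have "full_row_rank (lower_half n * g * Q)"
    by (rule full_row_rank_mult_right_factor[OF _ _ Q_carrier R_carrier QR])
      (use big.isometriesD(1)[OF assms(1)] lower_half_carrier in \<open>auto intro: mult_carrier_mat\<close>)
  then show ?thesis using assms(2) by (simp add: lagr_def)
qed

text \<open>The rows of (0 | 1) are isotropic for -J, and g preserves this form. In the coordinates
  given by R the form is diag[\<psi>, -\<psi>], so isotropy reads
  \<open>gram A A - gram B B = 0\<close>.\<close>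

lemma lagr_gram:
  assumes g: "g \<in> big.isometries" and L: "lagr g A B"
  shows "gram A A = gram B B"
proof -
  note c [simp] = carrier_matD[OF big.isometriesD(1)[OF g]]
  have A: "A \<in> carrier_mat n n" and B: "B \<in> carrier_mat n n" and AB: "append_cols A B = lower_half n * g * Q"
    using L by (auto simp: lagr_def)
  note [simp] = carrier_matD[OF A] carrier_matD[OF B]
  let ?Z = "lower_half n :: 'a mat"
  have "adj R * adj Q = 1\<^sub>m (n + n)" using adj_mult[of Q R] QR by simp
  have "append_cols A B * (R * - J_mat n * adj R) * adj (append_cols A B) =
      ?Z * (g * ((Q * R) * - J_mat n * (adj R * adj Q)) * adj g) * adj ?Z"
    unfolding AB by (simp add: adj_mult assoc_mult_mat_dim)
  also have "\<dots> = ?Z * (g * (- J_mat n * adj g)) * adj ?Z"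
    unfolding QR \<open>adj R * adj Q = 1\<^sub>m (n + n)\<close> by (simp add: assoc_mult_mat_dim)
  also have "g * (- J_mat n * adj g) = - J_mat n" by (rule big.isometriesD(2)[OF g])
  also have "?Z * - J_mat n * adj ?Z = 0\<^sub>m n n"
  proof -
    have "?Z * J_mat n = append_cols (1\<^sub>m n) (0\<^sub>m n n)"
      unfolding lower_half_def J_mat_def
      by (simp add: four_block_mat_eq_append append_cols_mult_append_rows mat_dim_simps)
    then have "?Z * J_mat n * adj ?Z = 0\<^sub>m n n"
      by (simp add: lower_half_def adj_append_cols append_cols_mult_append_rows mat_dim_simps)
    then show ?thesis by (simp add: mat_dim_simps(1-6)) (simp add: mat_dim_simps)
  qed
  finally have 0: "append_cols A B * pair \<psi> (- \<psi>) * adj (append_cols A B) = 0\<^sub>m n n"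
    unfolding R_isometry pair_def .
  have "append_cols A B * pair \<psi> (- \<psi>) = append_cols (A * \<psi>) (B * - \<psi>)"
    using A B psi_carrier by (intro append_cols_mult_pair) auto
  then have "gram A A - gram B B = 0\<^sub>m n n"
    using 0 by (simp add: adj_append_cols append_cols_mult_append_rows gram_def mat_dim_simps(1-6))
      (simp add: mat_eq_iff)
  then show ?thesis
    by (subst (asm) minus_mat_eq_0_iff) (auto intro!: carrier_matI)
qed

text \<open>The hypotheses say that the lower half of \<open>g'\<close> is W times the lower half of
  \<open>g * dbl h k\<close>. The quotient of these two isometries therefore stabilises the row
  space of (0 | 1).\<close>

lemma lagr_coset:
  assumes L: "lagr g A B" "lagr g' A' B'" and g: "g \<in> big.isometries" "g' \<in> big.isometries"
    and W: "W \<in> carrier_mat n n" and hk: "h \<in> isometries" "k \<in> isometries"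
    and eq: "A' = W * A * h" "B' = W * B * k"
  obtains p where "p \<in> parabolic" "g' = p * g * dbl h k"
proof -
  note c [simp] = carrier_matD[OF big.isometriesD(1)[OF g(1)]] carrier_matD[OF big.isometriesD(1)[OF g(2)]]
    carrier_matD[OF isometriesD(1)[OF hk(1)]] carrier_matD[OF isometriesD(1)[OF hk(2)]] carrier_matD[OF W]
  let ?Z = "lower_half n :: 'a mat"
  have A: "A \<in> carrier_mat n n" "B \<in> carrier_mat n n" using L by (auto simp: lagr_def)
  have "?Z * g' * Q = append_cols (W * A * h) (W * B * k)" using L(2) eq by (simp add: lagr_def)
  also have "\<dots> = W * append_cols A B * pair h k"
    using append_cols_mult_pair[OF mult_carrier_mat[OF W A(1)] mult_carrier_mat[OF W A(2)]] A
      isometriesD(1)[OF hk(1)] isometriesD(1)[OF hk(2)] by (simp add: mult_append_cols)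
  also have "append_cols A B = ?Z * g * Q" using L(1) by (simp add: lagr_def)
  also have "W * (?Z * g * Q) * pair h k = W * (?Z * g * (Q * pair h k))" by (simp add: assoc_mult_mat_dim)
  finally have "?Z * g' * Q * R = W * (?Z * g * (Q * pair h k)) * R" by simp
  then have "?Z * g' * (Q * R) = W * (?Z * (g * dbl h k))"
    by (simp add: dbl_def assoc_mult_mat_dim)
  then have Zg': "?Z * g' = W * (?Z * (g * dbl h k))" by (simp add: QR)
  define d where "d = g * dbl h k"
  have d: "d \<in> big.isometries" unfolding d_def by (rule big.isometries_mult[OF g(1) dbl_isometry[OF hk]])
  obtain e where e: "e \<in> big.isometries" "d * e = 1\<^sub>m (n + n)" "e * d = 1\<^sub>m (n + n)"
    using big.isometry_inverse[OF d] by blast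
  note [simp] = carrier_matD[OF big.isometriesD(1)[OF d]] carrier_matD[OF big.isometriesD(1)[OF e(1)]]
  have "?Z * (g' * e) = ?Z * g' * e" by (simp add: assoc_mult_mat_dim)
  also have "\<dots> = W * (?Z * (d * e))" unfolding Zg' d_def[symmetric] by (simp add: assoc_mult_mat_dim)
  also have "\<dots> = W * ?Z" unfolding e(2) by simp
  finally have p: "g' * e \<in> parabolic"
    using big.isometries_mult[OF g(2) e(1)] W by (auto simp: parabolic_def)
  have "g' * e * d = g'" using e(3) by (simp add: assoc_mult_mat_dim)
  then have "g' = g' * e * g * dbl h k"
    using dbl_carrier[OF isometriesD(1)[OF hk(1)] isometriesD(1)[OF hk(2)]]
    by (simp add: d_def assoc_mult_mat_dim)
  then show thesis using that[OF p] by blast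
qed

text \<open>A converse to \<open>lagr_coset\<close> for the left half, through which the rank of A
  becomes an invariant of the double coset. Here \<open>W\<close> is the lower right block of
  p.\<close>

lemma lagr_parabolic:
  assumes L: "lagr g A B" "lagr g' A' B'" and g: "g \<in> big.isometries"
    and p: "p \<in> parabolic" and hk: "h \<in> isometries" "k \<in> isometries" and eq: "g' = p * g * dbl h k"
  obtains W where "W \<in> carrier_mat n n" "A' = W * A * h"
proof -
  obtain W where W: "W \<in> carrier_mat n n" "lower_half n * p = W * lower_half n" and p': "p \<in> big.isometries"
    using p by (auto simp: parabolic_def)
  note c = isometriesD(1)[OF hk(1)] isometriesD(1)[OF hk(2)]
  note [simp] = carrier_matD[OF big.isometriesD(1)[OF g]] carrier_matD[OF big.isometriesD(1)[OF p']]
    carrier_matD[OF c(1)] carrier_matD[OF c(2)] carrier_matD[OF W(1)] carrier_matD[OF dbl_carrier[OF c]]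
  have A: "A \<in> carrier_mat n n" "B \<in> carrier_mat n n" "A' \<in> carrier_mat n n" "B' \<in> carrier_mat n n"
    using L by (auto simp: lagr_def)
  have "append_cols A' B' = lower_half n * (p * g * dbl h k) * Q" using L(2) eq by (simp add: lagr_def)
  also have "\<dots> = (lower_half n * p) * g * (dbl h k * Q)" by (simp add: assoc_mult_mat_dim)
  also have "\<dots> = W * (lower_half n * g * Q) * pair h k"
    unfolding W(2) dbl_Q[OF c] by (simp add: assoc_mult_mat_dim)
  also have "\<dots> = append_cols (W * A * h) (W * B * k)"
    using append_cols_mult_pair[OF mult_carrier_mat[OF W(1) A(1)] mult_carrier_mat[OF W(1) A(2)] c] A L(1)
    by (simp add: mult_append_cols lagr_def)
  finally have "A' = W * A * h" by (rule append_cols_inject(1)) (use A in auto)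
  then show thesis using that W(1) by blast
qed

definition doubled_group :: "'a mat set" where
  "doubled_group = {dbl g h | g h. g \<in> isometries \<and> h \<in> isometries}"

lemma double_coset_subset:
  assumes g: "g \<in> big.isometries" and p: "p \<in> parabolic" and hk: "h \<in> isometries" "k \<in> isometries"
  shows "double_coset parabolic (p * g * dbl h k) doubled_group \<subseteq> double_coset parabolic g doubled_group"
proof
  fix x assume "x \<in> double_coset parabolic (p * g * dbl h k) doubled_group"
  then obtain q h' k' where q: "q \<in> parabolic" and hk': "h' \<in> isometries" "k' \<in> isometries"
    and x: "x = q * (p * g * dbl h k) * dbl h' k'"
    unfolding double_coset_def doubled_group_def by blast
  note c = isometriesD(1)[OF hk(1)] isometriesD(1)[OF hk(2)] isometriesD(1)[OF hk'(1)] isometriesD(1)[OF hk'(2)]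
  have pq: "p \<in> big.isometries" "q \<in> big.isometries" using p q by (auto simp: parabolic_def)
  note [simp] = carrier_matD[OF big.isometriesD(1)[OF g]] carrier_matD[OF big.isometriesD(1)[OF pq(1)]]
    carrier_matD[OF big.isometriesD(1)[OF pq(2)]]
    carrier_matD[OF dbl_carrier[OF c(1,2)]] carrier_matD[OF dbl_carrier[OF c(3,4)]]
  have "x = (q * p) * g * (dbl h k * dbl h' k')" unfolding x by (simp add: assoc_mult_mat_dim)
  also have "dbl h k * dbl h' k' = dbl (h * h') (k * k')" by (rule dbl_mult[OF c])
  finally show "x \<in> double_coset parabolic g doubled_group"
    unfolding double_coset_def doubled_group_def
    using parabolic_mult[OF q p] isometries_mult[OF hk(1) hk'(1)] isometries_mult[OF hk(2) hk'(2)] by blast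
qed

lemma same_rank_double_coset_subset:
  assumes g: "g \<in> big.isometries" "lagr g A B" "has_rank A k"
    and g': "g' \<in> big.isometries" "lagr g' A' B'" "has_rank A' k"
  shows "double_coset parabolic g' doubled_group \<subseteq> double_coset parabolic g doubled_group"
proof -
  have c: "A \<in> carrier_mat n n" "B \<in> carrier_mat n n" "A' \<in> carrier_mat n n" "B' \<in> carrier_mat n n"
    using g(2) g'(2) by (auto simp: lagr_def)
  obtain W h k where W: "W \<in> carrier_mat n n" "h \<in> isometries" "k \<in> isometries" "A' = W * A * h" "B' = W * B * k"
    by (rule lagrangian_equivalence[OF c(3,4) lagr_full_row_rank[OF g'(1,2)] lagr_gram[OF g'(1,2)]
        c(1,2) lagr_full_row_rank[OF g(1,2)] lagr_gram[OF g(1,2)] g'(3) g(3)])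
  obtain p where "p \<in> parabolic" "g' = p * g * dbl h k"
    by (rule lagr_coset[OF g(2) g'(2) g(1) g'(1) W])
  then show ?thesis using double_coset_subset[OF g(1) _ W(2,3)] by blast
qed

text \<open>\<open>g'\<close> lies in its own double coset and so in that of g. This makes its left
  half a product \<open>W * A * h\<close>, whose rank cannot exceed that of A.\<close>

lemma double_coset_rank_le:
  assumes g: "g \<in> big.isometries" "lagr g A B" "has_rank A k"
    and g': "g' \<in> big.isometries" "lagr g' A' B'" "has_rank A' k'"
    and eq: "double_coset parabolic g' doubled_group \<subseteq> double_coset parabolic g doubled_group"
  shows "k' \<le> k"
proof -
  have c [simp]: "dim_row A = n" "dim_col A = n" using g(2) by (auto simp: lagr_def)
  have one: "dbl (1\<^sub>m n) (1\<^sub>m n) = 1\<^sub>m (n + n)" by (simp add: dbl_def pair_def QR)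
  have "g' = 1\<^sub>m (n + n) * g' * dbl (1\<^sub>m n) (1\<^sub>m n)"
    unfolding one using carrier_matD[OF big.isometriesD(1)[OF g'(1)]] by simp
  then have "g' \<in> double_coset parabolic g' doubled_group"
    unfolding double_coset_def doubled_group_def using parabolic_one isometries_one by blast
  then obtain p h l where p: "p \<in> parabolic" "h \<in> isometries" "l \<in> isometries" "g' = p * g * dbl h l"
    using eq unfolding double_coset_def doubled_group_def by blast
  obtain W where "W \<in> carrier_mat n n" "A' = W * A * h"
    by (rule lagr_parabolic[OF g(2) g'(2) g(1) p])
  then show ?thesis using has_rank_le[OF g'(3) g(3)] isometriesD(1)[OF p(2)] by auto
qed

end

section \<open>Block computations\<close>

lemma block3_mult:
  fixes a b c d e f g h i a' b' c' d' e' f' g' h' i' :: "'a::semiring_0 mat"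
  assumes "dim_row b = dim_row a" "dim_row c = dim_row a" "dim_row e = dim_row d" "dim_row f = dim_row d"
    "dim_row h = dim_row g" "dim_row i = dim_row g" "dim_col d = dim_col a" "dim_col g = dim_col a"
    "dim_col e = dim_col b" "dim_col h = dim_col b" "dim_col f = dim_col c" "dim_col i = dim_col c"
    "dim_row b' = dim_row a'" "dim_row c' = dim_row a'" "dim_row e' = dim_row d'" "dim_row f' = dim_row d'"
    "dim_row h' = dim_row g'" "dim_row i' = dim_row g'" "dim_col d' = dim_col a'" "dim_col g' = dim_col a'"
    "dim_col e' = dim_col b'" "dim_col h' = dim_col b'" "dim_col f' = dim_col c'" "dim_col i' = dim_col c'"
    "dim_row a' = dim_col a" "dim_row d' = dim_col b" "dim_row g' = dim_col c"
  shows "block_mat [[a, b, c], [d, e, f], [g, h, i]] * block_mat [[a', b', c'], [d', e', f'], [g', h', i']] =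
    block_mat [[a * a' + (b * d' + c * g'), a * b' + (b * e' + c * h'), a * c' + (b * f' + c * i')],
      [d * a' + (e * d' + f * g'), d * b' + (e * e' + f * h'), d * c' + (e * f' + f * i')],
      [g * a' + (h * d' + i * g'), g * b' + (h * e' + i * h'), g * c' + (h * f' + i * i')]]"
  using assms by (simp add: append_rows_mult append_cols_mult_append_rows mult_append_cols append_cols_add)

lemma block3_add:
  fixes a b c d e f g h i a' b' c' d' e' f' g' h' i' :: "'a::semiring_0 mat"
  assumes "dim_row b = dim_row a" "dim_row c = dim_row a" "dim_row e = dim_row d" "dim_row f = dim_row d"
    "dim_row h = dim_row g" "dim_row i = dim_row g" "dim_col d = dim_col a" "dim_col g = dim_col a"
    "dim_col e = dim_col b" "dim_col h = dim_col b" "dim_col f = dim_col c" "dim_col i = dim_col c"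
    "dim_row b' = dim_row a'" "dim_row c' = dim_row a'" "dim_row e' = dim_row d'" "dim_row f' = dim_row d'"
    "dim_row h' = dim_row g'" "dim_row i' = dim_row g'" "dim_col d' = dim_col a'" "dim_col g' = dim_col a'"
    "dim_col e' = dim_col b'" "dim_col h' = dim_col b'" "dim_col f' = dim_col c'" "dim_col i' = dim_col c'"
    "dim_row a' = dim_row a" "dim_row d' = dim_row d" "dim_row g' = dim_row g"
    "dim_col a' = dim_col a" "dim_col b' = dim_col b" "dim_col c' = dim_col c"
  shows "block_mat [[a, b, c], [d, e, f], [g, h, i]] + block_mat [[a', b', c'], [d', e', f'], [g', h', i']] =
    block_mat [[a + a', b + b', c + c'], [d + d', e + e', f + f'], [g + g', h + h', i + i']]"
  using assms by (simp add: append_cols_add append_rows_add)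

lemma block3_uminus:
  assumes "dim_row b = dim_row a" "dim_row c = dim_row a" "dim_row e = dim_row d" "dim_row f = dim_row d"
    "dim_row h = dim_row g" "dim_row i = dim_row g" "dim_col d = dim_col a" "dim_col g = dim_col a"
    "dim_col e = dim_col b" "dim_col h = dim_col b" "dim_col f = dim_col c" "dim_col i = dim_col c"
  shows "- block_mat [[a, b, c], [d, e, f], [g, h, i]] =
    block_mat [[- a, - b, - c], [- d, - e, - f], [- g, - h, - i]]"
  using assms by (simp add: uminus_append_cols uminus_append_rows)

lemma block3_zero:
  "block_mat [[0\<^sub>m a d, 0\<^sub>m a e, 0\<^sub>m a f], [0\<^sub>m b d, 0\<^sub>m b e, 0\<^sub>m b f], [0\<^sub>m c d, 0\<^sub>m c e, 0\<^sub>m c f]] =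
    0\<^sub>m (a + (b + c)) (d + (e + f))"
  by (simp add: zero_append)

lemma block3_one:
  "block_mat [[1\<^sub>m a, 0\<^sub>m a b, 0\<^sub>m a c], [0\<^sub>m b a, 1\<^sub>m b, 0\<^sub>m b c], [0\<^sub>m c a, 0\<^sub>m c b, 1\<^sub>m c]] = 1\<^sub>m (a + (b + c))"
  by (rule eq_matI) (auto simp: index_append_rows index_append_cols)

lemma dim_block3 [simp]:
  "dim_row (block_mat [[a, b, c], [d, e, f], [g, h, i]]) = dim_row a + (dim_row d + dim_row g)"
  "dim_col (block_mat [[a, b, c], [d, e, f], [g, h, i]]) = dim_col a + (dim_col b + dim_col c)"
  by simp_all

text \<open>The matrices R and \<tau>_t are read as 2 by 2 arrays of 3 by 3 block matrices, whose
  products \<open>block3_mult\<close> computes.\<close>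

lemma block6_eq_four_block:
  assumes "dim_row b = dim_row a" "dim_row c = dim_row a" "dim_row e = dim_row d" "dim_row f = dim_row d"
    "dim_row h = dim_row g" "dim_row i = dim_row g" "dim_col d = dim_col a" "dim_col g = dim_col a"
    "dim_col e = dim_col b" "dim_col h = dim_col b" "dim_col f = dim_col c" "dim_col i = dim_col c"
    "dim_row a' = dim_row a" "dim_row d' = dim_row d" "dim_row g' = dim_row g"
    "dim_row b' = dim_row a" "dim_row c' = dim_row a" "dim_row e' = dim_row d" "dim_row f' = dim_row d"
    "dim_row h' = dim_row g" "dim_row i' = dim_row g" "dim_col d' = dim_col a'" "dim_col g' = dim_col a'"
    "dim_col e' = dim_col b'" "dim_col h' = dim_col b'" "dim_col f' = dim_col c'" "dim_col i' = dim_col c'"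
    "dim_row jb = dim_row ja" "dim_row jc = dim_row ja" "dim_row je = dim_row jd" "dim_row jf = dim_row jd"
    "dim_row jh = dim_row jg" "dim_row ji = dim_row jg" "dim_col jd = dim_col a" "dim_col jg = dim_col a"
    "dim_col ja = dim_col a" "dim_col jb = dim_col b" "dim_col jc = dim_col c"
    "dim_col je = dim_col b" "dim_col jh = dim_col b" "dim_col jf = dim_col c" "dim_col ji = dim_col c"
    "dim_row ka = dim_row ja" "dim_row kd = dim_row jd" "dim_row kg = dim_row jg"
    "dim_row kb = dim_row ja" "dim_row kc = dim_row ja" "dim_row ke = dim_row jd" "dim_row kf = dim_row jd"
    "dim_row kh = dim_row jg" "dim_row ki = dim_row jg" "dim_col kd = dim_col a'" "dim_col kg = dim_col a'"
    "dim_col ka = dim_col a'" "dim_col kb = dim_col b'" "dim_col kc = dim_col c'"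
    "dim_col ke = dim_col b'" "dim_col kh = dim_col b'" "dim_col kf = dim_col c'" "dim_col ki = dim_col c'"
  shows "block_mat [[a, b, c, a', b', c'], [d, e, f, d', e', f'], [g, h, i, g', h', i'],
      [ja, jb, jc, ka, kb, kc], [jd, je, jf, kd, ke, kf], [jg, jh, ji, kg, kh, ki]] =
    four_block_mat (block_mat [[a, b, c], [d, e, f], [g, h, i]]) (block_mat [[a', b', c'], [d', e', f'], [g', h', i']])
      (block_mat [[ja, jb, jc], [jd, je, jf], [jg, jh, ji]]) (block_mat [[ka, kb, kc], [kd, ke, kf], [kg, kh, ki]])"
  using assms
  by (simp add: four_block_mat_eq_append append_cols_append_rows append_cols_assoc append_rows_assoc)

lemma smult_one_mult_mat:
  fixes A :: "'a::semiring_1 mat"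
  assumes "dim_row A = k"
  shows "(x \<cdot>\<^sub>m 1\<^sub>m k) * A = x \<cdot>\<^sub>m A"
proof (rule eq_matI)
  fix i j assume "i < dim_row (x \<cdot>\<^sub>m A)" "j < dim_col (x \<cdot>\<^sub>m A)"
  then have ij: "i < k" "j < dim_col A" using assms by auto
  have "((x \<cdot>\<^sub>m 1\<^sub>m k) * A) $$ (i, j) = row (x \<cdot>\<^sub>m 1\<^sub>m k) i \<bullet> col A j"
    by (rule index_mult_mat) (use ij assms in auto)
  also have "\<dots> = (\<Sum>l = 0..<k. if l = i then x * A $$ (l, j) else 0)"
    unfolding scalar_prod_def by (rule sum.cong) (use ij assms in auto)
  finally show "((x \<cdot>\<^sub>m 1\<^sub>m k) * A) $$ (i, j) = (x \<cdot>\<^sub>m A) $$ (i, j)" using ij assms by simp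
qed (use assms in auto)

lemma smult_one_mat_simps:
  fixes x y :: "'a::ring_1"
  shows "(x \<cdot>\<^sub>m 1\<^sub>m k) * (y \<cdot>\<^sub>m 1\<^sub>m k) = (x * y) \<cdot>\<^sub>m 1\<^sub>m k"
    and "x \<cdot>\<^sub>m 1\<^sub>m k + y \<cdot>\<^sub>m 1\<^sub>m k = (x + y) \<cdot>\<^sub>m 1\<^sub>m k"
    and "- (x \<cdot>\<^sub>m 1\<^sub>m k) = (- x) \<cdot>\<^sub>m 1\<^sub>m k"
    and "0 \<cdot>\<^sub>m 1\<^sub>m k = (0\<^sub>m k k :: 'a mat)" and "1 \<cdot>\<^sub>m 1\<^sub>m k = (1\<^sub>m k :: 'a mat)"
    and "(- 1) \<cdot>\<^sub>m 1\<^sub>m k = (- 1\<^sub>m k :: 'a mat)"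
  by (auto simp: smult_one_mult_mat intro!: eq_matI)

lemmas block3_simps = block3_mult block3_add block3_uminus smult_one_mat_simps mat_dim_simps

context star_division_ring
begin

lemma adj_block3:
  assumes "dim_row b = dim_row a" "dim_row c = dim_row a" "dim_row e = dim_row d" "dim_row f = dim_row d"
    "dim_row h = dim_row g" "dim_row i = dim_row g" "dim_col d = dim_col a" "dim_col g = dim_col a"
    "dim_col e = dim_col b" "dim_col h = dim_col b" "dim_col f = dim_col c" "dim_col i = dim_col c"
  shows "adj (block_mat [[a, b, c], [d, e, f], [g, h, i]]) =
    block_mat [[adj a, adj d, adj g], [adj b, adj e, adj h], [adj c, adj f, adj i]]"
  using assms by (simp add: adj_append_rows adj_append_cols append_cols_append_rows append_cols_assoc)

lemma adj_smult_one: "adj (x \<cdot>\<^sub>m 1\<^sub>m k) = star x \<cdot>\<^sub>m 1\<^sub>m k"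
  by (rule eq_matI) auto

lemma star_inverse: "star (inverse x) = inverse (star x)"
proof (cases "x = 0")
  case False
  then have "star x * star (inverse x) = 1" by (simp add: star_mult[symmetric])
  then show ?thesis by (rule inverse_unique[symmetric])
qed simp

end

lemma half_add_half: "1 / 2 + 1 / 2 = (1 :: 'a::{division_ring,ring_char_0})"
  by (simp add: add_divide_distrib[symmetric])

lemma minus_half_minus_half: "- (1 / 2) - 1 / 2 = (- 1 :: 'a::{division_ring,ring_char_0})"
  using half_add_half by (metis minus_add_distrib diff_conv_add_uminus)

section \<open>The forms and the doubling matrix in coordinates\<close>

definition psi_mat :: "'b::{division_ring,ring_char_0} \<Rightarrow> nat \<Rightarrow> nat \<Rightarrow> 'b mat" where
  "psi_mat \<zeta> m r = block_mat
    [[0\<^sub>m m m, 0\<^sub>m m r, 1\<^sub>m m],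
     [0\<^sub>m r m, inverse \<zeta> \<cdot>\<^sub>m 1\<^sub>m r, 0\<^sub>m r m],
     [- 1\<^sub>m m, 0\<^sub>m m r, 0\<^sub>m m m]]"

locale doubling_setup = definite_quaternion +
  fixes m r :: nat
  assumes aniso: "anisotropic_block \<zeta> \<xi> r"
begin

text \<open>The bracketing is the one in which nested block matrices report their
  dimensions.\<close>

abbreviation n where "n \<equiv> m + (r + m)"

lemma star_half: "quat_conj \<zeta> \<xi> (1 / 2) = 1 / 2"
proof -
  have "quat_conj \<zeta> \<xi> 2 = 2" using star_add[of 1 1] by simp
  then show ?thesis using star_inverse[of 2] by (simp add: inverse_eq_divide)
qed

lemma dim_phi_psi [simp]:
  "dim_row (phi_mat \<zeta> m r) = n" "dim_col (phi_mat \<zeta> m r) = n"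
  "dim_row (psi_mat \<zeta> m r) = n" "dim_col (psi_mat \<zeta> m r) = n"
  unfolding phi_mat_def psi_mat_def by (simp_all del: block_mat.simps)

sublocale skew_hermitian_space "quat_conj \<zeta> \<xi>" n "psi_mat \<zeta> m r" "phi_mat \<zeta> m r"
proof
  show "psi_mat \<zeta> m r \<in> carrier_mat n n" "phi_mat \<zeta> m r \<in> carrier_mat n n"
    by (rule carrier_matI; simp)+
  show "adj (psi_mat \<zeta> m r) = - psi_mat \<zeta> m r"
    unfolding psi_mat_def
    by (simp add: adj_block3 block3_simps adj_smult_one adj_uminus star_inverse quat_conj_zeta
        del: block_mat.simps)
  show "psi_mat \<zeta> m r * phi_mat \<zeta> m r = 1\<^sub>m n"
    unfolding psi_mat_def phi_mat_def
    by (simp add: block3_simps zeta_ne_0 block3_one del: block_mat.simps)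
  show "phi_mat \<zeta> m r * psi_mat \<zeta> m r = 1\<^sub>m n"
    unfolding psi_mat_def phi_mat_def
    by (simp add: block3_simps zeta_ne_0 block3_one del: block_mat.simps)
qed

definition "R11 = block_mat [[1\<^sub>m m, 0\<^sub>m m r, 0\<^sub>m m m], [0\<^sub>m r m, (1 / 2) \<cdot>\<^sub>m 1\<^sub>m r, 0\<^sub>m r m],
  [0\<^sub>m m m, 0\<^sub>m m r, 0\<^sub>m m m :: 'a mat]]"
definition "R12 = block_mat [[0\<^sub>m m m, 0\<^sub>m m r, 0\<^sub>m m m], [0\<^sub>m r m, (- inverse \<zeta>) \<cdot>\<^sub>m 1\<^sub>m r, 0\<^sub>m r m],
  [1\<^sub>m m, 0\<^sub>m m r, 0\<^sub>m m m]]"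
definition "R21 = block_mat [[0\<^sub>m m m, 0\<^sub>m m r, - 1\<^sub>m m], [0\<^sub>m r m, (- (1 / 2)) \<cdot>\<^sub>m 1\<^sub>m r, 0\<^sub>m r m],
  [0\<^sub>m m m, 0\<^sub>m m r, 0\<^sub>m m m :: 'a mat]]"
definition "R22 = block_mat [[0\<^sub>m m m, 0\<^sub>m m r, 0\<^sub>m m m], [0\<^sub>m r m, (- inverse \<zeta>) \<cdot>\<^sub>m 1\<^sub>m r, 0\<^sub>m r m],
  [0\<^sub>m m m, 0\<^sub>m m r, 1\<^sub>m m]]"

lemma R_mat_eq: "R_mat \<zeta> m r = four_block_mat R11 R12 R21 R22"
  unfolding R_mat_def R11_def R12_def R21_def R22_def
  by (rule block6_eq_four_block) simp_all

lemma dim_R_blocks [simp]: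
  "dim_row R11 = n" "dim_col R11 = n" "dim_row R12 = n" "dim_col R12 = n"
  "dim_row R21 = n" "dim_col R21 = n" "dim_row R22 = n" "dim_col R22 = n"
  unfolding R11_def R12_def R21_def R22_def by (simp_all del: block_mat.simps)

lemma R_blocks_carrier:
  "R11 \<in> carrier_mat n n" "R12 \<in> carrier_mat n n" "R21 \<in> carrier_mat n n" "R22 \<in> carrier_mat n n"
  by (rule carrier_matI; simp)+

text \<open>The four blocks of \<open>adj R * diag[\<phi>, -\<phi>] * R\<close>, to be compared with
  those of J.\<close>

lemma R_block_forms:
  "adj R11 * phi_mat \<zeta> m r * R11 + adj R21 * - phi_mat \<zeta> m r * R21 = 0\<^sub>m n n"
  "adj R11 * phi_mat \<zeta> m r * R12 + adj R21 * - phi_mat \<zeta> m r * R22 = - 1\<^sub>m n"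
  "adj R12 * phi_mat \<zeta> m r * R11 + adj R22 * - phi_mat \<zeta> m r * R21 = 1\<^sub>m n"
  "adj R12 * phi_mat \<zeta> m r * R12 + adj R22 * - phi_mat \<zeta> m r * R22 = 0\<^sub>m n n"
proof -
  note defs = R11_def R12_def R21_def R22_def phi_mat_def
  note simps = adj_block3 block3_simps adj_smult_one adj_uminus star_inverse star_minus quat_conj_zeta star_half
    zeta_ne_0 mult.assoc half_add_half minus_half_minus_half
  show "adj R11 * phi_mat \<zeta> m r * R11 + adj R21 * - phi_mat \<zeta> m r * R21 = 0\<^sub>m n n"
    unfolding defs by (simp add: simps block3_zero del: block_mat.simps)
  show "adj R12 * phi_mat \<zeta> m r * R12 + adj R22 * - phi_mat \<zeta> m r * R22 = 0\<^sub>m n n"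
    unfolding defs by (simp add: simps block3_zero del: block_mat.simps)
  show "adj R12 * phi_mat \<zeta> m r * R11 + adj R22 * - phi_mat \<zeta> m r * R21 = 1\<^sub>m n"
    unfolding defs by (simp add: simps block3_one del: block_mat.simps)
  show "adj R11 * phi_mat \<zeta> m r * R12 + adj R21 * - phi_mat \<zeta> m r * R22 = - 1\<^sub>m n"
    unfolding defs block3_one[symmetric] by (simp add: simps del: block_mat.simps)
qed

text \<open>Read off from \<open>adj R * diag[\<phi>, -\<phi>] * R = J\<close>: multiplying by J^-1
  = -J on the left exhibits a left inverse of R.\<close>

definition R_inv :: "'a mat" where
  "R_inv = - J_mat n * adj (R_mat \<zeta> m r) * four_block_mat (phi_mat \<zeta> m r) (0\<^sub>m n n) (0\<^sub>m n n) (- phi_mat \<zeta> m r)"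

lemma R_mat_carrier: "R_mat \<zeta> m r \<in> carrier_mat (n + n) (n + n)"
  unfolding R_mat_eq using R_blocks_carrier by simp

lemma R_inv_carrier: "R_inv \<in> carrier_mat (n + n) (n + n)"
  by (rule carrier_matI) (simp_all add: R_inv_def)

lemma R_form:
  "adj (R_mat \<zeta> m r) * four_block_mat (phi_mat \<zeta> m r) (0\<^sub>m n n) (0\<^sub>m n n) (- phi_mat \<zeta> m r) * R_mat \<zeta> m r = J_mat n"
proof -
  note c = R_blocks_carrier phi_carrier
  have ac: "adj R11 \<in> carrier_mat n n" "adj R12 \<in> carrier_mat n n" "adj R21 \<in> carrier_mat n n" "adj R22 \<in> carrier_mat n n"
    by (rule carrier_matI; simp)+
  have "adj (R_mat \<zeta> m r) = four_block_mat (adj R11) (adj R21) (adj R12) (adj R22)"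
    unfolding R_mat_eq by (rule adj_four_block_mat[OF c(1-4)])
  then have 1: "adj (R_mat \<zeta> m r) * four_block_mat (phi_mat \<zeta> m r) (0\<^sub>m n n) (0\<^sub>m n n) (- phi_mat \<zeta> m r) =
      four_block_mat (adj R11 * phi_mat \<zeta> m r) (adj R21 * - phi_mat \<zeta> m r)
        (adj R12 * phi_mat \<zeta> m r) (adj R22 * - phi_mat \<zeta> m r)"
    using ac c by (simp add: mult_four_block_mat[of _ n n _ n _ n _ _ n _ n] mat_dim_simps)
  show ?thesis
    unfolding 1 unfolding R_mat_eq J_mat_def
    using mult_four_block_mat[OF mult_carrier_mat[OF ac(1) c(5)] mult_carrier_mat[OF ac(3) uminus_carrier_mat[OF c(5)]]
        mult_carrier_mat[OF ac(2) c(5)] mult_carrier_mat[OF ac(4) uminus_carrier_mat[OF c(5)]] c(1-4)]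
    by (simp only: R_block_forms)
qed

lemma R_inv_R: "R_inv * R_mat \<zeta> m r = 1\<^sub>m (n + n)"
proof -
  note [simp] = carrier_matD[OF R_mat_carrier]
  have "R_inv * R_mat \<zeta> m r = - J_mat n * (adj (R_mat \<zeta> m r) *
      four_block_mat (phi_mat \<zeta> m r) (0\<^sub>m n n) (0\<^sub>m n n) (- phi_mat \<zeta> m r) * R_mat \<zeta> m r)"
    unfolding R_inv_def by (simp add: assoc_mult_mat_dim)
  then show ?thesis unfolding R_form by (simp add: mat_dim_simps J_mat_square)
qed

sublocale doubled_space "quat_conj \<zeta> \<xi>" n "psi_mat \<zeta> m r" "phi_mat \<zeta> m r" "R_mat \<zeta> m r" R_inv
proof
  show "R_mat \<zeta> m r \<in> carrier_mat (n + n) (n + n)" by (rule R_mat_carrier)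
  show "R_inv \<in> carrier_mat (n + n) (n + n)" by (rule R_inv_carrier)
  show "R_inv * R_mat \<zeta> m r = 1\<^sub>m (n + n)" by (rule R_inv_R)
  show inv: "R_mat \<zeta> m r * R_inv = 1\<^sub>m (n + n)"
    by (rule mult_one_mat_commute[OF R_inv_carrier R_mat_carrier R_inv_R])
  note [simp] = carrier_matD[OF R_mat_carrier]
  let ?P = "four_block_mat (psi_mat \<zeta> m r) (0\<^sub>m n n) (0\<^sub>m n n) (- psi_mat \<zeta> m r)"
  let ?F = "four_block_mat (phi_mat \<zeta> m r) (0\<^sub>m n n) (0\<^sub>m n n) (- phi_mat \<zeta> m r)"
  have FP: "?F * ?P = 1\<^sub>m (n + n)"
    using psi_carrier phi_carrier
    by (simp add: mult_four_block_mat[of _ n n _ n _ n _ _ n _ n] mat_dim_simps phi_psi)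
  \<comment> \<open>Inserting \<open>?F * ?P = 1\<close> makes the product for \<open>R_inv\<close>
    visible, and \<open>?P\<close> is what is left.\<close>
  have "R_mat \<zeta> m r * - J_mat n * adj (R_mat \<zeta> m r) = R_mat \<zeta> m r * - J_mat n * adj (R_mat \<zeta> m r) * (?F * ?P)"
    unfolding FP by simp
  also have "\<dots> = R_mat \<zeta> m r * R_inv * ?P" by (simp add: R_inv_def assoc_mult_mat_dim)
  finally show "R_mat \<zeta> m r * - J_mat n * adj (R_mat \<zeta> m r) = ?P" unfolding inv by simp
qed

end

section \<open>Witt index and representatives\<close>

context doubling_setup
begin

lemma quat_adjoint_eq: "quat_adjoint \<zeta> \<xi> X = adj X"
  by (simp add: quat_adjoint_def adj_def)

lemma gram_zero:
  "dim_col Z = n \<Longrightarrow> gram (0\<^sub>m a n) Z = 0\<^sub>m a (dim_row Z)" "dim_col Z = n \<Longrightarrow> gram Z (0\<^sub>m a n) = 0\<^sub>m (dim_row Z) a"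
  by (simp_all add: gram_def mat_dim_simps)

lemma isotropic_append_rowsD:
  assumes "gram (X @\<^sub>r x) (X @\<^sub>r x) = 0\<^sub>m (k + l) (k + l)" "X \<in> carrier_mat k n" "x \<in> carrier_mat l n"
  shows "gram X X = 0\<^sub>m k k" "gram X x = 0\<^sub>m k l" "gram x x = 0\<^sub>m l l"
proof -
  have "gram (X @\<^sub>r x) (X @\<^sub>r x) = gram (0\<^sub>m k n @\<^sub>r 0\<^sub>m l n) (0\<^sub>m k n @\<^sub>r 0\<^sub>m l n)"
    unfolding assms(1) zero_append by (simp add: gram_zero)
  note * = gram_append_rows_eqD[OF this assms(2) zero_carrier_mat assms(3) zero_carrier_mat]
  show "gram X X = 0\<^sub>m k k" "gram X x = 0\<^sub>m k l" "gram x x = 0\<^sub>m l l"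
    using *(1,2,4) by (simp_all add: gram_zero)
qed

text \<open>By Witt's theorem the span of \<open>m\<close> isotropic rows can be moved to the last coordinate block \<open>F\<close>;
  a further isotropic row orthogonal to it lies in \<open>F\<close>, as the middle block is anisotropic.\<close>

lemma isotropic_rows_le:
  assumes X: "X \<in> carrier_mat l n" "full_row_rank X" "gram X X = 0\<^sub>m l l"
  shows "l \<le> m"
proof (rule ccontr)
  assume "\<not> l \<le> m"
  then have l: "l = (m + 1) + (l - (m + 1))" by simp
  obtain X1 Y where X1: "X1 \<in> carrier_mat (m + 1) n" "Y \<in> carrier_mat (l - (m + 1)) n" "X = X1 @\<^sub>r Y"
    using append_rows_split[of X "m + 1" "l - (m + 1)"] X(1) l by (metis carrier_matD)
  have fX1: "full_row_rank X1" using full_row_rank_appendD(1)[OF X(2)[unfolded X1(3)] X1(1,2)] .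
  have gX1: "gram X1 X1 = 0\<^sub>m (m + 1) (m + 1)"
    by (rule isotropic_append_rowsD(1)[of X1 Y _ "l - (m + 1)"]) (use X(3) X1 l in auto)
  obtain K w where K: "K \<in> carrier_mat m n" "w \<in> carrier_mat 1 n" "X1 = K @\<^sub>r w"
    using append_rows_split[of X1 m 1] X1(1) by (metis carrier_matD)
  note iso = isotropic_append_rowsD[OF gX1[unfolded K(3)] K(1,2)]
  have fK: "full_row_rank K" using full_row_rank_appendD(1)[OF fX1[unfolded K(3)] K(1,2)] .
  define F where "F = append_cols (0\<^sub>m m m) (append_cols (0\<^sub>m m r) (1\<^sub>m m) :: 'a mat)"
  have dimF [simp]: "dim_row F = m" "dim_col F = n" by (simp_all add: F_def)
  have F: "F \<in> carrier_mat m n" by (rule carrier_matI) simp_all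
  have fF: "full_row_rank F"
    by (rule full_row_rankI[of _ "0\<^sub>m m m @\<^sub>r (0\<^sub>m r m @\<^sub>r 1\<^sub>m m)" m])
      (simp_all add: F_def append_cols_mult_append_rows mat_dim_simps)
  \<comment> \<open>Pairing with \<open>F\<close> reads off the first block of coordinates, so a
    vector orthogonal to \<open>F\<close> has no component there.\<close>
  have gF: "gram F (append_cols u (append_cols v x)) = - adj u"
    if "u \<in> carrier_mat k m" "v \<in> carrier_mat k r" "x \<in> carrier_mat k m" for u v x k
    using that unfolding gram_def unfolding F_def psi_mat_def
    by (simp add: append_cols_mult_append_rows mult_append_cols append_cols_add
        adj_append_cols mat_dim_simps)
  have "gram F F = 0\<^sub>m m m"
    using gF[of "0\<^sub>m m m" m "0\<^sub>m m r" "1\<^sub>m m"] unfolding F_def[symmetric] by (simp add: mat_dim_simps)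
  then have "gram K K = gram F F" using iso(1) by simp
  then obtain g where g: "g \<in> isometries" "K * g = F"
    by (rule witt_extension[OF K(1) F fK fF])
  note [simp] = carrier_matD[OF isometriesD(1)[OF g(1)]] carrier_matD[OF K(1)] carrier_matD[OF K(2)]
  have wgd: "dim_row (w * g) = 1" "dim_col (w * g) = n" by simp_all
  obtain u v' where u: "u \<in> carrier_mat 1 m" "v' \<in> carrier_mat 1 (r + m)" "w * g = append_cols u v'"
    by (rule append_cols_split[OF wgd(2), unfolded wgd(1)])
  obtain v x where v: "v \<in> carrier_mat 1 r" "x \<in> carrier_mat 1 m" "v' = append_cols v x"
    using append_cols_split[of v' r m] u(2) by (metis carrier_matD)
  note [simp] = carrier_matD[OF u(1)] carrier_matD[OF v(1)] carrier_matD[OF v(2)]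
  have wg: "w * g = append_cols u (append_cols v x)" using u v by simp
  have "gram F (w * g) = 0\<^sub>m m 1" using gram_isometry[OF g(1), of K w] iso(2) g(2) by simp
  then have "- adj u = 0\<^sub>m m 1" unfolding wg gF[OF u(1) v(1,2)] .
  then have "adj u = 0\<^sub>m m 1" by (metis uminus_uminus_mat zero_add_mat_dim(6))
  then have u0: "u = 0\<^sub>m 1 m" by (simp add: adj_eq_zero_iff)
  \<comment> \<open>The hypothesis concerns the form \<zeta> on columns, while isotropy of w
    concerns \<zeta>^-1 on rows. With y = \<zeta>^-1 \<open>adj v\<close> one has
    \<open>adj y\<close> \<zeta> y = - v \<zeta>^-1 \<open>adj v\<close>, the sign coming from the
    conjugate of \<zeta>^-1.\<close>
  define y where "y = (inverse \<zeta> \<cdot>\<^sub>m 1\<^sub>m r) * adj v"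
  have y: "y \<in> carrier_mat r 1" by (rule carrier_matI) (simp_all add: y_def)
  have "gram (w * g) (w * g) = 0\<^sub>m 1 1" using gram_isometry[OF g(1), of w w] iso(3) by simp
  then have "v * (inverse \<zeta> \<cdot>\<^sub>m 1\<^sub>m r) * adj v = 0\<^sub>m 1 1"
    unfolding wg u0 gram_def unfolding psi_mat_def
    by (simp add: append_cols_mult_append_rows mult_append_cols append_cols_add
        adj_append_cols mat_dim_simps)
  then have v0: "v * y = 0\<^sub>m 1 1" by (simp add: y_def assoc_mult_mat_dim)
  have zy: "(\<zeta> \<cdot>\<^sub>m 1\<^sub>m r) * y = adj v"
    unfolding y_def
    by (subst assoc_mult_mat_dim[symmetric]) (simp_all add: smult_one_mat_simps zeta_ne_0)
  have "quat_adjoint \<zeta> \<xi> y = - v * (inverse \<zeta> \<cdot>\<^sub>m 1\<^sub>m r)"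
    by (simp add: quat_adjoint_eq y_def adj_mult adj_smult_one star_inverse quat_conj_zeta mat_dim_simps
        smult_one_mat_simps(3)[symmetric])
  then have "quat_adjoint \<zeta> \<xi> y * (\<zeta> \<cdot>\<^sub>m 1\<^sub>m r) * y = - (v * ((inverse \<zeta> \<cdot>\<^sub>m 1\<^sub>m r) * adj v))"
    using carrier_matD[OF y] by (simp add: assoc_mult_mat_dim zy uminus_mult_mat_dim)
  also have "\<dots> = 0\<^sub>m 1 1" using v0 unfolding y_def by (simp add: mat_dim_simps)
  finally have "y = 0\<^sub>m r 1" using aniso y unfolding anisotropic_block_def by blast
  then have "adj v = 0\<^sub>m r 1" using zy by (simp add: mat_dim_simps)
  then have "v = 0\<^sub>m 1 r" by (simp add: adj_eq_zero_iff)
  then have "w * g = x * F" unfolding wg u0 by (simp add: F_def mult_append_cols mat_dim_simps)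
  then have XF: "X1 * g = (1\<^sub>m m @\<^sub>r x) * F" using g(2) K(3) by (simp add: append_rows_mult)
  have "full_row_rank (X1 * g)" using full_row_rank_isometry[OF fX1 _ g(1)] X1(1) by simp
  then obtain T where T: "T \<in> carrier_mat n (m + 1)" "X1 * g * T = 1\<^sub>m (m + 1)"
    by (rule full_row_rankE) (use X1(1) in \<open>auto intro!: carrier_matI\<close>)
  \<comment> \<open>All m + 1 independent rows now lie in the span of the m rows of
    \<open>F\<close>, so the identity of size m + 1 factors through m.\<close>
  have "(1\<^sub>m m @\<^sub>r x) * (F * T) = 1\<^sub>m (m + 1)"
    using T unfolding XF by (simp add: assoc_mult_mat_dim)
  moreover have "1\<^sub>m m @\<^sub>r x \<in> carrier_mat (m + 1) m" using v(2) by (intro carrier_append_rows) auto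
  moreover have "F * T \<in> carrier_mat m (m + 1)" using F T(1) by (rule mult_carrier_mat)
  ultimately have "m + 1 \<le> m" using mult_eq_one_mat_le by blast
  then show False by simp
qed

section \<open>The Lagrangians of the representatives\<close>

definition tau_corner :: "nat \<Rightarrow> 'a mat" where
  "tau_corner t = block_mat [[0\<^sub>m m m, 0\<^sub>m m r, e_mat m t], [0\<^sub>m r m, 0\<^sub>m r r, 0\<^sub>m r m],
     [e_mat m t, 0\<^sub>m m r, 0\<^sub>m m m]]"

text \<open>With \<open>tau_right\<close> this solves (A | B) R = (C | 1), where the right-hand side
  is the lower half of \<tau>_t and C its corner. In the middle block the solution has equal entries
  x in both halves with -2 x \<zeta>^-1 = 1, whence x = -\<zeta>/2.\<close>

definition "tau_left t = block_mat [[0\<^sub>m m m, 0\<^sub>m m r, 1\<^sub>m m], [0\<^sub>m r m, (- (1 / 2 * \<zeta>)) \<cdot>\<^sub>m 1\<^sub>m r, 0\<^sub>m r m],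
  [e_mat m t, 0\<^sub>m m r, 0\<^sub>m m m]]"
definition "tau_right t = block_mat [[- e_mat m t, 0\<^sub>m m r, 0\<^sub>m m m],
  [0\<^sub>m r m, (- (1 / 2 * \<zeta>)) \<cdot>\<^sub>m 1\<^sub>m r, 0\<^sub>m r m], [0\<^sub>m m m, 0\<^sub>m m r, 1\<^sub>m m]]"

lemma e_mat_factor:
  assumes "t \<le> m"
  shows "e_mat m t = (1\<^sub>m t @\<^sub>r 0\<^sub>m (m - t) t) * (append_cols (1\<^sub>m t) (0\<^sub>m t (m - t)) :: 'a mat)"
  unfolding e_mat_def
  by (simp add: four_block_mat_eq_append append_rows_mult mat_dim_simps zero_append)

lemma dim_e_mat [simp]: "t \<le> m \<Longrightarrow> dim_row (e_mat m t) = m" "t \<le> m \<Longrightarrow> dim_col (e_mat m t) = m"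
  by (simp_all add: e_mat_def)

lemma adj_e_mat: "t \<le> m \<Longrightarrow> adj (e_mat m t) = e_mat m t"
  by (simp add: e_mat_factor adj_simps)

lemma dim_tau_blocks [simp]:
  assumes "t \<le> m"
  shows "dim_row (tau_corner t) = n" "dim_col (tau_corner t) = n" "dim_row (tau_left t) = n"
    "dim_col (tau_left t) = n" "dim_row (tau_right t) = n" "dim_col (tau_right t) = n"
  using assms unfolding tau_corner_def tau_left_def tau_right_def by (simp_all del: block_mat.simps)

lemma adj_tau_corner: "t \<le> m \<Longrightarrow> adj (tau_corner t) = tau_corner t"
  unfolding tau_corner_def by (simp add: adj_block3 adj_e_mat del: block_mat.simps)

lemma tau_mat_eq:
  assumes "t \<le> m"
  shows "tau_mat \<zeta> \<xi> m r t = four_block_mat (1\<^sub>m n) (0\<^sub>m n n) (tau_corner t) (1\<^sub>m n)"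
  unfolding tau_mat_def tau_corner_def block3_one[symmetric] block3_zero[symmetric] quat_adjoint_eq
  by (subst block6_eq_four_block) (use assms in \<open>simp_all add: adj_e_mat del: block_mat.simps\<close>)

text \<open>A lower unitriangular matrix with corner C preserves the form exactly when C is
  hermitian, and the corner is hermitian because \<open>e_mat\<close> is real and symmetric.\<close>

lemma tau_mat_isometry:
  assumes "t \<le> m"
  shows "tau_mat \<zeta> \<xi> m r t \<in> big.isometries"
proof -
  let ?C = "tau_corner t"
  have C: "?C \<in> carrier_mat n n" using assms by (intro carrier_matI) simp_all
  have mJ: "- J_mat n = (four_block_mat (0\<^sub>m n n) (1\<^sub>m n) (- 1\<^sub>m n) (0\<^sub>m n n) :: 'a mat)"
    unfolding J_mat_def by (rule eq_matI) auto
  have a: "adj (tau_mat \<zeta> \<xi> m r t) = four_block_mat (1\<^sub>m n) ?C (0\<^sub>m n n) (1\<^sub>m n)"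
    unfolding tau_mat_eq[OF assms] using C
    by (subst adj_four_block_mat[of _ n n _ n _ n]) (simp_all add: adj_tau_corner[OF assms])
  have "tau_mat \<zeta> \<xi> m r t * - J_mat n = four_block_mat (0\<^sub>m n n) (1\<^sub>m n) (- 1\<^sub>m n) ?C"
    unfolding tau_mat_eq[OF assms] mJ using C
    by (simp add: mult_four_block_mat[of _ n n _ n _ n _ _ n _ n] mat_dim_simps)
  then have "tau_mat \<zeta> \<xi> m r t * - J_mat n * adj (tau_mat \<zeta> \<xi> m r t) = - J_mat n"
    unfolding a mJ using C
    by (simp add: mult_four_block_mat[of _ n n _ n _ n _ _ n _ n] mat_dim_simps)
  moreover have "tau_mat \<zeta> \<xi> m r t \<in> carrier_mat (n + n) (n + n)"
    unfolding tau_mat_eq[OF assms] by (rule four_block_carrier_mat) auto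
  ultimately show ?thesis by (simp add: big.isometries_def)
qed

lemma tau_mat_lagr:
  assumes t: "t \<le> m"
  shows "lagr (tau_mat \<zeta> \<xi> m r t) (tau_left t) (tau_right t)"
proof -
  have c: "tau_left t \<in> carrier_mat n n" "tau_right t \<in> carrier_mat n n" "tau_corner t \<in> carrier_mat n n"
    using t by (auto intro!: carrier_matI)
  note [simp] = carrier_matD[OF c(1)] carrier_matD[OF c(2)] carrier_matD[OF c(3)]
  note simps = block3_simps zeta_ne_0 mult.assoc half_add_half
  have 1: "tau_left t * R11 + tau_right t * R21 = tau_corner t"
    unfolding tau_left_def tau_right_def R11_def R21_def tau_corner_def using t
    by (simp add: simps del: block_mat.simps)
  have 2: "tau_left t * R12 + tau_right t * R22 = 1\<^sub>m n"
    unfolding tau_left_def tau_right_def R12_def R22_def using t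
    by (simp add: simps block3_one del: block_mat.simps)
  have "append_cols (tau_left t) (tau_right t) * R_mat \<zeta> m r = append_cols (tau_corner t) (1\<^sub>m n)"
    unfolding R_mat_eq
    by (simp add: four_block_mat_eq_append append_cols_mult_append_rows mult_append_cols append_cols_add 1 2)
  also have "\<dots> = lower_half n * tau_mat \<zeta> \<xi> m r t"
    unfolding lower_half_def tau_mat_eq[OF t]
    by (simp add: four_block_mat_eq_append append_cols_mult_append_rows mult_append_cols append_cols_add mat_dim_simps)
  finally have "lower_half n * tau_mat \<zeta> \<xi> m r t * R_inv =
      append_cols (tau_left t) (tau_right t) * (R_mat \<zeta> m r * R_inv)"
    by (simp add: assoc_mult_mat_dim[symmetric])
  then show ?thesis using c(1,2) by (simp add: lagr_def RQ)
qed

text \<open>\<open>tau_left t\<close> is an invertible matrix \<open>V\<close>, a scaled permutation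
  of the blocks, times diag[e_t, 1, 1]. The latter is \<open>P * P'\<close> with inner dimension t +
  r + m, and \<open>P' * P = 1\<close>.\<close>

lemma tau_left_rank:
  assumes t: "t \<le> m"
  shows "has_rank (tau_left t) (t + (r + m))"
proof -
  define E where "E = (1\<^sub>m t @\<^sub>r 0\<^sub>m (m - t) t :: 'a mat)"
  define E' where "E' = (append_cols (1\<^sub>m t) (0\<^sub>m t (m - t)) :: 'a mat)"
  have [simp]: "dim_row E = m" "dim_col E = t" "dim_row E' = t" "dim_col E' = m"
    using t by (simp_all add: E_def E'_def)
  have E: "E * E' = e_mat m t" "E' * E = 1\<^sub>m t"
    using t by (simp_all add: E_def E'_def e_mat_factor append_cols_mult_append_rows mat_dim_simps)
  define P where "P = block_mat [[E, 0\<^sub>m m r, 0\<^sub>m m m], [0\<^sub>m r t, 1\<^sub>m r, 0\<^sub>m r m], [0\<^sub>m m t, 0\<^sub>m m r, 1\<^sub>m m]]"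
  define P' where "P' = block_mat [[E', 0\<^sub>m t r, 0\<^sub>m t m], [0\<^sub>m r m, 1\<^sub>m r, 0\<^sub>m r m], [0\<^sub>m m m, 0\<^sub>m m r, 1\<^sub>m m]]"
  define y where "y = - (1 / 2 * \<zeta>)"
  have y: "y \<noteq> 0" using zeta_ne_0 by (simp add: y_def)
  define V where "V = block_mat [[0\<^sub>m m m, 0\<^sub>m m r, 1\<^sub>m m], [0\<^sub>m r m, y \<cdot>\<^sub>m 1\<^sub>m r, 0\<^sub>m r m], [1\<^sub>m m, 0\<^sub>m m r, 0\<^sub>m m m]]"
  define V' where "V' = block_mat [[0\<^sub>m m m, 0\<^sub>m m r, 1\<^sub>m m], [0\<^sub>m r m, inverse y \<cdot>\<^sub>m 1\<^sub>m r, 0\<^sub>m r m],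
    [1\<^sub>m m, 0\<^sub>m m r, 0\<^sub>m m m]]"
  have [simp]: "dim_row P = n" "dim_col P = t + (r + m)" "dim_row P' = t + (r + m)" "dim_col P' = n"
    "dim_row V = n" "dim_col V = n" "dim_row V' = n" "dim_col V' = n"
    unfolding P_def P'_def V_def V'_def by (simp_all del: block_mat.simps)
  have PP: "P' * P = 1\<^sub>m (t + (r + m))"
    unfolding P_def P'_def by (simp add: block3_simps E block3_one del: block_mat.simps)
  have VV: "V' * V = 1\<^sub>m n"
    unfolding V_def V'_def using y by (simp add: block3_simps block3_one del: block_mat.simps)
  have "P * P' = block_mat [[e_mat m t, 0\<^sub>m m r, 0\<^sub>m m m], [0\<^sub>m r m, 1\<^sub>m r, 0\<^sub>m r m], [0\<^sub>m m m, 0\<^sub>m m r, 1\<^sub>m m]]"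
    unfolding P_def P'_def using t by (simp add: block3_simps E del: block_mat.simps)
  then have "V * (P * P') = tau_left t"
    unfolding V_def tau_left_def y_def[symmetric] using t by (simp add: block3_simps del: block_mat.simps)
  then have A: "tau_left t = V * P * P'" by (simp add: assoc_mult_mat_dim)
  have "P' * V' * tau_left t * P = P' * (V' * V) * (P * (P' * P))"
    unfolding A by (simp add: assoc_mult_mat_dim)
  also have "\<dots> = 1\<^sub>m (t + (r + m))" unfolding VV PP by (simp add: PP)
  finally have B: "P' * V' * tau_left t * P = 1\<^sub>m (t + (r + m))" .
  have "V * P \<in> carrier_mat n (t + (r + m))" "P' \<in> carrier_mat (t + (r + m)) n"
    "P' * V' \<in> carrier_mat (t + (r + m)) n" "P \<in> carrier_mat n (t + (r + m))"
    by (rule carrier_matI; simp)+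
  then show ?thesis unfolding has_rank_def dim_tau_blocks[OF t] using A B by blast
qed

lemma lagr_rank:
  assumes g: "g \<in> big.isometries" "lagr g A B"
  obtains t where "t \<le> m" "has_rank A (t + (r + m))"
proof -
  have c: "A \<in> carrier_mat n n" "B \<in> carrier_mat n n" using g(2) by (auto simp: lagr_def)
  obtain s l A1 A2 where *: "s + 2 * l = n" "has_rank A (s + l)"
    "A1 \<in> carrier_mat s n" "A2 \<in> carrier_mat l n" "full_row_rank (A1 @\<^sub>r A2)" "gram A2 A2 = 0\<^sub>m l l"
    using aligned_lagrangian[OF c lagr_full_row_rank[OF g] lagr_gram[OF g]] by metis
  have "l \<le> m" by (rule isotropic_rows_le[OF *(4) full_row_rank_appendD(2)[OF *(5,3,4)] *(6)])
  \<comment> \<open>From s + 2 l = n = 2 m + r the rank is n - l, so the index of the representative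
    is t = m - l; the bound l \<le> m makes the subtraction exact.\<close>
  then have "s + l = (m - l) + (r + m)" using *(1) by simp
  then show thesis using that[of "m - l"] *(2) by simp
qed

section \<open>Identification with the groups of the statement\<close>

lemma G_big_eq: "G_big \<zeta> \<xi> n = big.isometries"
  unfolding G_big_def isometry_group_def big.isometries_eq quat_adjoint_eq
  using big.isometry_invertible unfolding big.isometries_eq by auto

text \<open>\<open>isometries_eq\<close> passes from the form on rows to the form on columns, and
  invertibility follows from the explicit inverse of an isometry.\<close>

lemma G_small_eq: "G_small \<zeta> \<xi> m r = isometries"
  unfolding G_small_def isometry_group_def isometries_eq quat_adjoint_eq
  using isometry_invertible unfolding isometries_eq by auto

text \<open>\<open>lower_half n * g\<close> is the lower block row (c | d) of g and
  \<open>d * lower_half n\<close> is (0 | d), so equality means c = 0 and leaves the upper block row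
  free.\<close>

lemma siegel_parabolic_eq: "siegel_parabolic \<zeta> \<xi> n = parabolic"
proof -
  have "(\<exists>a b d. a \<in> carrier_mat n n \<and> b \<in> carrier_mat n n \<and> d \<in> carrier_mat n n \<and>
      g = four_block_mat a b (0\<^sub>m n n) d) \<longleftrightarrow> (\<exists>d \<in> carrier_mat n n. lower_half n * g = d * lower_half n)"
    (is "?L \<longleftrightarrow> ?R") if g: "g \<in> carrier_mat (n + n) (n + n)" for g :: "'a mat"
  proof
    have dZ: "d * lower_half n = append_cols (0\<^sub>m n n) d" if "d \<in> carrier_mat n n" for d :: "'a mat"
      using that by (simp add: lower_half_def mult_append_cols mat_dim_simps)
    show ?R if ?L
    proof -
      obtain a b d where *: "a \<in> carrier_mat n n" "b \<in> carrier_mat n n" "d \<in> carrier_mat n n"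
        "g = four_block_mat a b (0\<^sub>m n n) d" using \<open>?L\<close> by blast
      have "lower_half n * g = append_cols (0\<^sub>m n n) d"
        using *(1-3) unfolding *(4) lower_half_def
        by (simp add: four_block_mat_eq_append append_cols_mult_append_rows mult_append_cols append_cols_add
            mat_dim_simps)
      then show ?R using dZ *(3) by metis
    qed
    show ?L if ?R
    proof -
      obtain d where d: "d \<in> carrier_mat n n" "lower_half n * g = d * lower_half n" using \<open>?R\<close> by blast
      obtain X Y where XY: "X \<in> carrier_mat n (n + n)" "Y \<in> carrier_mat n (n + n)" "g = X @\<^sub>r Y"
        using append_rows_split[of g n n] g by (metis carrier_matD)
      obtain a b where ab: "a \<in> carrier_mat n n" "b \<in> carrier_mat n n" "X = append_cols a b"
        using append_cols_split[of X n n] XY(1) by (metis carrier_matD)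
      have "lower_half n * g = Y"
        using XY by (simp add: lower_half_def append_cols_mult_append_rows mat_dim_simps)
      then have "Y = append_cols (0\<^sub>m n n) d" using d dZ by simp
      then have "g = four_block_mat a b (0\<^sub>m n n) d"
        unfolding XY(3) ab(3) using ab(1,2) d(1) by (simp add: four_block_mat_eq_append)
      then show ?L using ab(1,2) d(1) by blast
    qed
  qed
  then show ?thesis
    unfolding siegel_parabolic_def parabolic_def G_big_eq using big.isometriesD(1) by blast
qed

lemma doubling_eq:
  assumes "g \<in> isometries" "h \<in> isometries"
  shows "doubling \<zeta> m r g h = dbl g h"
proof -
  have n2: "2 * (2 * m + r) = n + n" by simp
  \<comment> \<open>The inverse in the matrix ring is a definite description, so uniqueness of the
    two-sided inverse has to be shown along with its existence.\<close>
  have "inv\<^bsub>ring_mat TYPE('a) (n + n) ()\<^esub> (R_mat \<zeta> m r) = R_inv"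
    unfolding m_inv_def ring_mat_simps
  proof (rule the_equality)
    show "R_inv \<in> carrier_mat (n + n) (n + n) \<and> R_mat \<zeta> m r * R_inv = 1\<^sub>m (n + n) \<and>
        R_inv * R_mat \<zeta> m r = 1\<^sub>m (n + n)" using Q_carrier RQ QR by blast
    fix y assume y: "y \<in> carrier_mat (n + n) (n + n) \<and> R_mat \<zeta> m r * y = 1\<^sub>m (n + n) \<and> y * R_mat \<zeta> m r = 1\<^sub>m (n + n)"
    have "y = y * (R_mat \<zeta> m r * R_inv)" unfolding RQ using y right_mult_one_mat by metis
    also have "\<dots> = (y * R_mat \<zeta> m r) * R_inv"
      using carrier_matD[OF conjunct1[OF y]] by (simp add: assoc_mult_mat_dim)
    finally show "y = R_inv" using y by simp
  qed
  moreover have "diag_block_mat [g, h] = pair g h"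
    using isometriesD(1)[OF assms(1)] isometriesD(1)[OF assms(2)]
    by (subst diag_block_mat.simps(2)) (simp only: diag_block_mat_singleton Let_def pair_def carrier_matD)
  ultimately show ?thesis unfolding doubling_def n2 dbl_def by simp
qed

lemma doubled_subgroup_eq: "doubled_subgroup \<zeta> \<xi> m r = doubled_group"
  unfolding doubled_subgroup_def doubled_group_def G_small_eq
  using doubling_eq by (intro Collect_cong) metis

lemma tau_complete_double_coset_reps:
  "complete_double_coset_reps parabolic big.isometries doubled_group {tau_mat \<zeta> \<xi> m r t | t. t \<le> m}"
  unfolding complete_double_coset_reps_def
proof
  let ?D = "\<lambda>g. double_coset parabolic g doubled_group"
  let ?T = "{tau_mat \<zeta> \<xi> m r t | t. t \<le> m}"
  note tau = tau_mat_isometry tau_mat_lagr tau_left_rank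
  show sub: "?T \<subseteq> big.isometries" using tau_mat_isometry by blast
  show "bij_betw ?D ?T (?D ` big.isometries)"
    unfolding bij_betw_def
  proof
    show "inj_on ?D ?T"
    proof (rule inj_onI)
      fix x y assume "x \<in> ?T" "y \<in> ?T" and eq: "?D x = ?D y"
      then obtain t s where ts: "t \<le> m" "s \<le> m" "x = tau_mat \<zeta> \<xi> m r t" "y = tau_mat \<zeta> \<xi> m r s" by blast
      \<comment> \<open>Equal double cosets bound each of the two ranks by the other, and the rank
        determines the index.\<close>
      have "t + (r + m) \<le> s + (r + m)"
        by (rule double_coset_rank_le[OF tau[OF ts(2)] tau[OF ts(1)]]) (use eq ts in simp)
      moreover have "s + (r + m) \<le> t + (r + m)"
        by (rule double_coset_rank_le[OF tau[OF ts(1)] tau[OF ts(2)]]) (use eq ts in simp)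
      ultimately show "x = y" using ts by simp
    qed
    have "\<exists>x \<in> ?T. ?D g = ?D x" if g: "g \<in> big.isometries" for g
    proof -
      obtain A B where L: "lagr g A B" using lagr_exists big.isometriesD(1)[OF g] by blast
      obtain t where t: "t \<le> m" "has_rank A (t + (r + m))" using lagr_rank[OF g L] .
      have "?D g = ?D (tau_mat \<zeta> \<xi> m r t)"
        using same_rank_double_coset_subset[OF g L t(2) tau[OF t(1)]]
          same_rank_double_coset_subset[OF tau[OF t(1)] g L t(2)] by blast
      then show ?thesis using t(1) by blast
    qed
    then show "?D ` ?T = ?D ` big.isometries" using sub by blast
  qed
qed

end

theorem proposition4p3:
  fixes \<alpha> \<beta> :: int and \<zeta> \<xi> :: "'b::{division_ring,ring_char_0}" and m r n :: nat
  assumes "definite_quaternion_algebra \<alpha> \<beta> \<zeta> \<xi>"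
    and "m > 1" and "n = 2 * m + r"
    and "anisotropic_block \<zeta> \<xi> r"
  shows "complete_double_coset_reps (siegel_parabolic \<zeta> \<xi> n) (G_big \<zeta> \<xi> n)
    (doubled_subgroup \<zeta> \<xi> m r) {tau_mat \<zeta> \<xi> m r t | t. t \<le> m}"
proof -
  interpret doubling_setup \<alpha> \<beta> \<zeta> \<xi> m r
    by unfold_locales (use assms in auto)
  \<comment> \<open>Brings the dimension to the shape used by \<open>doubling_setup\<close>, so that
    its equations apply.\<close>
  have n: "n = m + (r + m)" using assms(3) by simp
  show ?thesis
    unfolding n siegel_parabolic_eq G_big_eq doubled_subgroup_eq by (rule tau_complete_double_coset_reps)
qed

end
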